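(* Let $0<p<q<1$, and let $H$ be a probability measure on $\mathbb R$ whose cumulative distribution function, also denoted $H$, is continuous and has a positive derivative $h$ on the interval $[H^{-1}(p)-\epsilon,\ H^{-1}(q)+\epsilon]$ for some $\epsilon>0$. For each $a>0$ let $P_a\sim \mathrm{DP}(a,H)$ be a Dirichlet process on $\mathbb R$ with concentration parameter $a$ and base measure $H$, and let $$Q_a=\sqrt a\,\big(P_a^{-1}-H^{-1}\big)$$ be the Dirichlet quantile process. Then, as $a\to\infty$, $$Q_a(\cdot)\ \xrightarrow{d}\ Q(\cdot):=-\frac{B_\lambda(\cdot)}{h(H^{-1}(\cdot))}\quad\text{in } D[p,q],$$ where $B_\lambda$ is a Brownian bridge on $[0,1]$. That is, the limiting process $Q$ is a Gaussian process with zero mean and covariance function $$\mathrm{Cov}(Q(s),Q(t))=\frac{\min(s,t)-st}{h(H^{-1}(s))\,h(H^{-1}(t))},\qquad s,t\in[p,q].$$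
   Context: Dirichlet process: let $(\mathfrak X,\mathcal A)$ be a measurable space, $H$ a probability measure on it, and $a>0$. A random probability measure $P_a=\{P_a(A)\}_{A\in\mathcal A}$ is a Dirichlet process with parameters $a$ and $H$, written $P_a\sim\mathrm{DP}(a,H)$, if for every finite measurable partition $\{A_1,\dots,A_k\}$ of $\mathfrak X$ the vector $(P_a(A_1),\dots,P_a(A_k))$ has the Dirichlet distribution with parameters $(aH(A_1),\dots,aH(A_k))$, with the convention that $P_a(A_j)=0$ almost surely if $H(A_j)=0$. The Dirichlet distribution with parameters $a_1,\dots,a_k>0$ is the law on the simplex $\{y_i\ge 0,\ \sum_{i=1}^k y_i=1\}$ with density $\frac{\Gamma(\sum_{i=1}^k a_i)}{\prod_{i=1}^k\Gamma(a_i)}\prod_{i=1}^k y_i^{a_i-1}$. Here $\mathfrak X=\mathbb R$ with its Borel sets. The same letter denotes a probability measure and its cumulative distribution function: $P_a(t)=P_a((-\infty,t])$, $H(t)=H((-\infty,t])$. The inverse of a distribution function $F$ is $F^{-1}(t)=\inf\{x: F(x)\ge t\}$. The Brownian bridge $B_\lambda$ is the centered Gaussian process on $[0,1]$ with $\mathrm{Cov}(B_\lambda(s),B_\lambda(t))=\min(s,t)-st$ and continuous sample paths. $D[p,q]$ is the Skorokhod space on $[p,q]$ with the Skorokhod topology, and $\xrightarrow{d}$ denotes convergence in distribution.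
   Formalization: The derivative h is additionally assumed continuous on [H^{-1}(p), H^{-1}(q)]; otherwise Q almost surely lacks one-sided limits and is not in D[p,q]. D[p,q] is taken as left-continuous paths with right limits, as quantile functions are. *)

theory Defs
  imports "HOL-Probability.Probability"
begin

section \<open>Dirichlet processes\<close>

text \<open>
  Lebesgue measure on the hyperplane where the coordinates in \<open>I\<close> sum to 1, parametrised by all
  coordinates except the last one. (Eliminating another coordinate gives the same measure.) If \<open>I\<close>
  is a singleton, this is the point mass at 1.
\<close>

definition sum_one_lebesgue :: "nat set \<Rightarrow> (nat \<Rightarrow> real) measure" where
  "sum_one_lebesgue I =
     distr (\<Pi>\<^sub>M i\<in>I - {Max I}. lborel) (\<Pi>\<^sub>M i\<in>I. borel)
       (\<lambda>y. y(Max I := 1 - (\<Sum>i\<in>I - {Max I}. y i)))"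

text \<open>Meaningful for finite nonempty \<open>I\<close> and \<open>\<alpha> i > 0\<close> for all \<open>i \<in> I\<close>.\<close>

definition dirichlet_distribution :: "nat set \<Rightarrow> (nat \<Rightarrow> real) \<Rightarrow> (nat \<Rightarrow> real) measure" where
  "dirichlet_distribution I \<alpha> =
     density (sum_one_lebesgue I)
       (\<lambda>y. ennreal (if \<forall>i\<in>I. 0 \<le> y i
                     then Gamma (\<Sum>i\<in>I. \<alpha> i) / (\<Prod>i\<in>I. Gamma (\<alpha> i))
                          * (\<Prod>i\<in>I. y i powr (\<alpha> i - 1))
                     else 0))"

text \<open>
  \<open>P\<close> is a random probability measure on the measurable space underlying \<open>H\<close>, defined on the
  probability space \<open>M\<close>. Cells of the partition with \<open>H\<close>-measure 0 would give zero parameters; they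
  receive \<open>P\<close>-mass 0 almost surely, and the remaining cells have a Dirichlet distribution.
\<close>

definition dirichlet_process ::
  "'w measure \<Rightarrow> real \<Rightarrow> 'x measure \<Rightarrow> ('w \<Rightarrow> 'x measure) \<Rightarrow> bool" where
  "dirichlet_process M a H P \<longleftrightarrow>
     prob_space M \<and> prob_space H \<and> a > 0 \<and> P \<in> measurable M (prob_algebra H) \<and>
     (\<forall>(k::nat) A. (\<forall>i<k. A i \<in> sets H) \<and> disjoint_family_on A {..<k} \<and>
                   (\<Union>i<k. A i) = space H \<longrightarrow>
        (let J = {i. i < k \<and> measure H (A i) \<noteq> 0} in
           (\<forall>i\<in>{..<k} - J. AE \<omega> in M. measure (P \<omega>) (A i) = 0) \<and>
           distr M (\<Pi>\<^sub>M i\<in>J. borel) (\<lambda>\<omega>. \<lambda>i\<in>J. measure (P \<omega>) (A i)) =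
             dirichlet_distribution J (\<lambda>i. a * measure H (A i))))"

section \<open>Quantile functions\<close>

definition quantile :: "real measure \<Rightarrow> real \<Rightarrow> real" where
  "quantile F t = Inf {x. cdf F x \<ge> t}"

section \<open>The Skorokhod space\<close>

text \<open>
  Quantile functions are left-continuous with right limits. So paths on \<open>[p, q]\<close> are taken here to
  be left-continuous with right limits, which makes the quantile process a random element of this
  space. The map \<open>t \<mapsto> p + q - t\<close> identifies it, together with its Skorokhod metric, with the space
  of right-continuous functions with left limits. Functions are extensional, that is, they have a
  fixed arbitrary value outside \<open>[p, q]\<close>.
\<close>

definition skorokhod_paths :: "real \<Rightarrow> real \<Rightarrow> (real \<Rightarrow> real) set" where
  "skorokhod_paths p q =
     {f \<in> extensional {p..q}.
        (\<forall>t\<in>{p<..q}. (f \<longlongrightarrow> f t) (at_left t)) \<and>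
        (\<forall>t\<in>{p..<q}. \<exists>l. (f \<longlongrightarrow> l) (at_right t))}"

text \<open>Such time changes are automatically homeomorphisms of \<open>[p, q]\<close>.\<close>

definition time_changes :: "real \<Rightarrow> real \<Rightarrow> (real \<Rightarrow> real) set" where
  "time_changes p q = {\<tau>. strict_mono_on {p..q} \<tau> \<and> \<tau> ` {p..q} = {p..q}}"

definition skorokhod_close ::
  "real \<Rightarrow> real \<Rightarrow> (real \<Rightarrow> real) \<Rightarrow> (real \<Rightarrow> real) \<Rightarrow> real set" where
  "skorokhod_close p q f g =
     {e. e > 0 \<and> (\<exists>\<tau>\<in>time_changes p q. \<forall>t\<in>{p..q}. \<bar>\<tau> t - t\<bar> \<le> e \<and> \<bar>f t - g (\<tau> t)\<bar> \<le> e)}"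

definition skorokhod_dist :: "real \<Rightarrow> real \<Rightarrow> (real \<Rightarrow> real) \<Rightarrow> (real \<Rightarrow> real) \<Rightarrow> real" where
  "skorokhod_dist p q f g =
     (if f \<in> skorokhod_paths p q \<and> g \<in> skorokhod_paths p q
      then Inf (skorokhod_close p q f g) else 0)"

definition skorokhod_topology :: "real \<Rightarrow> real \<Rightarrow> (real \<Rightarrow> real) topology" where
  "skorokhod_topology p q = Metric_space.mtopology (skorokhod_paths p q) (skorokhod_dist p q)"

lemma skorokhod_path_bounded:
  assumes f: "f \<in> skorokhod_paths p q"
  obtains B where "\<And>t. t \<in> {p..q} \<Longrightarrow> \<bar>f t\<bar> \<le> B"
proof -
  have loc: "\<exists>U B. open U \<and> t \<in> U \<and> (\<forall>s\<in>U \<inter> {p..q}. \<bar>f s\<bar> \<le> B)" if t: "t \<in> {p..q}" for t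
  proof -
    have L: "\<exists>b<t. \<forall>s. b < s \<and> s < t \<and> s \<in> {p..q} \<longrightarrow> \<bar>f s\<bar> \<le> \<bar>f t\<bar> + 1"
    proof (cases "t = p")
      case True
      then show ?thesis by (intro exI[of _ "t - 1"]) auto
    next
      case False
      then have "(f \<longlongrightarrow> f t) (at_left t)" using f t by (auto simp: skorokhod_paths_def)
      then have "eventually (\<lambda>s. dist (f s) (f t) < 1) (at_left t)"
        by (rule tendstoD) simp
      then obtain b where "b < t" and b: "\<And>s. b < s \<Longrightarrow> s < t \<Longrightarrow> dist (f s) (f t) < 1"
        using eventually_at_left[of "t - 1" t] by auto
      then show ?thesis
        by (intro exI[of _ b] conjI allI impI) (auto simp: dist_real_def dest!: b)
    qed
    have R: "\<exists>c>t. \<exists>l. \<forall>s. t < s \<and> s < c \<and> s \<in> {p..q} \<longrightarrow> \<bar>f s\<bar> \<le> \<bar>l\<bar> + 1"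
    proof (cases "t = q")
      case True
      then show ?thesis by (intro exI[of _ "t + 1"]) auto
    next
      case False
      then obtain l where "(f \<longlongrightarrow> l) (at_right t)" using f t
        by (force simp: skorokhod_paths_def)
      then have "eventually (\<lambda>s. dist (f s) l < 1) (at_right t)"
        by (rule tendstoD) simp
      then obtain c where "c > t" and c: "\<And>s. t < s \<Longrightarrow> s < c \<Longrightarrow> dist (f s) l < 1"
        using eventually_at_right[of t "t + 1"] by auto
      then show ?thesis
        by (intro exI[of _ c] conjI exI[of _ l] allI impI) (auto simp: dist_real_def dest!: c)
    qed
    from L R obtain b c l where b: "b < t" "\<And>s. b < s \<Longrightarrow> s < t \<Longrightarrow> s \<in> {p..q} \<Longrightarrow> \<bar>f s\<bar> \<le> \<bar>f t\<bar> + 1"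
      and c: "c > t" "\<And>s. t < s \<Longrightarrow> s < c \<Longrightarrow> s \<in> {p..q} \<Longrightarrow> \<bar>f s\<bar> \<le> \<bar>l\<bar> + 1" by blast
    have "\<bar>f s\<bar> \<le> \<bar>f t\<bar> + \<bar>l\<bar> + 1" if "s \<in> {b<..<c} \<inter> {p..q}" for s
    proof -
      consider "s < t" | "s = t" | "s > t" by linarith
      then show ?thesis using b(2)[of s] c(2)[of s] that by cases auto
    qed
    then show ?thesis using b(1) c(1)
      by (intro exI[of _ "{b<..<c}"] exI[of _ "\<bar>f t\<bar> + \<bar>l\<bar> + 1"]) auto
  qed
  then obtain U B where U: "\<And>t. t \<in> {p..q} \<Longrightarrow> open (U t) \<and> t \<in> U t \<and>
      (\<forall>s\<in>U t \<inter> {p..q}. \<bar>f s\<bar> \<le> B t)" by metis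
  have "compact {p..q}" by simp
  then obtain C where C: "C \<subseteq> {p..q}" "finite C" "{p..q} \<subseteq> (\<Union>c\<in>C. U c)"
    by (rule compactE_image[of _ "{p..q}" U]) (use U in auto)
  have "\<bar>f t\<bar> \<le> (\<Sum>c\<in>C. \<bar>B c\<bar>)" if t: "t \<in> {p..q}" for t
  proof -
    obtain c where c: "c \<in> C" "t \<in> U c" using C t by auto
    then have "\<bar>f t\<bar> \<le> B c" using U[of c] C t by auto
    also have "\<dots> \<le> \<bar>B c\<bar>" by simp
    also have "\<dots> \<le> (\<Sum>c\<in>C. \<bar>B c\<bar>)" using c C by (intro member_le_sum) auto
    finally show ?thesis .
  qed
  then show ?thesis by (rule that)
qed

lemma time_change_id: "(\<lambda>t. t) \<in> time_changes p q"
  by (auto simp: time_changes_def strict_mono_on_def)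

lemma time_change_in: "\<tau> \<in> time_changes p q \<Longrightarrow> t \<in> {p..q} \<Longrightarrow> \<tau> t \<in> {p..q}"
  by (auto simp: time_changes_def)

lemma time_change_comp:
  assumes "\<tau> \<in> time_changes p q" "\<mu> \<in> time_changes p q"
  shows "(\<lambda>t. \<mu> (\<tau> t)) \<in> time_changes p q"
proof -
  have "(\<lambda>t. \<mu> (\<tau> t)) ` {p..q} = \<mu> ` \<tau> ` {p..q}" by auto
  moreover have "strict_mono_on {p..q} (\<lambda>t. \<mu> (\<tau> t))"
  proof (rule strict_mono_onI)
    fix r s assume rs: "r \<in> {p..q}" "s \<in> {p..q}" "r < s"
    then have "\<tau> r < \<tau> s" using assms by (auto simp: time_changes_def strict_mono_on_def)
    then show "\<mu> (\<tau> r) < \<mu> (\<tau> s)"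
      using rs assms(2) time_change_in[OF assms(1)]
      unfolding time_changes_def strict_mono_on_def by blast
  qed
  ultimately show ?thesis using assms by (auto simp: time_changes_def)
qed

lemma time_change_inverse:
  assumes "\<tau> \<in> time_changes p q"
  obtains \<mu> where "\<mu> \<in> time_changes p q" "\<And>t. t \<in> {p..q} \<Longrightarrow> \<tau> (\<mu> t) = t"
proof -
  define \<mu> where "\<mu> = inv_into {p..q} \<tau>"
  have inj: "inj_on \<tau> {p..q}" and im: "\<tau> ` {p..q} = {p..q}"
    using assms by (auto simp: time_changes_def intro: strict_mono_on_imp_inj_on)
  have "\<tau> (\<mu> t) = t" if "t \<in> {p..q}" for t
    using that im unfolding \<mu>_def by (metis f_inv_into_f)
  moreover have "\<mu> ` {p..q} = {p..q}"
    using inv_into_image_cancel[OF inj, of "{p..q}"] im unfolding \<mu>_def by simp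
  moreover have "strict_mono_on {p..q} \<mu>"
  proof (rule strict_mono_onI)
    fix r s assume rs: "r \<in> {p..q}" "s \<in> {p..q}" "r < s"
    have m: "\<mu> r \<in> {p..q}" "\<mu> s \<in> {p..q}" using rs calculation(2) by blast+
    have "\<tau> (\<mu> r) = r" "\<tau> (\<mu> s) = s" using rs calculation(1) by auto
    then show "\<mu> r < \<mu> s"
      using m rs assms unfolding time_changes_def strict_mono_on_def
      by (metis (no_types, lifting) mem_Collect_eq not_less_iff_gr_or_eq)
  qed
  ultimately show ?thesis by (intro that) (auto simp: time_changes_def)
qed

lemma time_change_left: "\<tau> \<in> time_changes p q \<Longrightarrow> p \<le> q \<Longrightarrow> \<tau> p = p"
proof -
  assume l: "\<tau> \<in> time_changes p q" and pq: "p \<le> q"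
  then obtain s where s: "s \<in> {p..q}" "\<tau> s = p"
    unfolding time_changes_def by (metis (mono_tags, lifting) atLeastAtMost_iff imageE mem_Collect_eq order_refl)
  have "\<tau> p \<ge> p" using time_change_in[OF l, of p] pq by auto
  moreover have "s = p"
  proof (rule ccontr)
    assume "s \<noteq> p"
    then have "\<tau> p < \<tau> s" using l s pq by (auto simp: time_changes_def strict_mono_on_def)
    with s \<open>\<tau> p \<ge> p\<close> show False by simp
  qed
  ultimately show "\<tau> p = p" using s by simp
qed

lemma skorokhod_closeI:
  assumes "e > 0" "\<tau> \<in> time_changes p q"
    and "\<And>t. t \<in> {p..q} \<Longrightarrow> \<bar>\<tau> t - t\<bar> \<le> e"
    and "\<And>t. t \<in> {p..q} \<Longrightarrow> \<bar>f t - g (\<tau> t)\<bar> \<le> e"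
  shows "e \<in> skorokhod_close p q f g"
  unfolding skorokhod_close_def using assms by blast

lemma skorokhod_close_nonempty:
  assumes "f \<in> skorokhod_paths p q" "g \<in> skorokhod_paths p q"
  shows "skorokhod_close p q f g \<noteq> {}"
proof -
  obtain A B where A: "\<And>t. t \<in> {p..q} \<Longrightarrow> \<bar>f t\<bar> \<le> A" and B: "\<And>t. t \<in> {p..q} \<Longrightarrow> \<bar>g t\<bar> \<le> B"
    using assms skorokhod_path_bounded by metis
  have "\<bar>f t - g t\<bar> \<le> \<bar>A\<bar> + \<bar>B\<bar> + 1" if "t \<in> {p..q}" for t
    using A[OF that] B[OF that] by linarith
  then have "\<bar>A\<bar> + \<bar>B\<bar> + 1 \<in> skorokhod_close p q f g"
    by (intro skorokhod_closeI[OF _ time_change_id]) auto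
  then show ?thesis by auto
qed

lemma skorokhod_close_sym: "skorokhod_close p q f g \<subseteq> skorokhod_close p q g f"
proof
  fix e assume "e \<in> skorokhod_close p q f g"
  then obtain \<tau> where e: "e > 0" and l: "\<tau> \<in> time_changes p q"
    "\<And>t. t \<in> {p..q} \<Longrightarrow> \<bar>\<tau> t - t\<bar> \<le> e \<and> \<bar>f t - g (\<tau> t)\<bar> \<le> e"
    by (auto simp: skorokhod_close_def)
  obtain \<mu> where m: "\<mu> \<in> time_changes p q" "\<And>t. t \<in> {p..q} \<Longrightarrow> \<tau> (\<mu> t) = t"
    using time_change_inverse[OF l(1)] by blast
  have "\<bar>\<mu> t - t\<bar> \<le> e \<and> \<bar>g t - f (\<mu> t)\<bar> \<le> e" if "t \<in> {p..q}" for t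
    using l(2)[OF time_change_in[OF m(1) that]] m(2)[OF that] by (simp add: abs_minus_commute)
  then show "e \<in> skorokhod_close p q g f"
    by (intro skorokhod_closeI[OF e m(1)]) auto
qed

lemma skorokhod_close_trans:
  assumes "d \<in> skorokhod_close p q f g" "e \<in> skorokhod_close p q g h"
  shows "d + e \<in> skorokhod_close p q f h"
proof -
  obtain \<tau> where l: "d > 0" "\<tau> \<in> time_changes p q"
    "\<And>t. t \<in> {p..q} \<Longrightarrow> \<bar>\<tau> t - t\<bar> \<le> d \<and> \<bar>f t - g (\<tau> t)\<bar> \<le> d"
    using assms(1) by (auto simp: skorokhod_close_def)
  obtain \<mu> where m: "e > 0" "\<mu> \<in> time_changes p q"
    "\<And>t. t \<in> {p..q} \<Longrightarrow> \<bar>\<mu> t - t\<bar> \<le> e \<and> \<bar>g t - h (\<mu> t)\<bar> \<le> e"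
    using assms(2) by (auto simp: skorokhod_close_def)
  have "\<bar>\<mu> (\<tau> t) - t\<bar> \<le> d + e \<and> \<bar>f t - h (\<mu> (\<tau> t))\<bar> \<le> d + e" if t: "t \<in> {p..q}" for t
    using l(3)[OF t] m(3)[OF time_change_in[OF l(2) t]] by linarith
  then show ?thesis
    using l(1) m(1) by (intro skorokhod_closeI[OF _ time_change_comp[OF l(2) m(2)]]) auto
qed

lemma skorokhod_close_bdd_below: "bdd_below (skorokhod_close p q f g)"
  by (rule bdd_belowI[of _ 0]) (auto simp: skorokhod_close_def)

lemma skorokhod_close_arbitrary:
  assumes f: "f \<in> skorokhod_paths p q" and g: "g \<in> skorokhod_paths p q"
    and close: "\<And>\<epsilon>. \<epsilon> > 0 \<Longrightarrow> \<exists>e\<in>skorokhod_close p q f g. e < \<epsilon>"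
  shows "f = g"
proof (rule extensionalityI[of _ "{p..q}"])
  show "f \<in> extensional {p..q}" "g \<in> extensional {p..q}"
    using f g by (auto simp: skorokhod_paths_def)
  have time: "\<exists>\<tau>\<in>time_changes p q. \<forall>t\<in>{p..q}. \<bar>\<tau> t - t\<bar> < \<epsilon> \<and> \<bar>f t - g (\<tau> t)\<bar> < \<epsilon>"
    if "\<epsilon> > 0" for \<epsilon>
  proof -
    obtain e where e: "e \<in> skorokhod_close p q f g" "e < \<epsilon>" using close[OF \<open>\<epsilon> > 0\<close>] by blast
    then show ?thesis by (force simp: skorokhod_close_def)
  qed
  fix t assume t: "t \<in> {p..q}"
  show "f t = g t"
  proof (cases "t = p")
    case True
    have "\<bar>f p - g p\<bar> < \<epsilon>" if "\<epsilon> > 0" for \<epsilon>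
      using time[OF that] time_change_left t True by (metis atLeastAtMost_iff)
    then have "\<bar>f p - g p\<bar> = 0" by (metis abs_ge_zero less_irrefl order_le_less)
    then show ?thesis using True by simp
  next
    case False
    then have t': "t \<in> {p<..q}" using t by auto
    have gl: "(g \<longlongrightarrow> g t) (at_left t)" and fl: "(f \<longlongrightarrow> f t) (at_left t)"
      using f g t' by (auto simp: skorokhod_paths_def)
    have "(f \<longlongrightarrow> g t) (at_left t)"
    proof (rule tendstoI)
      fix \<epsilon> :: real assume eps: "\<epsilon> > 0"
      then have "eventually (\<lambda>s. dist (g s) (g t) < \<epsilon> / 2) (at_left t)"
        using gl by (intro tendstoD) auto
      then obtain b where "b < t" and b: "\<And>s. b < s \<Longrightarrow> s < t \<Longrightarrow> dist (g s) (g t) < \<epsilon> / 2"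
        using eventually_at_left[of "t - 1" t] by auto
      have "dist (f s) (g t) < \<epsilon>" if s: "max b p < s" "s < t" for s
      proof -
        define \<delta> where "\<delta> = min (\<epsilon> / 2) (min (s - b) (t - s))"
        have "\<delta> > 0" using s eps by (auto simp: \<delta>_def)
        from time[OF this] obtain \<tau> where l: "\<bar>\<tau> s - s\<bar> < \<delta>" "\<bar>f s - g (\<tau> s)\<bar> < \<delta>"
          using s t by (metis atLeastAtMost_iff less_eq_real_def max_less_iff_conj order_trans)
        have "b < \<tau> s" "\<tau> s < t" using l(1) by (auto simp: \<delta>_def)
        have "\<bar>g (\<tau> s) - g t\<bar> < \<epsilon> / 2" using b[OF \<open>b < \<tau> s\<close> \<open>\<tau> s < t\<close>] by (simp add: dist_real_def)
        moreover have "\<bar>f s - g (\<tau> s)\<bar> < \<epsilon> / 2" using l(2) by (simp add: \<delta>_def)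
        ultimately show ?thesis unfolding dist_real_def by linarith
      qed
      moreover have "max b p < t" using \<open>b < t\<close> t' by auto
      ultimately show "eventually (\<lambda>s. dist (f s) (g t) < \<epsilon>) (at_left t)"
        using eventually_at_left[of "max b p" t] by blast
    qed
    with fl show ?thesis by (rule tendsto_unique[rotated]) simp
  qed
qed

lemma Metric_space_skorokhod: "Metric_space (skorokhod_paths p q) (skorokhod_dist p q)"
proof
  fix f g h
  show "0 \<le> skorokhod_dist p q f g"
    using skorokhod_close_nonempty[of f p q g]
    by (auto simp: skorokhod_dist_def intro!: cInf_greatest) (auto simp: skorokhod_close_def)
  have "skorokhod_close p q f g = skorokhod_close p q g f"
    by (intro equalityI skorokhod_close_sym)
  then show "skorokhod_dist p q f g = skorokhod_dist p q g f"
    by (auto simp: skorokhod_dist_def)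
  assume f: "f \<in> skorokhod_paths p q" and g: "g \<in> skorokhod_paths p q"
  have approx: "\<exists>e\<in>skorokhod_close p q f' g'. e < skorokhod_dist p q f' g' + \<epsilon>"
    if "\<epsilon> > 0" "f' \<in> skorokhod_paths p q" "g' \<in> skorokhod_paths p q" for f' g' \<epsilon>
    using that cInf_lessD[of "skorokhod_close p q f' g'" "skorokhod_dist p q f' g' + \<epsilon>"]
      skorokhod_close_nonempty[of f' p q g']
    by (auto simp: skorokhod_dist_def)
  show "skorokhod_dist p q f g = 0 \<longleftrightarrow> f = g"
  proof
    assume "skorokhod_dist p q f g = 0"
    then show "f = g" using approx[OF _ f g] by (intro skorokhod_close_arbitrary[OF f g]) auto
  next
    assume "f = g"
    have "skorokhod_dist p q f g \<le> \<epsilon>" if "\<epsilon> > 0" for \<epsilon>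
    proof -
      have "\<epsilon> \<in> skorokhod_close p q f g"
        using that \<open>f = g\<close> by (intro skorokhod_closeI[OF _ time_change_id]) auto
      then show ?thesis
        using f g by (auto simp: skorokhod_dist_def intro!: cInf_lower skorokhod_close_bdd_below)
    qed
    then have "skorokhod_dist p q f g \<le> 0" by (rule field_le_epsilon[of _ 0, simplified])
    with \<open>0 \<le> skorokhod_dist p q f g\<close> show "skorokhod_dist p q f g = 0" by simp
  qed
  assume h: "h \<in> skorokhod_paths p q"
  show "skorokhod_dist p q f h \<le> skorokhod_dist p q f g + skorokhod_dist p q g h"
  proof (rule field_le_epsilon)
    fix \<epsilon> :: real assume "\<epsilon> > 0"
    then obtain d e where d: "d \<in> skorokhod_close p q f g" "d < skorokhod_dist p q f g + \<epsilon> / 2"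
      and e: "e \<in> skorokhod_close p q g h" "e < skorokhod_dist p q g h + \<epsilon> / 2"
      using approx[of "\<epsilon> / 2", OF _ f g] approx[of "\<epsilon> / 2", OF _ g h] by auto
    have "skorokhod_dist p q f h \<le> d + e"
      using f h skorokhod_close_trans[OF d(1) e(1)]
      by (auto simp: skorokhod_dist_def intro!: cInf_lower skorokhod_close_bdd_below)
    with d e show "skorokhod_dist p q f h
        \<le> skorokhod_dist p q f g + skorokhod_dist p q g h + \<epsilon>" by simp
  qed
qed

lemma topspace_skorokhod_topology: "topspace (skorokhod_topology p q) = skorokhod_paths p q"
  by (simp add: skorokhod_topology_def Metric_space.topspace_mtopology[OF Metric_space_skorokhod])

section \<open>Convergence in distribution\<close>

definition borel_of_topology :: "'x topology \<Rightarrow> 'x measure" where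
  "borel_of_topology T = sigma (topspace T) {U. openin T U}"

text \<open>
  The variables \<open>X i\<close> may live on different probability spaces \<open>M i\<close>.
\<close>

definition converges_in_distribution ::
  "'x topology \<Rightarrow> ('i \<Rightarrow> 'w measure) \<Rightarrow> ('i \<Rightarrow> 'w \<Rightarrow> 'x) \<Rightarrow> 'v measure \<Rightarrow> ('v \<Rightarrow> 'x)
     \<Rightarrow> 'i filter \<Rightarrow> bool" where
  "converges_in_distribution T M X N Y F \<longleftrightarrow>
     (\<forall>\<^sub>F i in F. prob_space (M i) \<and> X i \<in> measurable (M i) (borel_of_topology T)) \<and>
     prob_space N \<and> Y \<in> measurable N (borel_of_topology T) \<and>
     (\<forall>\<phi>. continuous_map T euclideanreal \<phi> \<and> bounded (\<phi> ` topspace T) \<longrightarrow>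
        ((\<lambda>i. \<integral>\<omega>. \<phi> (X i \<omega>) \<partial>M i) \<longlongrightarrow> (\<integral>\<omega>. \<phi> (Y \<omega>) \<partial>N)) F)"

section \<open>Gaussian processes and the Brownian bridge\<close>

definition normal_distribution :: "real \<Rightarrow> real \<Rightarrow> real measure" where
  "normal_distribution \<mu> \<sigma> =
     (if \<sigma> = 0 then return borel \<mu> else density lborel (normal_density \<mu> \<sigma>))"

text \<open>
  Finite-dimensional distributions are (possibly degenerate) multivariate normal, which means that
  all linear combinations of the components are normal.
\<close>

definition gaussian_process :: "'v measure \<Rightarrow> 't set \<Rightarrow> ('t \<Rightarrow> 'v \<Rightarrow> real) \<Rightarrow> bool" where
  "gaussian_process N T X \<longleftrightarrow>
     prob_space N \<and> (\<forall>t\<in>T. X t \<in> borel_measurable N) \<and>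
     (\<forall>I c. finite I \<and> I \<subseteq> T \<longrightarrow>
        (\<exists>\<mu> \<sigma>. \<sigma> \<ge> 0 \<and> distr N borel (\<lambda>\<omega>. \<Sum>t\<in>I. c t * X t \<omega>) = normal_distribution \<mu> \<sigma>))"

definition covariance :: "'v measure \<Rightarrow> ('v \<Rightarrow> real) \<Rightarrow> ('v \<Rightarrow> real) \<Rightarrow> real" where
  "covariance N X Y =
     (\<integral>\<omega>. (X \<omega> - (\<integral>\<omega>'. X \<omega>' \<partial>N)) * (Y \<omega> - (\<integral>\<omega>'. Y \<omega>' \<partial>N)) \<partial>N)"

definition brownian_bridge :: "'v measure \<Rightarrow> (real \<Rightarrow> 'v \<Rightarrow> real) \<Rightarrow> bool" where
  "brownian_bridge N B \<longleftrightarrow>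
     gaussian_process N {0..1} B \<and>
     (\<forall>t\<in>{0..1}. (\<integral>\<omega>. B t \<omega> \<partial>N) = 0) \<and>
     (\<forall>s\<in>{0..1}. \<forall>t\<in>{0..1}. covariance N (B s) (B t) = min s t - s * t) \<and>
     (\<forall>\<omega>\<in>space N. continuous_on {0..1} (\<lambda>t. B t \<omega>))"

section \<open>The Dirichlet quantile process\<close>

definition quantile_process_path ::
  "(real \<Rightarrow> 'w \<Rightarrow> real measure) \<Rightarrow> real measure \<Rightarrow> real \<Rightarrow> real \<Rightarrow> real \<Rightarrow> 'w \<Rightarrow> real \<Rightarrow> real" where
  "quantile_process_path P H p q a \<omega> =
     (\<lambda>t\<in>{p..q}. sqrt a * (quantile (P a \<omega>) t - quantile H t))"

definition limit_process ::
  "(real \<Rightarrow> 'v \<Rightarrow> real) \<Rightarrow> (real \<Rightarrow> real) \<Rightarrow> real measure \<Rightarrow> real \<Rightarrow> 'v \<Rightarrow> real" where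
  "limit_process B h H t \<omega> = - (B t \<omega> / h (quantile H t))"

end

theory Submission
  imports Defs
begin

text \<open>
  Let \<open>G(u) = sqrt a * (P_a(H^-1(u)) - u)\<close>. Its increments over a grid are centred and scaled Dirichlet
  vectors. Multiplying a Dirichlet density by a coordinate raises one parameter by 1, so the moments
  of linear forms are coefficients of \<open>\<Prod> (1 - s_i X) ^ (- \<alpha>_i)\<close>; after scaling they converge to Gaussian
  moments, which gives the finite-dimensional limits of \<open>G\<close>. The fourth moments of the increments
  control the oscillation of \<open>G\<close> by dyadic chaining. Since \<open>P_a^-1(t) = H^-1(t - G(t) / sqrt a)\<close> up to
  an error of the size of that oscillation, \<open>Q_a\<close> is uniformly close to \<open>- G / h(H^-1)\<close>. In
  the Skorokhod space it then suffices to test with bounded Lipschitz functions, and to compare both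
  processes with step functions built from their values on a dyadic grid.
\<close>

section \<open>Moments of Dirichlet distributions\<close>

text \<open>The obstacle is the small scale. Over an interval of \<open>H\<close>-mass
  \<open>x\<close>, the increment of \<open>G\<close> has fourth moment at most
  \<open>3 x^2 + 6 x / a\<close>. The quadratic term permits chaining; the linear one takes over
  once \<open>x\<close> is below the order of \<open>1 / a\<close>. So chaining stops at a level
  \<open>L\<close> with \<open>a \<le> 2 ^ L \<le> 2 * a\<close>, and monotonicity of the
  distribution function covers the rest: one cell of that grid costs at most
  \<open>sqrt a / 2 ^ L \<le> 1 / sqrt a\<close>.

  In finite dimensions a uniform bound on second moments plays the part of tightness. In path space
  this part is played by a comparison with step paths that is uniform in time outside an event of
  small probability. Lipschitz test functions turn such a comparison into a bound on expectations,
  and inf-convolutions lead from them to all bounded continuous functions. Borel measurability of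
  random paths rests on approximants with countably many values.\<close>

definition neg_binomial_fps :: "real \<Rightarrow> real \<Rightarrow> real fps" where
  "neg_binomial_fps c s = Abs_fps (\<lambda>k. pochhammer c k / fact k * s ^ k)"

text \<open>\<open>neg_binomial_fps c s\<close> is the binomial series of
  \<open>(1 - s X) ^ (- c)\<close>, so this is the chain rule. On coefficients it is the splitting
  of the first factor off a rising factorial.\<close>

lemma fps_deriv_neg_binomial:
  "fps_deriv (neg_binomial_fps c s) = fps_const (c * s) * neg_binomial_fps (c + 1) s"
proof (rule fps_ext)
  fix k
  show "fps_nth (fps_deriv (neg_binomial_fps c s)) k
      = fps_nth (fps_const (c * s) * neg_binomial_fps (c + 1) s) k"
    by (simp add: neg_binomial_fps_def pochhammer_rec divide_simps add.commute[of c])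
qed


text \<open>Lowers the exponent by multiplication, which avoids inverses of power series.\<close>

lemma neg_binomial_fps_Suc:
  "neg_binomial_fps (c + 1) s * (1 - fps_const s * fps_X) = neg_binomial_fps c s"
proof (rule fps_ext)
  fix k
  show "fps_nth (neg_binomial_fps (c + 1) s * (1 - fps_const s * fps_X)) k
      = fps_nth (neg_binomial_fps c s) k"
  proof (cases k)
    case (Suc m)
    have e: "neg_binomial_fps (c + 1) s * (1 - fps_const s * fps_X)
      = neg_binomial_fps (c + 1) s - fps_const s * (fps_X * neg_binomial_fps (c + 1) s)"
      by (simp add: algebra_simps)
    have 1: "pochhammer (c + 1) (Suc m) = (c + 1 + real m) * pochhammer (c + 1) m"
      "pochhammer c (Suc m) = c * pochhammer (c + 1) m"
      by (simp_all only: pochhammer_Suc[of "c + 1"] pochhammer_rec[of c] mult.commute)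
    have "pochhammer (c + 1) (Suc m) / fact (Suc m) * s ^ Suc m
        - s * (pochhammer (c + 1) m / fact m * s ^ m) = pochhammer c (Suc m) / fact (Suc m) * s ^ Suc m"
      unfolding 1 by (simp add: divide_simps) (simp add: algebra_simps)
    then show ?thesis
      unfolding e by (simp add: Suc neg_binomial_fps_def del: fact_Suc power_Suc)
  qed (simp add: neg_binomial_fps_def)
qed

definition dirichlet_fps :: "nat set \<Rightarrow> (nat \<Rightarrow> real) \<Rightarrow> (nat \<Rightarrow> real) \<Rightarrow> real fps" where
  "dirichlet_fps J \<alpha> s = (\<Prod>i\<in>J. neg_binomial_fps (\<alpha> i) (s i))"

lemma dirichlet_fps_0: "fps_nth (dirichlet_fps J \<alpha> s) 0 = 1"
  by (induction J rule: infinite_finite_induct) (auto simp: dirichlet_fps_def neg_binomial_fps_def)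

text \<open>The product rule. Raising \<open>\<alpha> j\<close> by 1 with weight
  \<open>\<alpha> j * s j\<close> is also what integrating the coordinate \<open>y j\<close> does to
  a moment, so this identity is the induction step of \<open>dirichlet_moment\<close>.\<close>

lemma fps_deriv_dirichlet:
  assumes "finite J"
  shows "fps_deriv (dirichlet_fps J \<alpha> s)
       = (\<Sum>j\<in>J. fps_const (\<alpha> j * s j) * dirichlet_fps J (\<alpha>(j := \<alpha> j + 1)) s)"
  using assms
proof (induction J)
  case (insert x F)
  let ?W = "neg_binomial_fps (\<alpha> x) (s x)"
  have ne: "dirichlet_fps (insert x F) (\<alpha>(j := \<alpha> j + 1)) s = ?W * dirichlet_fps F (\<alpha>(j := \<alpha> j + 1)) s"
    if "j \<in> F" for j using insert that by (auto simp: dirichlet_fps_def)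
  have "dirichlet_fps F (\<alpha>(x := \<alpha> x + 1)) s = dirichlet_fps F \<alpha> s"
    unfolding dirichlet_fps_def using insert by (intro prod.cong) auto
  then have nx: "dirichlet_fps (insert x F) (\<alpha>(x := \<alpha> x + 1)) s
      = neg_binomial_fps (\<alpha> x + 1) (s x) * dirichlet_fps F \<alpha> s"
    using insert by (auto simp: dirichlet_fps_def)
  have "dirichlet_fps (insert x F) \<alpha> s = ?W * dirichlet_fps F \<alpha> s"
    using insert by (simp add: dirichlet_fps_def)
  then have "fps_deriv (dirichlet_fps (insert x F) \<alpha> s)
      = fps_deriv ?W * dirichlet_fps F \<alpha> s + ?W * fps_deriv (dirichlet_fps F \<alpha> s)"
    by simp
  also have "\<dots> = (\<Sum>j\<in>insert x F. fps_const (\<alpha> j * s j) * dirichlet_fps (insert x F) (\<alpha>(j := \<alpha> j + 1)) s)"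
    using insert by (simp add: nx ne fps_deriv_neg_binomial sum_distrib_left mult_ac del: fun_upd_apply)
  finally show ?case .
qed (simp add: dirichlet_fps_def)

text \<open>The new factor is \<open>1 / (1 - s j X)\<close>, written as a geometric series so that
  coefficients can be read off.\<close>

lemma dirichlet_fps_Suc:
  assumes "finite J" "j \<in> J"
  shows "dirichlet_fps J (\<alpha>(j := \<alpha> j + 1)) s = dirichlet_fps J \<alpha> s * Abs_fps (\<lambda>l. s j ^ l)"
proof -
  define G where "G = (Abs_fps (\<lambda>l. s j ^ l) :: real fps)"
  have G: "(1 - fps_const (s j) * fps_X) * G = 1"
  proof (rule fps_ext)
    fix k
    have e: "(1 - fps_const (s j) * fps_X) * G = G - fps_const (s j) * (fps_X * G)"
      by (simp add: algebra_simps)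
    show "fps_nth ((1 - fps_const (s j) * fps_X) * G) k = fps_nth 1 k"
      unfolding e by (cases k) (auto simp: G_def)
  qed
  have R: "(\<Prod>i\<in>J - {j}. neg_binomial_fps ((\<alpha>(j := \<alpha> j + 1)) i) (s i))
      = (\<Prod>i\<in>J - {j}. neg_binomial_fps (\<alpha> i) (s i))" (is "_ = ?R")
    by (intro prod.cong) auto
  have 1: "dirichlet_fps J (\<alpha>(j := \<alpha> j + 1)) s = neg_binomial_fps (\<alpha> j + 1) (s j) * ?R"
    unfolding dirichlet_fps_def using assms R by (subst prod.remove[of J j]) auto
  have 2: "dirichlet_fps J \<alpha> s = neg_binomial_fps (\<alpha> j) (s j) * ?R"
    unfolding dirichlet_fps_def using assms by (subst prod.remove[of J j]) auto
  have "dirichlet_fps J \<alpha> s = dirichlet_fps J (\<alpha>(j := \<alpha> j + 1)) s * (1 - fps_const (s j) * fps_X)"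
    unfolding 1 2 by (subst neg_binomial_fps_Suc[symmetric]) (simp only: mult_ac)
  then have "dirichlet_fps J \<alpha> s * G
      = dirichlet_fps J (\<alpha>(j := \<alpha> j + 1)) s * ((1 - fps_const (s j) * fps_X) * G)"
    by (simp only: mult.assoc)
  then show ?thesis unfolding G by (simp add: G_def)
qed

text \<open>The logarithmic derivative of the product is the sum of
  \<open>\<alpha> j * s j / (1 - s j X)\<close>; comparing coefficients gives a Newton-type
  identity. The coefficients thus depend on \<open>\<alpha>\<close> and \<open>s\<close> only
  through weighted power sums, whose growth in \<open>a\<close> is explicit.\<close>

lemma dirichlet_fps_rec:
  assumes "finite J"
  shows "real (Suc k) * fps_nth (dirichlet_fps J \<alpha> s) (Suc k)
       = (\<Sum>i=0..k. fps_nth (dirichlet_fps J \<alpha> s) i * (\<Sum>j\<in>J. \<alpha> j * s j ^ Suc (k - i)))"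
proof -
  have "real (Suc k) * fps_nth (dirichlet_fps J \<alpha> s) (Suc k)
      = fps_nth (fps_deriv (dirichlet_fps J \<alpha> s)) k" by simp
  also have "\<dots> = (\<Sum>j\<in>J. \<alpha> j * s j * fps_nth (dirichlet_fps J (\<alpha>(j := \<alpha> j + 1)) s) k)"
    unfolding fps_deriv_dirichlet[OF assms] by (simp add: fps_sum_nth del: fun_upd_apply)
  also have "\<dots> = (\<Sum>j\<in>J. \<alpha> j * s j * (\<Sum>i=0..k. fps_nth (dirichlet_fps J \<alpha> s) i * s j ^ (k - i)))"
    by (intro sum.cong refl) (simp add: dirichlet_fps_Suc[OF assms] fps_mult_nth)
  also have "\<dots> = (\<Sum>i=0..k. fps_nth (dirichlet_fps J \<alpha> s) i * (\<Sum>j\<in>J. \<alpha> j * s j ^ Suc (k - i)))"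
    by (simp add: sum_distrib_left sum.swap[of _ J] mult_ac)
  finally show ?thesis .
qed

text \<open>When the first power sum is 0, coefficient 1 is 0 as well, so the first and third power
  sums both drop out of the recursion for coefficient 4.\<close>

lemma dirichlet_fps_centred:
  assumes "finite J" and "(\<Sum>j\<in>J. \<alpha> j * s j) = 0"
  shows "fps_nth (dirichlet_fps J \<alpha> s) 4
      = (\<Sum>j\<in>J. \<alpha> j * s j ^ 2)\<^sup>2 / 8 + (\<Sum>j\<in>J. \<alpha> j * s j ^ 4) / 4"
proof -
  let ?F = "\<lambda>k. fps_nth (dirichlet_fps J \<alpha> s) k"
  note rec = dirichlet_fps_rec[OF assms(1), of _ \<alpha> s]
  have 1: "?F 1 = 0" using rec[of 0] assms by (simp add: dirichlet_fps_0)
  have 2: "?F 2 = (\<Sum>j\<in>J. \<alpha> j * s j ^ 2) / 2"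
    using rec[of 1] assms 1 by (simp add: dirichlet_fps_0 numeral_2_eq_2)
  have "{0..3::nat} = {0,1,2,3}" by auto
  then have "4 * ?F 4 = (\<Sum>j\<in>J. \<alpha> j * s j ^ 4) + ?F 2 * (\<Sum>j\<in>J. \<alpha> j * s j ^ 2)"
    using rec[of 3] assms 1 by (simp add: dirichlet_fps_0 eval_nat_numeral)
  then show "?F 4 = (\<Sum>j\<in>J. \<alpha> j * s j ^ 2)\<^sup>2 / 8 + (\<Sum>j\<in>J. \<alpha> j * s j ^ 4) / 4"
    unfolding 2 by (simp add: power2_eq_square[of "\<Sum>j\<in>J. \<alpha> j * s j ^ 2"])
qed

section \<open>Dirichlet distributions as densities on the simplex\<close>

lemma sets_sum_one_lebesgue [simp, measurable_cong]:
  "sets (sum_one_lebesgue J) = sets (\<Pi>\<^sub>M i\<in>J. borel)"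
  by (simp add: sum_one_lebesgue_def)

lemma sets_dirichlet_distribution [simp, measurable_cong]:
  "sets (dirichlet_distribution J \<alpha>) = sets (\<Pi>\<^sub>M i\<in>J. borel)"
  by (simp add: dirichlet_distribution_def)

text \<open>A real-valued form of the density, as Bochner integrals over \<open>density\<close>
  require.\<close>

definition dirichlet_density :: "nat set \<Rightarrow> (nat \<Rightarrow> real) \<Rightarrow> (nat \<Rightarrow> real) \<Rightarrow> real" where
  "dirichlet_density J \<alpha> y = (if \<forall>i\<in>J. 0 \<le> y i
                     then Gamma (\<Sum>i\<in>J. \<alpha> i) / (\<Prod>i\<in>J. Gamma (\<alpha> i))
                          * (\<Prod>i\<in>J. y i powr (\<alpha> i - 1))
                     else 0)"

lemma dirichlet_distribution_density:
  "dirichlet_distribution J \<alpha> = density (sum_one_lebesgue J) (\<lambda>y. ennreal (dirichlet_density J \<alpha> y))"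
  by (simp add: dirichlet_distribution_def dirichlet_density_def)

lemma measurable_dirichlet_density [measurable]:
  assumes [simp]: "finite J"
  shows "dirichlet_density J \<alpha> \<in> borel_measurable (\<Pi>\<^sub>M i\<in>J. borel)"
  unfolding dirichlet_density_def[abs_def] by measurable

lemma dirichlet_density_nonneg:
  assumes "\<And>i. i \<in> J \<Longrightarrow> \<alpha> i > 0" "finite J" "J \<noteq> {}"
  shows "dirichlet_density J \<alpha> y \<ge> 0"
  using assms unfolding dirichlet_density_def
  by (auto intro!: mult_nonneg_nonneg divide_nonneg_nonneg prod_nonneg Gamma_real_nonneg sum_pos simp: less_imp_le sum_nonneg)

text \<open>Lets almost sure statements be pulled back through the \<open>distr\<close> that defines
  \<open>sum_one_lebesgue\<close>.\<close>

lemma measurable_sum_one_extension: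
  assumes "finite J" "J \<noteq> {}"
  shows "(\<lambda>y. y(Max J := 1 - (\<Sum>i\<in>J - {Max J}. y i)))
     \<in> measurable (\<Pi>\<^sub>M i\<in>J - {Max J}. lborel) (\<Pi>\<^sub>M i\<in>J. (borel :: real measure))"
proof -
  have M: "Max J \<in> J" using assms by simp
  show ?thesis
  proof (rule measurable_PiM_single')
    fix i assume i: "i \<in> J"
    show "(\<lambda>y. (y(Max J := 1 - (\<Sum>i\<in>J - {Max J}. y i))) i)
        \<in> measurable (\<Pi>\<^sub>M i\<in>J - {Max J}. lborel) (borel :: real measure)"
      using i by (cases "i = Max J") (auto simp: measurable_lborel1)
  qed (use M in \<open>auto simp: space_PiM PiE_def extensional_def\<close>)
qed

text \<open>The last coordinate is built so that the sum is 1, and the density vanishes where some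
  coordinate is negative.\<close>

lemma AE_dirichlet:
  assumes J: "finite J" "J \<noteq> {}"
  shows "AE y in dirichlet_distribution J \<alpha>. (\<forall>i\<in>J. 0 \<le> y i) \<and> (\<Sum>i\<in>J. y i) = 1"
proof -
  have M: "Max J \<in> J" using J by simp
  have "AE y in sum_one_lebesgue J. (\<Sum>i\<in>J. y i) = 1"
    unfolding sum_one_lebesgue_def
  proof (subst AE_distr_iff[OF measurable_sum_one_extension[OF J]])
    show "{y \<in> space (\<Pi>\<^sub>M i\<in>J. borel). (\<Sum>i\<in>J. y i) = (1::real)} \<in> sets (\<Pi>\<^sub>M i\<in>J. borel)"
      by measurable
    have "(\<Sum>i\<in>J. (y(Max J := 1 - (\<Sum>i\<in>J - {Max J}. y i))) i) = (1::real)" for y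
      using J M by (subst sum.remove[of J "Max J"]) (auto intro!: sum.cong)
    then show "AE y in (\<Pi>\<^sub>M i\<in>J - {Max J}. lborel).
        (\<Sum>i\<in>J. (y(Max J := 1 - (\<Sum>i\<in>J - {Max J}. y i))) i) = (1::real)" by simp
  qed
  then show ?thesis
    unfolding dirichlet_distribution_density using J
    by (subst AE_density) (auto simp: dirichlet_density_def elim!: eventually_mono split: if_splits)
qed

text \<open>Raising one parameter by 1 multiplies the density by a constant times the coordinate.\<close>

lemma integral_dirichlet_coordinate:
  fixes g :: "(nat \<Rightarrow> real) \<Rightarrow> real"
  assumes J: "finite J" "j \<in> J" and \<alpha>: "\<And>i. i \<in> J \<Longrightarrow> \<alpha> i > 0"
    and g [measurable]: "g \<in> borel_measurable (\<Pi>\<^sub>M i\<in>J. borel)"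
  shows "(\<integral>y. y j * g y \<partial>dirichlet_distribution J \<alpha>)
       = \<alpha> j / (\<Sum>i\<in>J. \<alpha> i) * (\<integral>y. g y \<partial>dirichlet_distribution J (\<alpha>(j := \<alpha> j + 1)))"
proof -
  let ?a = "\<Sum>i\<in>J. \<alpha> i" and ?\<beta> = "\<alpha>(j := \<alpha> j + 1)"
  have a: "?a > 0" using J \<alpha> by (intro sum_pos) auto
  have sum: "(\<Sum>i\<in>J. ?\<beta> i) = ?a + 1"
    using J by (simp add: sum.remove[of J j])
  have aj: "\<alpha> j > 0" using J \<alpha> by auto
  have prodG: "(\<Prod>i\<in>J. Gamma (?\<beta> i)) = \<alpha> j * (\<Prod>i\<in>J. Gamma (\<alpha> i))"
    using J aj by (simp add: prod.remove[of J j] Gamma_plus1 nonpos_Ints_def)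
  have dens: "\<alpha> j / ?a * dirichlet_density J ?\<beta> y = dirichlet_density J \<alpha> y * y j" for y
  proof (cases "\<forall>i\<in>J. 0 \<le> y i")
    case True
    then have "0 \<le> y j" using J by auto
    \<comment> \<open>At \<open>y j = 0\<close> both sides are 0, because \<open>0 powr x\<close> is
      0 for every \<open>x\<close>.\<close>
    then have p: "y j powr (\<alpha> j + 1 - 1) = y j powr (\<alpha> j - 1) * y j"
      by (cases "y j = 0") (auto simp: powr_diff)
    have prod: "(\<Prod>i\<in>J. y i powr (?\<beta> i - 1)) = (\<Prod>i\<in>J. y i powr (\<alpha> i - 1)) * y j"
      using J by (simp add: prod.remove[of J j] p[simplified])
    have "Gamma (?a + 1) = ?a * Gamma ?a"
      using a by (intro Gamma_plus1) (auto simp: nonpos_Ints_def)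
    then show ?thesis using True a aj
      unfolding dirichlet_density_def sum prodG prod by (simp add: field_simps)
  qed (auto simp: dirichlet_density_def)
  have ne: "J \<noteq> {}" using J by auto
  have "(\<integral>y. y j * g y \<partial>dirichlet_distribution J \<alpha>)
      = (\<integral>y. dirichlet_density J \<alpha> y * (y j * g y) \<partial>sum_one_lebesgue J)"
    unfolding dirichlet_distribution_density using J \<alpha> ne
    by (subst integral_density) (auto intro!: AE_I2 dirichlet_density_nonneg)
  also have "\<dots> = (\<integral>y. \<alpha> j / ?a * (dirichlet_density J ?\<beta> y * g y) \<partial>sum_one_lebesgue J)"
  proof (intro Bochner_Integration.integral_cong refl)
    fix y show "dirichlet_density J \<alpha> y * (y j * g y) = \<alpha> j / ?a * (dirichlet_density J ?\<beta> y * g y)"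
      unfolding mult.assoc[symmetric] dens ..
  qed
  also have "\<dots> = \<alpha> j / ?a * (\<integral>y. dirichlet_density J ?\<beta> y * g y \<partial>sum_one_lebesgue J)"
    by simp
  also have "(\<integral>y. dirichlet_density J ?\<beta> y * g y \<partial>sum_one_lebesgue J)
      = (\<integral>y. g y \<partial>dirichlet_distribution J ?\<beta>)"
    unfolding dirichlet_distribution_density using J \<alpha> ne aj
    by (subst integral_density) (auto intro!: AE_I2 dirichlet_density_nonneg add_pos_pos)
  finally show ?thesis .
qed

text \<open>Induction over all parameters at once: one factor of the power is expanded into
  coordinates, and each coordinate trades for a raised parameter in a lower moment. That the
  densities have mass 1 is a hypothesis here; \<open>prob_space_dirichlet\<close> supplies it
  later.\<close>

lemma dirichlet_moment:
  assumes J: "finite J" "J \<noteq> {}"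
    and prob: "\<And>\<beta>. (\<And>i. i \<in> J \<Longrightarrow> \<beta> i > 0) \<Longrightarrow> prob_space (dirichlet_distribution J \<beta>)"
    and \<alpha>: "\<And>i. i \<in> J \<Longrightarrow> \<alpha> i > 0"
  shows "(\<integral>y. (\<Sum>i\<in>J. s i * y i) ^ k \<partial>dirichlet_distribution J \<alpha>)
       = fact k / pochhammer (\<Sum>i\<in>J. \<alpha> i) k * fps_nth (dirichlet_fps J \<alpha> s) k"
  using \<alpha>
proof (induction k arbitrary: \<alpha>)
  case 0
  then interpret prob_space "dirichlet_distribution J \<alpha>" by (rule prob)
  show ?case by (simp add: dirichlet_fps_0 prob_space)
next
  case (Suc k)
  then interpret prob_space "dirichlet_distribution J \<alpha>" by (intro prob)
  let ?a = "\<Sum>i\<in>J. \<alpha> i" and ?D = "dirichlet_distribution J \<alpha>"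
  have a: "?a > 0" using J Suc by (intro sum_pos) auto
  \<comment> \<open>On the simplex every linear form is bounded, so all the moments below
    exist.\<close>
  have bound: "\<bar>\<Sum>i\<in>J. s i * y i\<bar> \<le> (\<Sum>i\<in>J. \<bar>s i\<bar>)"
    and le1: "j \<in> J \<Longrightarrow> \<bar>y j\<bar> \<le> 1"
    if y: "(\<forall>i\<in>J. 0 \<le> y i) \<and> (\<Sum>i\<in>J. y i) = 1" for y j
  proof -
    have y1: "y i \<le> 1" if "i \<in> J" for i
      using member_le_sum[of i J y] that y J by auto
    then show "j \<in> J \<Longrightarrow> \<bar>y j\<bar> \<le> 1" using y by auto
    have "\<bar>\<Sum>i\<in>J. s i * y i\<bar> \<le> (\<Sum>i\<in>J. \<bar>s i * y i\<bar>)" by (rule sum_abs)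
    also have "\<dots> \<le> (\<Sum>i\<in>J. \<bar>s i\<bar>)"
      using y y1 by (intro sum_mono) (auto simp: abs_mult intro!: mult_left_le)
    finally show "\<bar>\<Sum>i\<in>J. s i * y i\<bar> \<le> (\<Sum>i\<in>J. \<bar>s i\<bar>)" .
  qed
  have int: "integrable ?D (\<lambda>y. y j * (\<Sum>i\<in>J. s i * y i) ^ k)" if "j \<in> J" for j
  proof (rule integrable_const_bound[where B = "(\<Sum>i\<in>J. \<bar>s i\<bar>) ^ k"])
    show "AE y in ?D. norm (y j * (\<Sum>i\<in>J. s i * y i) ^ k) \<le> (\<Sum>i\<in>J. \<bar>s i\<bar>) ^ k"
      using AE_dirichlet[OF J, of \<alpha>]
    proof eventually_elim
      case (elim y)
      have "\<bar>y j\<bar> * \<bar>\<Sum>i\<in>J. s i * y i\<bar> ^ k \<le> 1 * (\<Sum>i\<in>J. \<bar>s i\<bar>) ^ k"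
        using le1[OF elim that] bound[OF elim] by (intro mult_mono power_mono) auto
      then show ?case by (simp add: abs_mult power_abs)
    qed
  qed (use that J in measurable)
  have up: "(\<Sum>i\<in>J. (\<alpha>(j := \<alpha> j + 1)) i) = ?a + 1" if "j \<in> J" for j
    using J that by (simp add: sum.remove[of J j])
  have "(\<integral>y. (\<Sum>i\<in>J. s i * y i) ^ Suc k \<partial>?D)
      = (\<integral>y. (\<Sum>j\<in>J. s j * (y j * (\<Sum>i\<in>J. s i * y i) ^ k)) \<partial>?D)"
    by (simp add: sum_distrib_right mult_ac)
  also have "\<dots> = (\<Sum>j\<in>J. s j * (\<integral>y. y j * (\<Sum>i\<in>J. s i * y i) ^ k \<partial>?D))"
    using int by (subst Bochner_Integration.integral_sum) auto
  also have "\<dots> = (\<Sum>j\<in>J. s j * (\<alpha> j / ?a * (fact k / pochhammer (?a + 1) k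
                  * fps_nth (dirichlet_fps J (\<alpha>(j := \<alpha> j + 1)) s) k)))"
  proof (intro sum.cong refl arg_cong2[where f = "(*)"])
    fix j assume j: "j \<in> J"
    have "(\<integral>y. y j * (\<Sum>i\<in>J. s i * y i) ^ k \<partial>?D)
      = \<alpha> j / ?a * (\<integral>y. (\<Sum>i\<in>J. s i * y i) ^ k \<partial>dirichlet_distribution J (\<alpha>(j := \<alpha> j + 1)))"
      using J j Suc.prems by (intro integral_dirichlet_coordinate) auto
    also have "(\<integral>y. (\<Sum>i\<in>J. s i * y i) ^ k \<partial>dirichlet_distribution J (\<alpha>(j := \<alpha> j + 1)))
      = fact k / pochhammer (?a + 1) k * fps_nth (dirichlet_fps J (\<alpha>(j := \<alpha> j + 1)) s) k"
      using Suc.prems j by (subst Suc.IH) (auto simp: up[OF j, simplified] add_pos_pos)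
    finally show "(\<integral>y. y j * (\<Sum>i\<in>J. s i * y i) ^ k \<partial>?D) = \<alpha> j / ?a * (fact k / pochhammer (?a + 1) k
                  * fps_nth (dirichlet_fps J (\<alpha>(j := \<alpha> j + 1)) s) k)" .
  qed
  also have "\<dots> = fact k / (?a * pochhammer (?a + 1) k)
      * (\<Sum>j\<in>J. \<alpha> j * s j * fps_nth (dirichlet_fps J (\<alpha>(j := \<alpha> j + 1)) s) k)"
    by (simp add: sum_distrib_left mult_ac del: fun_upd_apply)
  also have "\<dots> = fact k / pochhammer ?a (Suc k) * fps_nth (fps_deriv (dirichlet_fps J \<alpha> s)) k"
    unfolding fps_deriv_dirichlet[OF J(1)] pochhammer_rec by (simp add: fps_sum_nth del: fun_upd_apply)
  finally show ?case by simp
qed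

section \<open>Convergence to Gaussian moments\<close>

text \<open>The Taylor coefficients of \<open>exp (v X^2 / 2)\<close>, that is, the moments of a
  centred normal law of variance \<open>v\<close> divided by \<open>k!\<close>. The recursion is the
  form that \<open>dirichlet_fps_rec\<close> takes when only the second power sum, with value
  \<open>v\<close>, survives.\<close>

fun gauss_coeff :: "real \<Rightarrow> nat \<Rightarrow> real" where
  "gauss_coeff v 0 = 1"
| "gauss_coeff v (Suc 0) = 0"
| "gauss_coeff v (Suc (Suc k)) = v * gauss_coeff v k / real (Suc (Suc k))"

lemma gauss_coeff_even: "gauss_coeff v (2 * m) = (v / 2) ^ m / fact m"
proof (induction m)
  case (Suc m)
  have *: "v * (X / G) / (2 * real m + 2) = (v / 2 * X) / (real (Suc m) * G)" if "G > 0" for X G :: real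
    using that by (simp add: field_simps)
  have "gauss_coeff v (2 * Suc m) = v * ((v / 2) ^ m / fact m) / (2 * real m + 2)" using Suc by simp
  also have "\<dots> = (v / 2) ^ Suc m / fact (Suc m)" unfolding power_Suc fact_Suc by (rule *) simp
  finally show ?case .
qed simp

lemma gauss_coeff_odd: "gauss_coeff v (Suc (2 * m)) = 0"
  by (induction m) auto

text \<open>Odd coefficients vanish and \<open>\<i> ^ (2 * j) = (-1) ^ j\<close>, so the Taylor
  polynomial of the characteristic function at 1 is a partial sum of
  \<open>exp (- v / 2)\<close>.\<close>

lemma sum_gauss_coeff:
  "(\<Sum>k\<le>2 * m. \<i> ^ k * complex_of_real (gauss_coeff v k)) = complex_of_real (\<Sum>j\<le>m. (- v / 2) ^ j / fact j)"
proof (induction m)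
  case (Suc m)
  have "\<i> ^ (2 * m) = (-1) ^ m" by (simp add: power_mult)
  then have "\<i> ^ Suc (Suc (2 * m)) * complex_of_real (gauss_coeff v (2 * Suc m))
      = complex_of_real ((- v / 2) ^ Suc m / fact (Suc m))"
    unfolding gauss_coeff_even by (simp add: power_minus' power_divide)
  then show ?case using Suc gauss_coeff_odd[of v m] by (simp del: gauss_coeff.simps(3) fact_Suc power_Suc)
qed simp

text \<open>The error bound for the Taylor polynomial of a characteristic function is itself a moment.\<close>

lemma char_tendsto_gauss:
  fixes X :: "'i \<Rightarrow> 'w \<Rightarrow> real"
  assumes ev: "\<forall>\<^sub>F i in F. prob_space (M i) \<and> X i \<in> borel_measurable (M i) \<and> (\<forall>k. integrable (M i) (\<lambda>\<omega>. X i \<omega> ^ k))"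
    and mom: "\<And>k. ((\<lambda>i. \<integral>\<omega>. X i \<omega> ^ k \<partial>M i) \<longlongrightarrow> fact k * gauss_coeff v k) F"
  shows "((\<lambda>i. char (distr (M i) borel (X i)) 1) \<longlongrightarrow> complex_of_real (exp (- v / 2))) F"
proof (rule tendstoI)
  fix e :: real assume e: "e > 0"
  have "(\<lambda>m. \<Sum>j\<le>m. (- v / 2) ^ j / fact j) \<longlonglongrightarrow> exp (- v / 2)"
    using exp_converges[of "- v / 2"] unfolding sums_def_le by (simp add: field_simps)
  then have 1: "\<forall>\<^sub>F m in sequentially. dist (\<Sum>j\<le>m. (- v / 2) ^ j / fact j) (exp (- v / 2)) < e / 3"
    using e by (intro tendstoD) auto
  have "(\<lambda>m. 2 * ((v / 2) ^ m / fact m)) \<longlonglongrightarrow> 2 * 0"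
    using summable_LIMSEQ_zero[OF summable_exp[of "v / 2"]] by (intro tendsto_intros) (simp add: field_simps)
  then have 2: "\<forall>\<^sub>F m in sequentially. 2 * ((v / 2) ^ m / fact m) < e / 3"
    by (rule order_tendstoD) (use e in simp)
  \<comment> \<open>One truncation order, fixed before the filter is used, serves both the
    exponential series and the Taylor remainder.\<close>
  obtain m where m: "dist (\<Sum>j\<le>m. (- v / 2) ^ j / fact j) (exp (- v / 2)) < e / 3"
    "2 * ((v / 2) ^ m / fact m) < e / 3"
    using eventually_conj[OF 1 2] by (auto simp: eventually_sequentially)
  define S where "S i = (\<Sum>k\<le>2 * m. ((\<i> * complex_of_real 1) ^ k / fact k) * complex_of_real (\<integral>\<omega>. X i \<omega> ^ k \<partial>M i))" for i
  have "((\<lambda>i. S i) \<longlongrightarrow> (\<Sum>k\<le>2 * m. ((\<i> * complex_of_real 1) ^ k / fact k) * complex_of_real (fact k * gauss_coeff v k))) F"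
    unfolding S_def by (intro tendsto_intros mom)
  also have "(\<Sum>k\<le>2 * m. ((\<i> * complex_of_real 1) ^ k / fact k) * complex_of_real (fact k * gauss_coeff v k))
     = complex_of_real (\<Sum>j\<le>m. (- v / 2) ^ j / fact j)"
    unfolding sum_gauss_coeff[symmetric] by (intro sum.cong) auto
  finally have evS: "\<forall>\<^sub>F i in F. dist (S i) (complex_of_real (\<Sum>j\<le>m. (- v / 2) ^ j / fact j)) < e / 3"
    using e by (intro tendstoD) auto
  have "((\<lambda>i. 2 * \<bar>1\<bar> ^ (2 * m) / fact (2 * m) * (\<integral>\<omega>. X i \<omega> ^ (2 * m) \<partial>M i))
      \<longlongrightarrow> 2 * \<bar>1\<bar> ^ (2 * m) / fact (2 * m) * (fact (2 * m) * gauss_coeff v (2 * m))) F"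
    by (intro tendsto_intros mom)
  also have "2 * \<bar>1\<bar> ^ (2 * m) / fact (2 * m) * (fact (2 * m) * gauss_coeff v (2 * m)) = 2 * ((v / 2) ^ m / fact m)"
    by (simp add: gauss_coeff_even)
  finally have evR: "\<forall>\<^sub>F i in F. 2 * \<bar>1\<bar> ^ (2 * m) / fact (2 * m) * (\<integral>\<omega>. X i \<omega> ^ (2 * m) \<partial>M i) < e / 3"
    by (rule order_tendstoD) (use m in simp)
  show "\<forall>\<^sub>F i in F. dist (char (distr (M i) borel (X i)) 1) (complex_of_real (exp (- v / 2))) < e"
    using ev evS evR
  proof eventually_elim
    case (elim i)
    then interpret prob_space "M i" by simp
    \<comment> \<open>The order is even, so the absolute moment in the remainder is an ordinary
      moment with a known limit.\<close>
    have ab: "\<bar>X i x\<bar> ^ (2 * m) = X i x ^ (2 * m)" for x by (simp add: power_mult)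
    have "cmod (char (distr (M i) borel (X i)) 1 - S i) \<le> 2 * \<bar>1\<bar> ^ (2 * m) / fact (2 * m) * (\<integral>\<omega>. \<bar>X i \<omega>\<bar> ^ (2 * m) \<partial>M i)"
      unfolding S_def using elim by (intro char_approx1') auto
    then have "dist (char (distr (M i) borel (X i)) 1) (S i) < e / 3"
      using elim by (simp add: dist_norm ab)
    moreover have "dist (complex_of_real (\<Sum>j\<le>m. (- v / 2) ^ j / fact j)) (complex_of_real (exp (- v / 2))) < e / 3"
      using m(1) by (simp only: dist_of_real)
    ultimately show ?case
      using elim dist_triangle[of "char (distr (M i) borel (X i)) 1" "complex_of_real (exp (- v / 2))" "S i"]
        dist_triangle[of "S i" "complex_of_real (exp (- v / 2))" "complex_of_real (\<Sum>j\<le>m. (- v / 2) ^ j / fact j)"]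
      by linarith
  qed
qed

section \<open>Asymptotics of Dirichlet moments\<close>

lemma power_over_pochhammer_tendsto:
  "((\<lambda>a::real. a ^ k / pochhammer a k) \<longlongrightarrow> 1) at_top"
proof (induction k)
  case (Suc k)
  have "((\<lambda>a::real. 1 - real k / (real k + a)) \<longlongrightarrow> 1 - 0) at_top"
    by (intro tendsto_intros tendsto_divide_0[OF tendsto_const] filterlim_at_top_imp_at_infinity
        filterlim_tendsto_add_at_top[OF tendsto_const] filterlim_ident)
  moreover have "\<forall>\<^sub>F a::real in at_top. 1 - real k / (real k + a) = a / (a + real k)"
    using eventually_gt_at_top[of 0] by eventually_elim (auto simp: field_simps add_nonneg_pos)
  ultimately have "((\<lambda>a::real. a / (a + real k)) \<longlongrightarrow> 1 - 0) at_top"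
    by (rule Lim_transform_eventually)
  then have "((\<lambda>a::real. a / (a + real k)) \<longlongrightarrow> 1) at_top" by simp
  from tendsto_mult[OF Suc this] show ?case by (simp add: pochhammer_Suc field_simps)
qed simp

text \<open>Under this scaling the power sum of order \<open>r\<close> is a constant times
  \<open>a powr (1 - r / 2)\<close>. Order 1 is killed by centring, order 2 is the variance, and
  higher orders tend to 0, so the recursion passes to that of \<open>gauss_coeff\<close>.\<close>

lemma dirichlet_fps_tendsto_gauss:
  assumes J: "finite J" and c: "(\<Sum>j\<in>J. w j * \<theta> j) = 0"
  shows "((\<lambda>a. fps_nth (dirichlet_fps J (\<lambda>j. a * w j) (\<lambda>j. \<theta> j / sqrt a)) k)
      \<longlongrightarrow> gauss_coeff (\<Sum>j\<in>J. w j * (\<theta> j)\<^sup>2) k) at_top"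
proof (induction k rule: less_induct)
  case (less k)
  define v where "v = (\<Sum>j\<in>J. w j * (\<theta> j)\<^sup>2)"
  let ?F = "\<lambda>k a. fps_nth (dirichlet_fps J (\<lambda>j. a * w j) (\<lambda>j. \<theta> j / sqrt a)) k"
  let ?p = "\<lambda>l a. \<Sum>j\<in>J. a * w j * (\<theta> j / sqrt a) ^ Suc l"
  show ?case
  proof (cases k)
    case 0
    then show ?thesis by (simp add: dirichlet_fps_0)
  next
    case (Suc n)
    \<comment> \<open>\<open>?p l\<close> has order \<open>l + 1\<close>, so the variance sits at
      index 1.\<close>
    have p: "(?p l \<longlongrightarrow> (if l = 1 then v else 0)) at_top" for l
    proof (cases l)
      case 0
      have "?p 0 a = a / sqrt a * (\<Sum>j\<in>J. w j * \<theta> j)" for a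
        by (simp add: sum_distrib_left mult_ac)
      then show ?thesis using 0 c by simp
    next
      case (Suc m)
      have "((\<lambda>a. (1 / sqrt a) ^ m) \<longlongrightarrow> (if m = 0 then 1 else 0)) at_top"
      proof (cases m)
        case (Suc m')
        have "((\<lambda>a. 1 / sqrt a) \<longlongrightarrow> 0) at_top"
          by (intro tendsto_divide_0[OF tendsto_const] filterlim_at_top_imp_at_infinity sqrt_at_top)
        from tendsto_power[OF this, of m] show ?thesis using Suc by simp
      qed simp
      then have "((\<lambda>a. (1 / sqrt a) ^ m * (\<Sum>j\<in>J. w j * \<theta> j ^ Suc (Suc m)))
          \<longlongrightarrow> (if m = 0 then 1 else 0) * (\<Sum>j\<in>J. w j * \<theta> j ^ Suc (Suc m))) at_top"
        by (intro tendsto_intros)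
      moreover have "\<forall>\<^sub>F a in at_top. (1 / sqrt a) ^ m * (\<Sum>j\<in>J. w j * \<theta> j ^ Suc (Suc m)) = ?p l a"
        using eventually_gt_at_top[of 0]
      proof eventually_elim
        case (elim a)
        have "a * w j * (\<theta> j / sqrt a) ^ Suc l = (1 / sqrt a) ^ m * (w j * \<theta> j ^ Suc (Suc m))" for j
        proof -
          have "sqrt a * sqrt a = a" using elim by simp
          then show ?thesis using elim by (simp add: Suc power_divide field_simps)
        qed
        then show ?case by (simp add: sum_distrib_left)
      qed
      ultimately have "(?p l \<longlongrightarrow> (if m = 0 then 1 else 0) * (\<Sum>j\<in>J. w j * \<theta> j ^ Suc (Suc m))) at_top"
        by (rule Lim_transform_eventually)
      moreover have "(if m = 0 then 1 else 0) * (\<Sum>j\<in>J. w j * \<theta> j ^ Suc (Suc m)) = (if l = 1 then v else 0)"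
        using Suc by (simp add: v_def power2_eq_square)
      ultimately show ?thesis by simp
    qed
    have "((\<lambda>a. (\<Sum>i=0..n. ?F i a * ?p (n - i) a) / real k)
        \<longlongrightarrow> (\<Sum>i=0..n. gauss_coeff v i * (if n - i = 1 then v else 0)) / real k) at_top"
      using Suc by (intro tendsto_intros p) (auto simp: v_def intro!: less)
    moreover have "(\<Sum>i=0..n. ?F i a * ?p (n - i) a) / real k = ?F k a" for a
      using dirichlet_fps_rec[OF J, of n "\<lambda>j. a * w j" "\<lambda>j. \<theta> j / sqrt a"] Suc by (simp add: field_simps)
    moreover have "(\<Sum>i=0..n. gauss_coeff v i * (if n - i = 1 then v else 0)) / real k = gauss_coeff v k"
    proof (cases n)
      case 0
      then show ?thesis using Suc by simp
    next
      case (Suc n')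
      have "(\<Sum>i=0..n. gauss_coeff v i * (if n - i = 1 then v else 0)) = (\<Sum>i=0..n. if i = n' then gauss_coeff v i * v else 0)"
        using Suc by (intro sum.cong) auto
      also have "\<dots> = gauss_coeff v n' * v" using Suc by (subst sum.delta) auto
      finally show ?thesis using \<open>k = Suc n\<close> Suc by simp
    qed
    ultimately show ?thesis by (simp add: v_def)
  qed
qed

lemma dirichlet_linear_form_moment_tendsto:
  assumes J: "finite J" "J \<noteq> {}" and c: "(\<Sum>j\<in>J. w j * \<theta> j) = 0"
    and w: "\<And>j. j \<in> J \<Longrightarrow> w j > 0" "(\<Sum>j\<in>J. w j) = 1"
    and prob: "\<And>\<beta>. (\<And>i. i \<in> J \<Longrightarrow> \<beta> i > 0) \<Longrightarrow> prob_space (dirichlet_distribution J \<beta>)"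
  shows "((\<lambda>a. \<integral>y. (sqrt a * (\<Sum>j\<in>J. \<theta> j * y j)) ^ k \<partial>dirichlet_distribution J (\<lambda>j. a * w j))
      \<longlongrightarrow> fact k * gauss_coeff (\<Sum>j\<in>J. w j * (\<theta> j)\<^sup>2) k) at_top"
proof -
  let ?F = "\<lambda>a. fps_nth (dirichlet_fps J (\<lambda>j. a * w j) (\<lambda>j. \<theta> j / sqrt a)) k"
  have "((\<lambda>a. fact k * (a ^ k / pochhammer a k * ?F a)) \<longlongrightarrow> fact k * (1 * gauss_coeff (\<Sum>j\<in>J. w j * (\<theta> j)\<^sup>2) k)) at_top"
    by (intro tendsto_intros power_over_pochhammer_tendsto dirichlet_fps_tendsto_gauss J c)
  moreover have "\<forall>\<^sub>F a in at_top. fact k * (a ^ k / pochhammer a k * ?F a)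
      = (\<integral>y. (sqrt a * (\<Sum>j\<in>J. \<theta> j * y j)) ^ k \<partial>dirichlet_distribution J (\<lambda>j. a * w j))"
    using eventually_gt_at_top[of 0]
  proof eventually_elim
    case (elim a)
    \<comment> \<open>Writing \<open>sqrt a\<close> as \<open>a / sqrt a\<close> pairs
      \<open>a ^ k\<close> with the Pochhammer symbol and leaves the scaling
      \<open>\<theta> j / sqrt a\<close> of the coefficient limit.\<close>
    have "sqrt a * (\<Sum>j\<in>J. \<theta> j * y j) = a * (\<Sum>j\<in>J. \<theta> j / sqrt a * y j)" for y
    proof -
      have "sqrt a * (\<theta> j * y j) = a * (\<theta> j / sqrt a * y j)" for j
        using elim by (simp add: field_simps)
      then show ?thesis by (simp add: sum_distrib_left)
    qed
    then have "(\<integral>y. (sqrt a * (\<Sum>j\<in>J. \<theta> j * y j)) ^ k \<partial>dirichlet_distribution J (\<lambda>j. a * w j))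
      = a ^ k * (\<integral>y. (\<Sum>j\<in>J. \<theta> j / sqrt a * y j) ^ k \<partial>dirichlet_distribution J (\<lambda>j. a * w j))"
      by (simp add: power_mult_distrib)
    also have "(\<integral>y. (\<Sum>j\<in>J. \<theta> j / sqrt a * y j) ^ k \<partial>dirichlet_distribution J (\<lambda>j. a * w j))
      = fact k / pochhammer (\<Sum>j\<in>J. a * w j) k * ?F a"
      using elim w by (intro dirichlet_moment J prob) auto
    also have "(\<Sum>j\<in>J. a * w j) = a" using w(2) by (simp flip: sum_distrib_left)
    finally show ?case by simp
  qed
  ultimately show ?thesis using Lim_transform_eventually by fastforce
qed

text \<open>On the simplex the linear form is \<open>y 0 - x\<close>; the weights
  \<open>1 - x\<close> and \<open>- x\<close> write it with vanishing first power sum. The two terms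
  of the bound balance at \<open>x\<close> of order \<open>1 / a\<close>, the scale below which the
  increments stop being small enough for chaining.\<close>

lemma dirichlet_centred_fourth_moment:
  assumes prob: "\<And>\<beta>. (\<And>i. i \<in> {0, 1} \<Longrightarrow> \<beta> i > 0) \<Longrightarrow> prob_space (dirichlet_distribution {0, 1} \<beta>)"
    and a: "a > 0" and x: "0 < x" "x < 1"
  shows "(\<integral>y. ((1 - x) * y 0 - x * y 1) ^ 4 \<partial>dirichlet_distribution {0, 1} (\<lambda>i. a * (if i = 0 then x else 1 - x)))
    \<le> 3 * x\<^sup>2 / a\<^sup>2 + 6 * x / a ^ 3"
proof -
  define \<alpha> where "\<alpha> i = a * (if i = 0 then x else 1 - x)" for i :: nat
  define s where "s i = (if i = 0 then 1 - x else - x)" for i :: nat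
  let ?S = "\<lambda>l. \<Sum>j\<in>{0, 1}. \<alpha> j * s j ^ l"
  have c: "(\<Sum>j\<in>{0, 1}. \<alpha> j * s j) = 0" by (simp add: \<alpha>_def s_def algebra_simps)
  have "(\<integral>y. ((1 - x) * y 0 - x * y 1) ^ 4 \<partial>dirichlet_distribution {0, 1} \<alpha>)
      = (\<integral>y. (\<Sum>i\<in>{0, 1}. s i * y i) ^ 4 \<partial>dirichlet_distribution {0, 1} \<alpha>)"
    by (simp add: s_def)
  also have "\<dots> = fact 4 / pochhammer (\<Sum>i\<in>{0, 1}. \<alpha> i) 4 * fps_nth (dirichlet_fps {0, 1} \<alpha> s) 4"
    using a x by (intro dirichlet_moment prob) (auto simp: \<alpha>_def)
  also have "(\<Sum>i\<in>{0, 1}. \<alpha> i) = a" by (simp add: \<alpha>_def algebra_simps)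
  also have "fps_nth (dirichlet_fps {0, 1} \<alpha> s) 4 = (?S 2)\<^sup>2 / 8 + ?S 4 / 4"
    by (rule dirichlet_fps_centred[OF _ c]) simp
  also have "fact 4 / pochhammer a 4 * ((?S 2)\<^sup>2 / 8 + ?S 4 / 4) \<le> 24 / a ^ 4 * ((a * x)\<^sup>2 / 8 + a * x / 4)"
  proof (rule mult_mono)
    have "a ^ 4 \<le> pochhammer a 4"
    proof -
      have "a * a * a * a \<le> a * (a + 1) * (a + 2) * (a + 3)" using a by (intro mult_mono) auto
      then show ?thesis by (simp add: eval_nat_numeral pochhammer_Suc algebra_simps)
    qed
    moreover have "(fact 4 :: real) = 24" by (simp add: eval_nat_numeral)
    ultimately show "fact 4 / pochhammer a 4 \<le> 24 / a ^ 4" using a by (simp add: frac_le)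
    have S: "0 \<le> ?S l" if "even l" for l
      using a x that by (auto simp: \<alpha>_def intro!: add_nonneg_nonneg mult_nonneg_nonneg zero_le_even_power)
    have S2: "?S 2 = a * (x * (1 - x))" by (simp add: \<alpha>_def s_def power2_eq_square) (simp add: algebra_simps)
    have xx: "x * (1 - x) \<le> x" using x by (intro mult_left_le) auto
    have "?S 2 \<le> a * x" unfolding S2 using a xx by (intro mult_left_mono) auto
    then have "(?S 2)\<^sup>2 \<le> (a * x)\<^sup>2" using S[of 2] by (intro power_mono) auto
    moreover have "?S 4 \<le> ?S 2"
    proof (rule sum_mono)
      fix j :: nat
      have "(s j)\<^sup>2 \<le> 1" using x by (auto simp: s_def power_le_one)
      then have "(s j)\<^sup>2 * (s j)\<^sup>2 \<le> 1 * (s j)\<^sup>2" by (intro mult_right_mono) auto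
      moreover have "s j ^ 4 = (s j)\<^sup>2 * (s j)\<^sup>2" by (simp flip: power_add)
      ultimately have "s j ^ 4 \<le> (s j)\<^sup>2" by linarith
      then show "\<alpha> j * s j ^ 4 \<le> \<alpha> j * s j ^ 2"
        by (rule mult_left_mono) (use a x in \<open>simp add: \<alpha>_def\<close>)
    qed
    ultimately show "(?S 2)\<^sup>2 / 8 + ?S 4 / 4 \<le> (a * x)\<^sup>2 / 8 + a * x / 4"
      using \<open>?S 2 \<le> a * x\<close> by linarith
    show "0 \<le> (?S 2)\<^sup>2 / 8 + ?S 4 / 4" using S[of 4] by simp
  qed (use a in simp)
  also have "\<dots> = 3 * x\<^sup>2 / a\<^sup>2 + 6 * x / a ^ 3"
    using a by (simp add: field_simps eval_nat_numeral)
  finally show ?thesis by (simp add: \<alpha>_def[abs_def])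
qed

section \<open>Moments and characteristic functions of normal variables\<close>

lemma gaussian_random_variable:
  fixes X :: "'v \<Rightarrow> real"
  assumes N: "prob_space N" and X: "X \<in> borel_measurable N" and \<sigma>: "\<sigma> \<ge> 0"
    and d: "distr N borel X = normal_distribution \<mu> \<sigma>"
  shows "integrable N X" "integrable N (\<lambda>\<omega>. (X \<omega>)\<^sup>2)" "(\<integral>\<omega>. X \<omega> \<partial>N) = \<mu>"
    "(\<integral>\<omega>. (X \<omega> - \<mu>)\<^sup>2 \<partial>N) = \<sigma>\<^sup>2"
    "char (distr N borel X) 1 = iexp \<mu> * complex_of_real (exp (- \<sigma>\<^sup>2 / 2))"
proof -
  interpret prob_space N by (rule N)
  note [measurable] = X
  have "integrable N X \<and> integrable N (\<lambda>\<omega>. (X \<omega>)\<^sup>2) \<and> (\<integral>\<omega>. X \<omega> \<partial>N) = \<mu> \<and>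
    (\<integral>\<omega>. (X \<omega> - \<mu>)\<^sup>2 \<partial>N) = \<sigma>\<^sup>2 \<and> char (distr N borel X) 1 = iexp \<mu> * complex_of_real (exp (- \<sigma>\<^sup>2 / 2))"
  \<comment> \<open>For \<open>\<sigma> = 0\<close> the law is a point mass and \<open>X\<close> is
    almost surely constant; otherwise standardising reduces every claim to the standard normal
    law.\<close>
  proof (cases "\<sigma> = 0")
    case True
    then have d: "distr N borel X = return borel \<mu>" using d by (simp add: normal_distribution_def)
    have "AE x in distr N borel X. x = \<mu>" unfolding d by (subst AE_return) auto
    then have ae: "AE \<omega> in N. X \<omega> = \<mu>" by (subst (asm) AE_distr_iff) auto
    have "integrable N X" using ae by (intro integrable_cong_AE[THEN iffD1, OF _ _ _ integrable_const[of \<mu>]]) auto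
    moreover have "integrable N (\<lambda>\<omega>. (X \<omega>)\<^sup>2)"
      using ae by (intro integrable_cong_AE[THEN iffD1, OF _ _ _ integrable_const[of "\<mu>\<^sup>2"]]) auto
    moreover have "(\<integral>\<omega>. X \<omega> \<partial>N) = (\<integral>\<omega>. \<mu> \<partial>N)" using ae by (intro integral_cong_AE) auto
    moreover have "(\<integral>\<omega>. (X \<omega> - \<mu>)\<^sup>2 \<partial>N) = (\<integral>\<omega>. 0 \<partial>N)" using ae by (intro integral_cong_AE) auto
    moreover have "char (distr N borel X) 1 = iexp \<mu>"
      unfolding d char_def by (subst integral_return) auto
    ultimately show ?thesis using True by (simp add: prob_space)
  next
    case False
    then have \<sigma>: "\<sigma> > 0" using \<sigma> by simp
    let ?Z = "\<lambda>\<omega>. (X \<omega> - \<mu>) / \<sigma>"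
    have "distributed N lborel X (normal_density \<mu> \<sigma>)"
      using d False by (simp add: distributed_def normal_distribution_def cong: distr_cong)
    then have Z: "distributed N lborel ?Z std_normal_density"
      using normal_standard_normal_convert[OF \<sigma>, of X \<mu>] by simp
    have dZ: "distr N borel ?Z = std_normal_distribution"
      using Z by (simp add: distributed_def cong: distr_cong)
    have m: "?Z \<in> borel_measurable N" by measurable
    have 1: "integrable N ?Z" "(\<integral>\<omega>. ?Z \<omega> \<partial>N) = 0"
      using integrable_distr_eq[OF m, of "\<lambda>x. x"] integral_distr[OF m, of "\<lambda>x. x"]
        integral_std_normal_distribution_moment_odd[of 1] integrable_std_normal_distribution_moment[of 1]
      by (auto simp: dZ)
    have 2: "integrable N (\<lambda>\<omega>. (?Z \<omega>)\<^sup>2)" "(\<integral>\<omega>. (?Z \<omega>)\<^sup>2 \<partial>N) = 1"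
      using integrable_distr_eq[OF m, of "\<lambda>x. x\<^sup>2"] integral_distr[OF m, of "\<lambda>x. x\<^sup>2"]
        std_normal_distribution_even_moments[of 1] integrable_std_normal_distribution_moment[of 2] by (auto simp: dZ power2_eq_square numeral_2_eq_2)
    have XZ: "X \<omega> = \<mu> + \<sigma> * ?Z \<omega>" for \<omega> using \<sigma> by simp
    have "integrable N (\<lambda>\<omega>. \<mu> + \<sigma> * ?Z \<omega>)"
      using 1(1) by (intro Bochner_Integration.integrable_add integrable_mult_right) auto
    then have i1: "integrable N X" by (simp only: XZ[symmetric])
    have sq: "(X \<omega>)\<^sup>2 = \<mu>\<^sup>2 + 2 * \<mu> * \<sigma> * ?Z \<omega> + \<sigma>\<^sup>2 * (?Z \<omega>)\<^sup>2" for \<omega>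
    proof -
      have "(\<mu> + \<sigma> * z)\<^sup>2 = \<mu>\<^sup>2 + 2 * \<mu> * \<sigma> * z + \<sigma>\<^sup>2 * z\<^sup>2" for z
        by (simp add: power2_eq_square algebra_simps)
      from this[of "?Z \<omega>"] show ?thesis by (simp only: XZ[symmetric])
    qed
    have "integrable N (\<lambda>\<omega>. \<mu>\<^sup>2 + 2 * \<mu> * \<sigma> * ?Z \<omega> + \<sigma>\<^sup>2 * (?Z \<omega>)\<^sup>2)"
      using 1 2 by (intro Bochner_Integration.integrable_add integrable_mult_right) auto
    then have i2: "integrable N (\<lambda>\<omega>. (X \<omega>)\<^sup>2)" by (simp only: sq[symmetric])
    have "(\<integral>\<omega>. X \<omega> \<partial>N) = (\<integral>\<omega>. \<mu> + \<sigma> * ?Z \<omega> \<partial>N)" by (simp only: XZ[symmetric])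
    also have "\<dots> = \<mu> + \<sigma> * (\<integral>\<omega>. ?Z \<omega> \<partial>N)"
      using 1(1) by (subst Bochner_Integration.integral_add) (auto simp: prob_space simp del: times_divide_eq_right)
    finally have e1: "(\<integral>\<omega>. X \<omega> \<partial>N) = \<mu>" unfolding 1(2) by simp
    have "(X \<omega> - \<mu>)\<^sup>2 = \<sigma>\<^sup>2 * (?Z \<omega>)\<^sup>2" for \<omega> using \<sigma> by (simp add: power_divide)
    then have "(\<integral>\<omega>. (X \<omega> - \<mu>)\<^sup>2 \<partial>N) = \<sigma>\<^sup>2 * (\<integral>\<omega>. (?Z \<omega>)\<^sup>2 \<partial>N)" by (simp only: integral_mult_right_zero)
    then have e2: "(\<integral>\<omega>. (X \<omega> - \<mu>)\<^sup>2 \<partial>N) = \<sigma>\<^sup>2" unfolding 2(2) by simp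
    have "char (distr N borel X) 1 = (\<integral>\<omega>. iexp (X \<omega>) \<partial>N)"
      unfolding char_def by (subst integral_distr) auto
    also have "\<dots> = (\<integral>\<omega>. iexp \<mu> * iexp (\<sigma> * ?Z \<omega>) \<partial>N)"
      by (subst (1) XZ) (simp only: of_real_add distrib_left exp_add)
    also have "\<dots> = iexp \<mu> * (\<integral>\<omega>. iexp (\<sigma> * ?Z \<omega>) \<partial>N)" by (rule integral_mult_right_zero)
    also have "(\<integral>\<omega>. iexp (\<sigma> * ?Z \<omega>) \<partial>N) = char std_normal_distribution \<sigma>"
      unfolding char_def dZ[symmetric] by (subst integral_distr[OF m]) auto
    finally show ?thesis using i1 i2 e1 e2 by (simp add: char_std_normal_distribution)
  qed
  then show "integrable N X" "integrable N (\<lambda>\<omega>. (X \<omega>)\<^sup>2)" "(\<integral>\<omega>. X \<omega> \<partial>N) = \<mu>"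
    "(\<integral>\<omega>. (X \<omega> - \<mu>)\<^sup>2 \<partial>N) = \<sigma>\<^sup>2"
    "char (distr N borel X) 1 = iexp \<mu> * complex_of_real (exp (- \<sigma>\<^sup>2 / 2))" by blast+
qed

text \<open>Passes from characteristic functions to the real test functions that generate
  \<open>trig_span\<close>.\<close>

lemma char_cos_sin:
  assumes N: "prob_space N" and X: "X \<in> borel_measurable N"
  shows "(\<integral>\<omega>. cos (X \<omega>) \<partial>N) = Re (char (distr N borel X) 1)"
    "(\<integral>\<omega>. sin (X \<omega>) \<partial>N) = Im (char (distr N borel X) 1)"
proof -
  interpret prob_space N by (rule N)
  have c: "char (distr N borel X) 1 = (\<integral>\<omega>. iexp (X \<omega>) \<partial>N)"
    unfolding char_def using X by (subst integral_distr) auto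
  have i: "integrable N (\<lambda>\<omega>. iexp (X \<omega>))" using X by (intro integrable_const_bound[of _ 1]) auto
  show "(\<integral>\<omega>. cos (X \<omega>) \<partial>N) = Re (char (distr N borel X) 1)"
    unfolding c integral_Re[OF i, symmetric] by (simp flip: cis_conv_exp)
  show "(\<integral>\<omega>. sin (X \<omega>) \<partial>N) = Im (char (distr N borel X) 1)"
    unfolding c integral_Im[OF i, symmetric] by (simp flip: cis_conv_exp)
qed

section \<open>Weak convergence of random vectors\<close>

text \<open>Generated by linear operations only, so that convergence of expectations extends to it
  by linearity. Closure under products, which Stone-Weierstrass needs, is proved afterwards.\<close>

inductive_set trig_span :: "nat \<Rightarrow> ((nat \<Rightarrow> real) \<Rightarrow> real) set" for n where
  trig_cos: "(\<lambda>x. cos (\<Sum>k<n. c k * x k)) \<in> trig_span n"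
| trig_sin: "(\<lambda>x. sin (\<Sum>k<n. c k * x k)) \<in> trig_span n"
| trig_add: "f \<in> trig_span n \<Longrightarrow> g \<in> trig_span n \<Longrightarrow> (\<lambda>x. f x + g x) \<in> trig_span n"
| trig_scale: "f \<in> trig_span n \<Longrightarrow> (\<lambda>x. r * f x) \<in> trig_span n"

text \<open>Product-to-sum formulas: frequencies \<open>c\<close> and \<open>d\<close> combine to
  \<open>c + d\<close> and \<open>c - d\<close>.\<close>

lemma trig_span_mult_aux:
  assumes f: "f = (\<lambda>x. cos (\<Sum>k<n. c k * x k)) \<or> f = (\<lambda>x. sin (\<Sum>k<n. c k * x k))"
    and "g \<in> trig_span n"
  shows "(\<lambda>x. f x * g x) \<in> trig_span n"
  using assms(2)
proof induction
  case (trig_cos d)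
  have p: "(\<Sum>k<n. c k * x k) + (\<Sum>k<n. d k * x k) = (\<Sum>k<n. (c k + d k) * x k)"
    "(\<Sum>k<n. c k * x k) - (\<Sum>k<n. d k * x k) = (\<Sum>k<n. (c k - d k) * x k)" for x :: "nat \<Rightarrow> real"
    by (simp_all add: sum.distrib sum_subtractf algebra_simps)
  show ?case using f
  proof
    assume f: "f = (\<lambda>x. cos (\<Sum>k<n. c k * x k))"
    have "(\<lambda>x. (1/2) * cos (\<Sum>k<n. (c k - d k) * x k) + (1/2) * cos (\<Sum>k<n. (c k + d k) * x k)) \<in> trig_span n"
      by (intro trig_span.intros)
    then show ?thesis unfolding f cos_times_cos p by (simp add: add_divide_distrib)
  next
    assume f: "f = (\<lambda>x. sin (\<Sum>k<n. c k * x k))"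
    have "(\<lambda>x. (1/2) * sin (\<Sum>k<n. (c k + d k) * x k) + (1/2) * sin (\<Sum>k<n. (c k - d k) * x k)) \<in> trig_span n"
      by (intro trig_span.intros)
    then show ?thesis unfolding f sin_times_cos p by (simp add: add_divide_distrib)
  qed
next
  case (trig_sin d)
  have p: "(\<Sum>k<n. c k * x k) + (\<Sum>k<n. d k * x k) = (\<Sum>k<n. (c k + d k) * x k)"
    "(\<Sum>k<n. c k * x k) - (\<Sum>k<n. d k * x k) = (\<Sum>k<n. (c k - d k) * x k)" for x :: "nat \<Rightarrow> real"
    by (simp_all add: sum.distrib sum_subtractf algebra_simps)
  show ?case using f
  proof
    assume f: "f = (\<lambda>x. cos (\<Sum>k<n. c k * x k))"
    have "(\<lambda>x. (1/2) * sin (\<Sum>k<n. (c k + d k) * x k) + (-1/2) * sin (\<Sum>k<n. (c k - d k) * x k)) \<in> trig_span n"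
      by (intro trig_span.intros)
    then show ?thesis unfolding f cos_times_sin p by (simp add: diff_divide_distrib)
  next
    assume f: "f = (\<lambda>x. sin (\<Sum>k<n. c k * x k))"
    have "(\<lambda>x. (1/2) * cos (\<Sum>k<n. (c k - d k) * x k) + (-1/2) * cos (\<Sum>k<n. (c k + d k) * x k)) \<in> trig_span n"
      by (intro trig_span.intros)
    then show ?thesis unfolding f sin_times_sin p by (simp add: diff_divide_distrib)
  qed
next
  case (trig_add g1 g2)
  then show ?case using trig_span.trig_add by (simp add: distrib_left)
next
  case (trig_scale g r)
  from trig_span.trig_scale[OF trig_scale(2), where r = r] show ?case by (simp add: mult.left_commute)
qed

lemma trig_span_mult:
  assumes "f \<in> trig_span n" "g \<in> trig_span n"
  shows "(\<lambda>x. f x * g x) \<in> trig_span n"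
  using assms(1)
proof induction
  case (trig_cos c)
  show ?case by (rule trig_span_mult_aux[where c = c]) (use assms in auto)
next
  case (trig_sin c)
  show ?case by (rule trig_span_mult_aux[where c = c]) (use assms in auto)
next
  case (trig_add g1 g2)
  then show ?case using trig_span.trig_add by (simp add: distrib_right)
next
  case (trig_scale f r)
  from trig_span.trig_scale[OF trig_scale(2), where r = r] show ?case by (simp add: mult.assoc)
qed

lemma trig_span_const: "(\<lambda>x. r) \<in> trig_span n"
  using trig_scale[OF trig_cos[of "\<lambda>_. 0" n], of r] by simp

lemma trig_span_sin_coordinate:
  assumes "k < n" shows "(\<lambda>x. sin (w * x k)) \<in> trig_span n"
proof -
  have "(\<Sum>i<n. (if i = k then w else 0) * x i) = w * x k" for x :: "nat \<Rightarrow> real"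
  proof -
    have "(\<Sum>i<n. (if i = k then w else 0) * x i) = (\<Sum>i<n. if i = k then w * x i else 0)"
      by (intro sum.cong) auto
    then show ?thesis using assms by (simp add: sum.delta)
  qed
  with trig_sin[of "\<lambda>i. if i = k then w else 0" n] show ?thesis by simp
qed

lemma trig_span_bounded: "f \<in> trig_span n \<Longrightarrow> \<exists>D. \<forall>x. \<bar>f x\<bar> \<le> D"
proof (induction rule: trig_span.induct)
  case (trig_add f g)
  then obtain D E where "\<And>x. \<bar>f x\<bar> \<le> D" "\<And>x. \<bar>g x\<bar> \<le> E" by blast
  then have "\<bar>f x + g x\<bar> \<le> D + E" for x by (meson abs_triangle_ineq add_mono order_trans)
  then show ?case by blast
next
  case (trig_scale f r)
  then obtain D where "\<And>x. \<bar>f x\<bar> \<le> D" by blast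
  then have "\<bar>r * f x\<bar> \<le> \<bar>r\<bar> * D" for x by (simp add: abs_mult mult_left_mono)
  then show ?case by blast
qed (auto intro: exI[of _ 1])

lemma trig_span_measurable:
  assumes "f \<in> trig_span n" and "\<And>k. k < n \<Longrightarrow> (\<lambda>\<omega>. V \<omega> k) \<in> borel_measurable M"
  shows "(\<lambda>\<omega>. f (V \<omega>)) \<in> borel_measurable M"
  using assms(1)
proof (induction rule: trig_span.induct)
  case (trig_cos c)
  have [measurable]: "(\<lambda>\<omega>. \<Sum>k<n. c k * V \<omega> k) \<in> borel_measurable M"
    using assms(2) by (intro borel_measurable_sum borel_measurable_times) auto
  show ?case by measurable
next
  case (trig_sin c)
  have [measurable]: "(\<lambda>\<omega>. \<Sum>k<n. c k * V \<omega> k) \<in> borel_measurable M"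
    using assms(2) by (intro borel_measurable_sum borel_measurable_times) auto
  show ?case by measurable
qed auto

lemma (in prob_space) integrable_trig_span:
  assumes "f \<in> trig_span n" "\<And>k. k < n \<Longrightarrow> (\<lambda>\<omega>. V \<omega> k) \<in> borel_measurable M"
  shows "integrable M (\<lambda>\<omega>. f (V \<omega>))"
proof -
  obtain D where "\<And>x. \<bar>f x\<bar> \<le> D" using trig_span_bounded[OF assms(1)] by blast
  then show ?thesis using trig_span_measurable[OF assms]
    by (intro integrable_const_bound[of _ D]) auto
qed

lemma trig_span_tendsto:
  fixes V :: "'i \<Rightarrow> 'w \<Rightarrow> nat \<Rightarrow> real" and W :: "'v \<Rightarrow> nat \<Rightarrow> real"
  assumes V: "\<forall>\<^sub>F i in F. prob_space (M i) \<and> (\<forall>k<n. (\<lambda>\<omega>. V i \<omega> k) \<in> borel_measurable (M i))"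
    and W: "prob_space N" "\<And>k. k < n \<Longrightarrow> (\<lambda>\<omega>. W \<omega> k) \<in> borel_measurable N"
    and cos: "\<And>c. ((\<lambda>i. \<integral>\<omega>. cos (\<Sum>k<n. c k * V i \<omega> k) \<partial>M i) \<longlongrightarrow> (\<integral>\<omega>. cos (\<Sum>k<n. c k * W \<omega> k) \<partial>N)) F"
    and sin: "\<And>c. ((\<lambda>i. \<integral>\<omega>. sin (\<Sum>k<n. c k * V i \<omega> k) \<partial>M i) \<longlongrightarrow> (\<integral>\<omega>. sin (\<Sum>k<n. c k * W \<omega> k) \<partial>N)) F"
    and f: "f \<in> trig_span n"
  shows "((\<lambda>i. \<integral>\<omega>. f (V i \<omega>) \<partial>M i) \<longlongrightarrow> (\<integral>\<omega>. f (W \<omega>) \<partial>N)) F"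
  using f
proof (induction rule: trig_span.induct)
  case (trig_add f g)
  have ev: "\<forall>\<^sub>F i in F. (\<integral>\<omega>. f (V i \<omega>) \<partial>M i) + (\<integral>\<omega>. g (V i \<omega>) \<partial>M i) = (\<integral>\<omega>. f (V i \<omega>) + g (V i \<omega>) \<partial>M i)"
    using V
  proof eventually_elim
    case (elim i)
    then show ?case using trig_add
      by (subst Bochner_Integration.integral_add) (auto intro!: prob_space.integrable_trig_span[where V = "V i" and n = n])
  qed
  have "(\<integral>\<omega>. f (W \<omega>) + g (W \<omega>) \<partial>N) = (\<integral>\<omega>. f (W \<omega>) \<partial>N) + (\<integral>\<omega>. g (W \<omega>) \<partial>N)"
    using trig_add W by (intro Bochner_Integration.integral_add prob_space.integrable_trig_span[where V = W and n = n]) auto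
  then show ?case
    using Lim_transform_eventually[OF tendsto_add[OF trig_add.IH] ev] by simp
next
  case (trig_scale f r)
  from tendsto_mult[OF tendsto_const[of r] this(2)] show ?case by simp
qed (auto intro: cos sin)

text \<open>Continuity is meant in the product topology on sequences, where the compact set of the
  Stone-Weierstrass argument lives.\<close>

lemma lipschitz_coordinates_continuous:
  fixes \<psi> :: "(nat \<Rightarrow> real) \<Rightarrow> real"
  assumes "\<And>x y. \<bar>\<psi> x - \<psi> y\<bar> \<le> L * (\<Sum>k<n. \<bar>x k - y k\<bar>)"
  shows "continuous_on S \<psi>"
proof -
  have "(\<psi> \<longlongrightarrow> \<psi> x) (at x within UNIV)" for x
  proof -
    have "((\<lambda>y. y k) \<longlongrightarrow> x k) (at x)" for k
      using continuous_on_product_coordinates[of k] by (auto simp: continuous_on_def)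
    then have "((\<lambda>y. L * (\<Sum>k<n. \<bar>y k - x k\<bar>)) \<longlongrightarrow> L * (\<Sum>k<n. \<bar>x k - x k\<bar>)) (at x)"
      by (intro tendsto_intros)
    then have "((\<lambda>y. L * (\<Sum>k<n. \<bar>y k - x k\<bar>)) \<longlongrightarrow> 0) (at x)" by simp
    then have "((\<lambda>y. \<psi> y - \<psi> x) \<longlongrightarrow> 0) (at x)"
      by (rule Lim_null_comparison[rotated]) (use assms in auto)
    then show ?thesis by (simp add: LIM_zero_iff)
  qed
  then have "continuous_on UNIV \<psi>" by (simp add: continuous_on_def)
  then show ?thesis using continuous_on_subset by blast
qed

text \<open>
  Each coordinate enters through \<open>arcsin (sin (\<omega> x))\<close>, which agrees with \<open>\<omega> x\<close> on the box. The
  approximant, a polynomial in the \<open>sin (\<omega> x)\<close>, is therefore bounded on the whole space.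
\<close>

lemma trig_span_approx:
  fixes \<psi> :: "(nat \<Rightarrow> real) \<Rightarrow> real"
  assumes lip: "\<And>x y. \<bar>\<psi> x - \<psi> y\<bar> \<le> L * (\<Sum>k<n. \<bar>x k - y k\<bar>)"
    and bd: "\<And>x. \<bar>\<psi> x\<bar> \<le> D" and K: "K > 0" and \<eta>: "\<eta> > 0"
  obtains f where "f \<in> trig_span n"
    "\<And>x. \<bar>\<psi> x - f x\<bar> \<le> \<eta> + 2 * D * (\<Sum>k<n. (x k)\<^sup>2) / K\<^sup>2"
proof -
  \<comment> \<open>The scale at which \<open>\<bar>x k\<bar> \<le> K\<close> places
    \<open>w * x k\<close> in the interval where \<open>arcsin\<close> inverts
    \<open>sin\<close>.\<close>
  define w where "w = pi / (2 * K)"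
  have w: "w > 0" using K by (simp add: w_def)
  \<comment> \<open>Coordinates from \<open>n\<close> on are pinned to 0. This keeps
    \<open>S\<close> compact, and the first \<open>n\<close> coordinates separate its
    points.\<close>
  define S where "S = (\<Pi>\<^sub>E k\<in>UNIV. if k < n then {-1..1::real} else {0})"
  have S: "compact S"
  proof -
    have "compactin (product_topology (\<lambda>_. euclidean) UNIV) S"
      unfolding S_def by (subst compactin_PiE) auto
    then show ?thesis by (simp add: euclidean_product_topology)
  qed
  define z where "z x k = (if k < n then sin (w * x k) else 0)" for x :: "nat \<Rightarrow> real" and k
  have zS: "z x \<in> S" for x by (auto simp: z_def S_def)
  define R where "R = {f. continuous_on S f \<and> (\<lambda>x. f (z x)) \<in> trig_span n}"
  interpret function_ring_on R S
  proof
    fix x y assume xy: "x \<in> S" "y \<in> S" "x \<noteq> y"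
    then obtain k where k: "x k \<noteq> y k" by auto
    with xy have "k < n" by (auto simp: S_def PiE_def Pi_def split: if_splits) (metis singletonD)
    then have "(\<lambda>s. s k) \<in> R"
      using trig_span_sin_coordinate[of k n w]
      by (auto simp: R_def z_def[abs_def] intro: continuous_on_subset[OF continuous_on_product_coordinates])
    with k show "\<exists>f\<in>R. f x \<noteq> f y" by (intro bexI[of _ "\<lambda>s. s k"])
  qed (use S trig_span_const trig_span_mult trig_span.trig_add in \<open>auto simp: R_def intro!: continuous_intros\<close>)
  define \<Psi> where "\<Psi> s = \<psi> (\<lambda>k. if k < n then arcsin (s k) / w else 0)" for s
  have "continuous_on S \<Psi>"
    unfolding \<Psi>_def
  proof (rule continuous_on_compose2[OF lipschitz_coordinates_continuous[OF lip, of UNIV]])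
    show "continuous_on S (\<lambda>s k. if k < n then arcsin (s k) / w else 0)"
    proof (rule continuous_on_coordinatewise_then_product)
      fix k
      have "continuous_on S (\<lambda>s. arcsin (s k))" if "k < n"
        using that by (intro continuous_on_arcsin continuous_on_subset[OF continuous_on_product_coordinates])
          (auto simp: S_def PiE_def Pi_def split: if_splits)
      then show "continuous_on S (\<lambda>s. if k < n then arcsin (s k) / w else 0)"
        using w by (cases "k < n") (auto intro!: continuous_intros)
    qed
  qed auto
  then obtain g where g: "g \<in> R" "\<And>s. s \<in> S \<Longrightarrow> \<bar>\<Psi> s - g s\<bar> < \<eta>"
    using Stone_Weierstrass_basic[OF _ \<eta>] by blast
  show ?thesis
  proof
    show "(\<lambda>x. g (z x)) \<in> trig_span n" using g by (simp add: R_def)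
    fix x :: "nat \<Rightarrow> real"
    have D: "0 \<le> D" using bd[of x] by linarith
    have g': "\<bar>\<Psi> (z x) - g (z x)\<bar> < \<eta>" using g zS by blast
    have "\<bar>\<psi> x - \<Psi> (z x)\<bar> \<le> 2 * D * (\<Sum>k<n. (x k)\<^sup>2) / K\<^sup>2"
    proof (cases "\<forall>k<n. \<bar>x k\<bar> \<le> K")
      case True
      have "arcsin (sin (w * x k)) = w * x k" if "k < n" for k
      proof -
        have "\<bar>w * x k\<bar> \<le> w * K" using True that w by (simp add: abs_mult)
        also have "w * K = pi / 2" using K by (simp add: w_def)
        finally show ?thesis by (intro arcsin_sin) auto
      qed
      then have "\<Psi> (z x) = \<psi> (\<lambda>k. if k < n then x k else 0)"
        unfolding \<Psi>_def z_def using w by (intro arg_cong[of _ _ \<psi>]) auto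
      \<comment> \<open>The Lipschitz bound sees only the first \<open>n\<close> coordinates, so
        setting the others to 0 leaves \<open>\<psi>\<close> unchanged.\<close>
      also have "\<bar>\<psi> x - \<psi> (\<lambda>k. if k < n then x k else 0)\<bar> \<le> 0"
        using lip[of x "\<lambda>k. if k < n then x k else 0"] by simp
      then have "\<psi> (\<lambda>k. if k < n then x k else 0) = \<psi> x" by simp
      finally show ?thesis using D by (simp add: sum_nonneg)
    next
      case False
      then obtain k where k: "k < n" "K < \<bar>x k\<bar>" by auto
      \<comment> \<open>Outside the box the trivial error \<open>2 * D\<close> is absorbed by the
        quadratic term, as in Chebyshev's inequality.\<close>
      then have "K\<^sup>2 \<le> (x k)\<^sup>2" using K by (metis abs_of_pos less_imp_le abs_le_square_iff)
      also have "\<dots> \<le> (\<Sum>k<n. (x k)\<^sup>2)" using k by (intro member_le_sum) auto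
      finally have "1 \<le> (\<Sum>k<n. (x k)\<^sup>2) / K\<^sup>2" using K by (simp add: le_divide_eq)
      then have "2 * D * 1 \<le> 2 * D * ((\<Sum>k<n. (x k)\<^sup>2) / K\<^sup>2)" using D by (intro mult_left_mono) auto
      moreover have "\<bar>\<psi> x - \<Psi> (z x)\<bar> \<le> 2 * D"
        unfolding \<Psi>_def using bd[of x] bd[of "\<lambda>k. if k < n then arcsin (z x k) / w else 0"] by linarith
      ultimately show ?thesis by simp
    qed
    with g' show "\<bar>\<psi> x - g (z x)\<bar> \<le> \<eta> + 2 * D * (\<Sum>k<n. (x k)\<^sup>2) / K\<^sup>2" by linarith
  qed
qed

text \<open>The uniform second-moment bound takes the role of tightness: it integrates the quadratic
  error of \<open>trig_span_approx\<close> to at most \<open>2 * D * n * C / K^2\<close>, which is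
  small for large \<open>K\<close> uniformly along the filter and in the limit.\<close>

lemma cramer_wold_lipschitz:
  fixes V :: "'i \<Rightarrow> 'w \<Rightarrow> nat \<Rightarrow> real" and W :: "'v \<Rightarrow> nat \<Rightarrow> real"
    and \<psi> :: "(nat \<Rightarrow> real) \<Rightarrow> real"
  assumes V: "\<forall>\<^sub>F i in F. prob_space (M i) \<and> (\<forall>k<n. (\<lambda>\<omega>. V i \<omega> k) \<in> borel_measurable (M i) \<and>
        integrable (M i) (\<lambda>\<omega>. (V i \<omega> k)\<^sup>2) \<and> (\<integral>\<omega>. (V i \<omega> k)\<^sup>2 \<partial>M i) \<le> C) \<and>
        (\<lambda>\<omega>. \<psi> (V i \<omega>)) \<in> borel_measurable (M i)"
    and W: "prob_space N" "\<And>k. k < n \<Longrightarrow> (\<lambda>\<omega>. W \<omega> k) \<in> borel_measurable N"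
      "\<And>k. k < n \<Longrightarrow> integrable N (\<lambda>\<omega>. (W \<omega> k)\<^sup>2)" "\<And>k. k < n \<Longrightarrow> (\<integral>\<omega>. (W \<omega> k)\<^sup>2 \<partial>N) \<le> C"
      "(\<lambda>\<omega>. \<psi> (W \<omega>)) \<in> borel_measurable N"
    and cos: "\<And>c. ((\<lambda>i. \<integral>\<omega>. cos (\<Sum>k<n. c k * V i \<omega> k) \<partial>M i) \<longlongrightarrow> (\<integral>\<omega>. cos (\<Sum>k<n. c k * W \<omega> k) \<partial>N)) F"
    and sin: "\<And>c. ((\<lambda>i. \<integral>\<omega>. sin (\<Sum>k<n. c k * V i \<omega> k) \<partial>M i) \<longlongrightarrow> (\<integral>\<omega>. sin (\<Sum>k<n. c k * W \<omega> k) \<partial>N)) F"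
    and lip: "\<And>x y. \<bar>\<psi> x - \<psi> y\<bar> \<le> L * (\<Sum>k<n. \<bar>x k - y k\<bar>)"
    and bd: "\<And>x. \<bar>\<psi> x\<bar> \<le> D"
  shows "((\<lambda>i. \<integral>\<omega>. \<psi> (V i \<omega>) \<partial>M i) \<longlongrightarrow> (\<integral>\<omega>. \<psi> (W \<omega>) \<partial>N)) F"
proof (rule tendstoI)
  fix e :: real assume e: "e > 0"
  have D: "0 \<le> D" using bd[of "\<lambda>_. 0"] by linarith
  define B where "B = 2 * D * (real n * C)"
  obtain K where K: "K > 0" "B / K\<^sup>2 \<le> e / 8"
  proof
    let ?K = "sqrt (8 * \<bar>B\<bar> / e + 1)"
    show "?K > 0" using e by (auto intro!: add_nonneg_pos)
    have K2: "?K\<^sup>2 = 8 * \<bar>B\<bar> / e + 1" using e by (subst real_sqrt_pow2) auto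
    have p: "8 * \<bar>B\<bar> / e + 1 > 0" using e by (auto intro!: add_nonneg_pos)
    have "B \<le> e / 8 * (8 * \<bar>B\<bar> / e + 1)" using e by (simp add: distrib_left)
    then show "B / ?K\<^sup>2 \<le> e / 8" unfolding K2 using p by (simp add: divide_le_eq)
  qed
  obtain f where f: "f \<in> trig_span n"
    and app: "\<And>x. \<bar>\<psi> x - f x\<bar> \<le> e / 8 + 2 * D * (\<Sum>k<n. (x k)\<^sup>2) / K\<^sup>2"
    using trig_span_approx[OF lip bd K(1), of "e / 8"] e by auto
  have key: "\<bar>(\<integral>\<omega>. \<psi> (X \<omega>) \<partial>Q) - (\<integral>\<omega>. f (X \<omega>) \<partial>Q)\<bar> \<le> e / 4"
    if Q: "prob_space Q" and X: "\<And>k. k < n \<Longrightarrow> (\<lambda>\<omega>. X \<omega> k) \<in> borel_measurable Q"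
      "\<And>k. k < n \<Longrightarrow> integrable Q (\<lambda>\<omega>. (X \<omega> k)\<^sup>2)" "\<And>k. k < n \<Longrightarrow> (\<integral>\<omega>. (X \<omega> k)\<^sup>2 \<partial>Q) \<le> C"
      "(\<lambda>\<omega>. \<psi> (X \<omega>)) \<in> borel_measurable Q" for Q :: "'x measure" and X
  proof -
    interpret prob_space Q by (rule Q)
    have i\<psi>: "integrable Q (\<lambda>\<omega>. \<psi> (X \<omega>))"
      using X(4) bd by (intro integrable_const_bound[of _ D]) auto
    have "if": "integrable Q (\<lambda>\<omega>. f (X \<omega>))" by (rule integrable_trig_span[OF f X(1)])
    have isq: "integrable Q (\<lambda>\<omega>. \<Sum>k<n. (X \<omega> k)\<^sup>2)" using X(2) by auto
    have "\<bar>(\<integral>\<omega>. \<psi> (X \<omega>) \<partial>Q) - (\<integral>\<omega>. f (X \<omega>) \<partial>Q)\<bar> = \<bar>\<integral>\<omega>. \<psi> (X \<omega>) - f (X \<omega>) \<partial>Q\<bar>"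
      using i\<psi> "if" by simp
    also have "\<dots> \<le> (\<integral>\<omega>. \<bar>\<psi> (X \<omega>) - f (X \<omega>)\<bar> \<partial>Q)" by (rule integral_abs_bound)
    also have "\<dots> \<le> (\<integral>\<omega>. e / 8 + 2 * D * (\<Sum>k<n. (X \<omega> k)\<^sup>2) / K\<^sup>2 \<partial>Q)"
      using i\<psi> "if" isq by (intro integral_mono app) auto
    also have "\<dots> = e / 8 + 2 * D * (\<Sum>k<n. \<integral>\<omega>. (X \<omega> k)\<^sup>2 \<partial>Q) / K\<^sup>2"
      using isq X(2) by (simp add: prob_space)
    also have "\<dots> \<le> e / 8 + 2 * D * (\<Sum>k<n. C) / K\<^sup>2"
      using D X(3) by (intro add_left_mono divide_right_mono mult_left_mono sum_mono) auto
    also have "\<dots> = e / 8 + B / K\<^sup>2" by (simp add: B_def)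
    finally show ?thesis using K by linarith
  qed
  have "((\<lambda>i. \<integral>\<omega>. f (V i \<omega>) \<partial>M i) \<longlongrightarrow> (\<integral>\<omega>. f (W \<omega>) \<partial>N)) F"
    by (rule trig_span_tendsto[OF _ W(1,2) cos sin f]) (use V in eventually_elim, auto)
  then have "\<forall>\<^sub>F i in F. dist (\<integral>\<omega>. f (V i \<omega>) \<partial>M i) (\<integral>\<omega>. f (W \<omega>) \<partial>N) < e / 4"
    using e by (intro tendstoD) auto
  with V show "\<forall>\<^sub>F i in F. dist (\<integral>\<omega>. \<psi> (V i \<omega>) \<partial>M i) (\<integral>\<omega>. \<psi> (W \<omega>) \<partial>N) < e"
  proof eventually_elim
    case (elim i)
    have "\<bar>(\<integral>\<omega>. \<psi> (V i \<omega>) \<partial>M i) - (\<integral>\<omega>. f (V i \<omega>) \<partial>M i)\<bar> \<le> e / 4"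
      using elim by (intro key) auto
    moreover have "\<bar>(\<integral>\<omega>. \<psi> (W \<omega>) \<partial>N) - (\<integral>\<omega>. f (W \<omega>) \<partial>N)\<bar> \<le> e / 4"
      using W by (intro key) auto
    ultimately show ?case using elim e unfolding dist_real_def by linarith
  qed
qed

section \<open>Weak convergence from Lipschitz test functions\<close>

lemma space_borel_of_topology [simp]: "space (borel_of_topology T) = topspace T"
  by (simp add: borel_of_topology_def space_measure_of_conv)

lemma sets_borel_of_topology:
  "sets (borel_of_topology T) = sigma_sets (topspace T) {U. openin T U}"
  unfolding borel_of_topology_def by (intro sets_measure_of) (use openin_subset in auto)

lemma openin_sets_borel: "openin T U \<Longrightarrow> U \<in> sets (borel_of_topology T)"
  by (auto simp: sets_borel_of_topology)

lemma borel_measurable_continuous_map: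
  assumes "continuous_map T euclideanreal \<phi>"
  shows "\<phi> \<in> borel_measurable (borel_of_topology T)"
proof (rule borel_measurableI)
  fix S :: "real set" assume "open S"
  then have "openin T {x \<in> topspace T. \<phi> x \<in> S}"
    using assms by (auto simp: continuous_map_def)
  moreover have "\<phi> -` S \<inter> space (borel_of_topology T) = {x \<in> topspace T. \<phi> x \<in> S}" by auto
  ultimately show "\<phi> -` S \<inter> space (borel_of_topology T) \<in> sets (borel_of_topology T)"
    using openin_sets_borel by metis
qed

context Metric_space
begin

lemma continuous_map_lipschitz:
  assumes "\<And>x y. x \<in> M \<Longrightarrow> y \<in> M \<Longrightarrow> \<bar>f x - f y\<bar> \<le> L * d x y"
  shows "continuous_map mtopology euclideanreal f"
proof -
  have "\<exists>\<delta>>0. \<forall>x. x \<in> M \<and> d a x < \<delta> \<longrightarrow> \<bar>f a - f x\<bar> < \<epsilon>" if "a \<in> M" "\<epsilon> > 0" for a \<epsilon>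
  proof (intro exI[of _ "\<epsilon> / (\<bar>L\<bar> + 1)"] conjI allI impI)
    fix x assume x: "x \<in> M \<and> d a x < \<epsilon> / (\<bar>L\<bar> + 1)"
    have "\<bar>f a - f x\<bar> \<le> L * d a x" using assms that x by auto
    also have "\<dots> \<le> (\<bar>L\<bar> + 1) * d a x" by (intro mult_right_mono) auto
    also have "\<dots> < \<epsilon>" using x by (simp add: field_simps)
    finally show "\<bar>f a - f x\<bar> < \<epsilon>" .
  qed (use that in auto)
  then have "continuous_map mtopology (Metric_space.mtopology UNIV dist) f"
    unfolding metric_continuous_map[OF Met_TC.Metric_space_axioms] by (auto simp: dist_real_def)
  then show ?thesis by (simp add: mtopology_is_euclidean)
qed

text \<open>The Pasch-Hausdorff envelope: for bounded \<open>f\<close>, the largest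
  \<open>k\<close>-Lipschitz minorant.\<close>

definition inf_convolution :: "('a \<Rightarrow> real) \<Rightarrow> nat \<Rightarrow> 'a \<Rightarrow> real" where
  "inf_convolution f k x = (INF y\<in>M. f y + real k * d x y)"

context
  fixes f :: "'a \<Rightarrow> real" and D :: real
  assumes bd: "\<And>x. x \<in> M \<Longrightarrow> \<bar>f x\<bar> \<le> D"
begin

lemma inf_convolution_bdd: "bdd_below ((\<lambda>y. f y + real k * d x y) ` M)"
proof (rule bdd_belowI2[of _ "-D"])
  fix y assume "y \<in> M"
  then have "- D \<le> f y" using bd[of y] by linarith
  moreover have "0 \<le> real k * d x y" by simp
  ultimately show "- D \<le> f y + real k * d x y" by linarith
qed

lemma inf_convolution_le: "x \<in> M \<Longrightarrow> inf_convolution f k x \<le> f x"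
  unfolding inf_convolution_def
  by (rule cINF_lower2[OF inf_convolution_bdd, of x]) auto

lemma inf_convolution_ge: "x \<in> M \<Longrightarrow> - D \<le> inf_convolution f k x"
  unfolding inf_convolution_def
proof (rule cINF_greatest)
  fix y assume "y \<in> M"
  then have "- D \<le> f y" using bd[of y] by linarith
  moreover have "0 \<le> real k * d x y" by simp
  ultimately show "- D \<le> f y + real k * d x y" by linarith
qed auto

lemma inf_convolution_lipschitz:
  assumes x: "x \<in> M" and y: "y \<in> M"
  shows "\<bar>inf_convolution f k x - inf_convolution f k y\<bar> \<le> real k * d x y"
proof -
  have *: "inf_convolution f k x - real k * d x y \<le> inf_convolution f k y"
    if x: "x \<in> M" and y: "y \<in> M" for x y
    unfolding inf_convolution_def[of f k y]
  proof (rule cINF_greatest)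
    fix z assume z: "z \<in> M"
    have "inf_convolution f k x \<le> f z + real k * d x z"
      unfolding inf_convolution_def using z by (intro cINF_lower inf_convolution_bdd)
    also have "\<dots> \<le> f z + real k * (d x y + d y z)"
      using triangle[OF x y z] by (intro add_left_mono mult_left_mono) auto
    finally show "inf_convolution f k x - real k * d x y \<le> f z + real k * d y z"
      by (simp add: algebra_simps)
  qed (use y in auto)
  from *[OF x y] *[OF y x] commute[of x y] show ?thesis by (simp add: abs_le_iff)
qed

text \<open>Points at distance at least \<open>\<delta>\<close> cannot lower the infimum once
  \<open>k * \<delta>\<close> exceeds the oscillation \<open>2 * D\<close>; nearer points are
  controlled by continuity at \<open>x\<close>.\<close>

lemma inf_convolution_tendsto:
  assumes cont: "continuous_map mtopology euclideanreal f" and x: "x \<in> M"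
  shows "(\<lambda>k. inf_convolution f k x) \<longlonglongrightarrow> f x"
proof (rule LIMSEQ_I)
  fix e :: real assume e: "e > 0"
  from cont have "continuous_map mtopology (Metric_space.mtopology UNIV dist) f"
    by (simp add: mtopology_is_euclidean)
  then have "\<forall>a\<in>M. \<forall>\<epsilon>>0. \<exists>\<delta>>0. \<forall>y. y \<in> M \<and> d a y < \<delta> \<longrightarrow> dist (f a) (f y) < \<epsilon>"
    unfolding metric_continuous_map[OF Met_TC.Metric_space_axioms] by blast
  from bspec[OF this x, rule_format, of "e / 2"] obtain \<delta>
    where \<delta>: "\<delta> > 0" "\<And>y. y \<in> M \<Longrightarrow> d x y < \<delta> \<Longrightarrow> \<bar>f x - f y\<bar> < e / 2"
    using e unfolding dist_real_def by auto
  obtain k0 :: nat where k0: "real k0 \<ge> 2 * D / \<delta>" by (meson real_arch_simple)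
  have "norm (inf_convolution f k x - f x) < e" if "k \<ge> k0" for k
  proof -
    have "f x - e / 2 \<le> inf_convolution f k x"
      unfolding inf_convolution_def
    proof (rule cINF_greatest)
      fix y assume y: "y \<in> M"
      show "f x - e / 2 \<le> f y + real k * d x y"
      proof (cases "d x y < \<delta>")
        case True
        have "0 \<le> real k * d x y" by simp
        then show ?thesis using \<delta>(2)[OF y True] by linarith
      next
        case False
        have "2 * D \<le> real k0 * \<delta>" using k0 \<delta>(1) by (simp add: field_simps)
        also have "\<dots> \<le> real k * d x y" using that False \<delta>(1) by (intro mult_mono) auto
        finally show ?thesis using bd[OF y] bd[OF x] e by linarith
      qed
    qed (use x in auto)
    with inf_convolution_le[OF x, of k] e show ?thesis by auto
  qed
  then show "\<exists>no. \<forall>k\<ge>no. norm (inf_convolution f k x - f x) < e" by blast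
qed

end

text \<open>Lipschitz minorants that converge pointwise bound the lower limit of the expectations of
  \<open>\<phi>\<close>. The same bound for \<open>- \<phi>\<close> gives the upper limit.\<close>

lemma weak_convergence_from_lipschitz:
  assumes X: "\<forall>\<^sub>F i in F. prob_space (Q i) \<and> X i \<in> measurable (Q i) (borel_of_topology mtopology)"
    and Y: "prob_space N" "Y \<in> measurable N (borel_of_topology mtopology)"
    and lip: "\<And>f L D. (\<And>x y. x \<in> M \<Longrightarrow> y \<in> M \<Longrightarrow> \<bar>f x - f y\<bar> \<le> L * d x y) \<Longrightarrow>
        (\<And>x. x \<in> M \<Longrightarrow> \<bar>f x\<bar> \<le> D) \<Longrightarrow>
        ((\<lambda>i. \<integral>\<omega>. f (X i \<omega>) \<partial>Q i) \<longlongrightarrow> (\<integral>\<omega>. f (Y \<omega>) \<partial>N)) F"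
  shows "converges_in_distribution mtopology Q X N Y F"
proof -
  have lower: "\<forall>\<^sub>F i in F. c < (\<integral>\<omega>. \<phi> (X i \<omega>) \<partial>Q i)"
    if cont: "continuous_map mtopology euclideanreal \<phi>" and bd: "\<And>x. x \<in> M \<Longrightarrow> \<bar>\<phi> x\<bar> \<le> D"
      and c: "c < (\<integral>\<omega>. \<phi> (Y \<omega>) \<partial>N)" for \<phi> D c
  proof -
    interpret N: prob_space N by (rule Y)
    let ?g = "inf_convolution \<phi>"
    have g_bd: "\<bar>?g k x\<bar> \<le> D" if "x \<in> M" for k x
      using inf_convolution_le[of \<phi> D x k] inf_convolution_ge[of \<phi> D x k] bd that by force
    have g_meas: "?g k \<in> borel_measurable (borel_of_topology mtopology)" for k
      using bd by (intro borel_measurable_continuous_map continuous_map_lipschitz[of _ "real k"]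
          inf_convolution_lipschitz[of _ D]) auto
    have Ysp: "Y \<omega> \<in> M" if "\<omega> \<in> space N" for \<omega>
      using measurable_space[OF Y(2) that] by simp
    have "(\<lambda>k. \<integral>\<omega>. ?g k (Y \<omega>) \<partial>N) \<longlonglongrightarrow> (\<integral>\<omega>. \<phi> (Y \<omega>) \<partial>N)"
    proof (rule integral_dominated_convergence[where w = "\<lambda>_. D"])
      show "(\<lambda>\<omega>. \<phi> (Y \<omega>)) \<in> borel_measurable N"
        by (rule measurable_compose[OF Y(2) borel_measurable_continuous_map[OF cont]])
      show "(\<lambda>\<omega>. ?g k (Y \<omega>)) \<in> borel_measurable N" for k
        by (rule measurable_compose[OF Y(2) g_meas])
      show "AE \<omega> in N. (\<lambda>k. ?g k (Y \<omega>)) \<longlonglongrightarrow> \<phi> (Y \<omega>)"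
        using bd cont Ysp by (intro AE_I2 inf_convolution_tendsto[of _ D]) auto
      show "AE \<omega> in N. norm (?g k (Y \<omega>)) \<le> D" for k
        using g_bd Ysp by (intro AE_I2) auto
    qed simp
    then have "\<forall>\<^sub>F k in sequentially. c < (\<integral>\<omega>. ?g k (Y \<omega>) \<partial>N)"
      using c by (rule order_tendstoD)
    then obtain k where k: "c < (\<integral>\<omega>. ?g k (Y \<omega>) \<partial>N)"
      by (auto simp: eventually_sequentially)
    have "((\<lambda>i. \<integral>\<omega>. ?g k (X i \<omega>) \<partial>Q i) \<longlongrightarrow> (\<integral>\<omega>. ?g k (Y \<omega>) \<partial>N)) F"
      by (rule lip[of _ "real k" D]) (use bd g_bd in \<open>auto intro!: inf_convolution_lipschitz[of _ D]\<close>)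
    from order_tendstoD(1)[OF this k] X show ?thesis
    proof eventually_elim
      case (elim i)
      then interpret Q: prob_space "Q i" by simp
      have Xm: "X i \<in> measurable (Q i) (borel_of_topology mtopology)" using elim by simp
      have Xsp: "X i \<omega> \<in> M" if "\<omega> \<in> space (Q i)" for \<omega>
        using measurable_space[OF Xm that] by simp
      have "(\<integral>\<omega>. ?g k (X i \<omega>) \<partial>Q i) \<le> (\<integral>\<omega>. \<phi> (X i \<omega>) \<partial>Q i)"
      proof (rule integral_mono)
        show "integrable (Q i) (\<lambda>\<omega>. ?g k (X i \<omega>))"
          using g_bd Xsp measurable_compose[OF Xm g_meas]
          by (intro Q.integrable_const_bound[of _ D] AE_I2) auto
        show "integrable (Q i) (\<lambda>\<omega>. \<phi> (X i \<omega>))"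
          using bd Xsp measurable_compose[OF Xm borel_measurable_continuous_map[OF cont]]
          by (intro Q.integrable_const_bound[of _ D] AE_I2) auto
        show "\<omega> \<in> space (Q i) \<Longrightarrow> ?g k (X i \<omega>) \<le> \<phi> (X i \<omega>)" for \<omega>
          using inf_convolution_le[of \<phi> D] bd Xsp by auto
      qed
      with elim show ?case by linarith
    qed
  qed
  have "((\<lambda>i. \<integral>\<omega>. \<phi> (X i \<omega>) \<partial>Q i) \<longlongrightarrow> (\<integral>\<omega>. \<phi> (Y \<omega>) \<partial>N)) F"
    if cont: "continuous_map mtopology euclideanreal \<phi>" and bdd: "bounded (\<phi> ` M)" for \<phi>
  proof (rule order_tendstoI)
    obtain D where D: "\<And>x. x \<in> M \<Longrightarrow> \<bar>\<phi> x\<bar> \<le> D" using bdd by (auto simp: bounded_iff)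
    show "c < (\<integral>\<omega>. \<phi> (Y \<omega>) \<partial>N) \<Longrightarrow> \<forall>\<^sub>F i in F. c < (\<integral>\<omega>. \<phi> (X i \<omega>) \<partial>Q i)" for c
      by (rule lower[OF cont D])
    show "\<forall>\<^sub>F i in F. (\<integral>\<omega>. \<phi> (X i \<omega>) \<partial>Q i) < c" if "(\<integral>\<omega>. \<phi> (Y \<omega>) \<partial>N) < c" for c
      using lower[of "\<lambda>x. - \<phi> x" D "- c"] D cont that by (simp add: continuous_map_minus)
  qed
  with X Y show ?thesis by (simp add: converges_in_distribution_def)
qed

end

section \<open>Measurability in the Skorokhod space\<close>

text \<open>A limit lies in an open \<open>U\<close> iff for some \<open>r\<close> the approximants
  eventually stay among the centres of balls of radius \<open>1 / (r + 1)\<close> inside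
  \<open>U\<close>. Asking for preimages of arbitrary sets is affordable because the approximants
  used later have countably many values.\<close>

lemma (in Metric_space) measurable_metric_limit:
  assumes X: "\<And>\<omega>. \<omega> \<in> space Q \<Longrightarrow> X \<omega> \<in> M"
    and Xn: "\<And>n \<omega>. \<omega> \<in> space Q \<Longrightarrow> Xn n \<omega> \<in> M"
    and pre: "\<And>n A. {\<omega> \<in> space Q. Xn n \<omega> \<in> A} \<in> sets Q"
    and lim: "\<And>\<omega>. \<omega> \<in> space Q \<Longrightarrow> (\<lambda>n. d (Xn n \<omega>) (X \<omega>)) \<longlonglongrightarrow> 0"
  shows "X \<in> measurable Q (borel_of_topology mtopology)"
  unfolding borel_of_topology_def
proof (rule measurable_measure_of)
  show "{U. openin mtopology U} \<subseteq> Pow (topspace mtopology)" using openin_subset[of mtopology] by auto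
  show "X \<in> space Q \<rightarrow> topspace mtopology" using X by simp
  fix U assume "U \<in> {U. openin mtopology U}"
  then have U: "openin mtopology U" by simp
  define V where "V r = {x \<in> M. mball x (1 / real (Suc r)) \<subseteq> U}" for r
  have "X -` U \<inter> space Q = (\<Union>r. \<Union>m. \<Inter>n\<in>{m..}. {\<omega> \<in> space Q. Xn n \<omega> \<in> V r})"
  proof (intro equalityI subsetI)
    fix \<omega> assume "\<omega> \<in> X -` U \<inter> space Q"
    then have \<omega>: "\<omega> \<in> space Q" "X \<omega> \<in> U" by auto
    then obtain e where e: "e > 0" "mball (X \<omega>) e \<subseteq> U" using U openin_mtopology by auto
    \<comment> \<open>Two radii are spent: one from the limit to the approximant, one for the ball
      around the approximant.\<close>
    obtain r where r: "2 / real (Suc r) < e"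
      using reals_Archimedean[of "e / 2"] e by (auto simp: field_simps)
    have "\<forall>\<^sub>F n in sequentially. d (Xn n \<omega>) (X \<omega>) < 1 / real (Suc r)"
      using lim[OF \<omega>(1)] by (rule order_tendstoD) simp
    then obtain m where m: "\<And>n. n \<ge> m \<Longrightarrow> d (Xn n \<omega>) (X \<omega>) < 1 / real (Suc r)"
      by (auto simp: eventually_sequentially)
    have "Xn n \<omega> \<in> V r" if "n \<ge> m" for n
    proof -
      have "y \<in> mball (X \<omega>) e" if "y \<in> mball (Xn n \<omega>) (1 / real (Suc r))" for y
      proof -
        have y: "y \<in> M" "d (Xn n \<omega>) y < 1 / real (Suc r)" using that by auto
        have "d (X \<omega>) y \<le> d (X \<omega>) (Xn n \<omega>) + d (Xn n \<omega>) y"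
          using y Xn X \<omega> by (intro triangle) auto
        also have "\<dots> < 2 / real (Suc r)" using m[OF \<open>n \<ge> m\<close>] y commute[of "X \<omega>"] by (simp add: field_simps)
        finally show ?thesis using r y X \<omega> by auto
      qed
      then show ?thesis using e Xn \<omega> by (auto simp: V_def)
    qed
    then show "\<omega> \<in> (\<Union>r. \<Union>m. \<Inter>n\<in>{m..}. {\<omega> \<in> space Q. Xn n \<omega> \<in> V r})" using \<omega> by blast
  next
    fix \<omega> assume "\<omega> \<in> (\<Union>r. \<Union>m. \<Inter>n\<in>{m..}. {\<omega> \<in> space Q. Xn n \<omega> \<in> V r})"
    then obtain r m where \<omega>: "\<omega> \<in> space Q" and V: "\<And>n. n \<ge> m \<Longrightarrow> Xn n \<omega> \<in> V r" by auto
    have "\<forall>\<^sub>F n in sequentially. d (Xn n \<omega>) (X \<omega>) < 1 / real (Suc r)"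
      using lim[OF \<omega>(1)] by (rule order_tendstoD) simp
    then obtain k where "\<And>n. n \<ge> k \<Longrightarrow> d (Xn n \<omega>) (X \<omega>) < 1 / real (Suc r)"
      unfolding eventually_sequentially by blast
    then have "d (Xn (max k m) \<omega>) (X \<omega>) < 1 / real (Suc r)" by simp
    then obtain n where n: "n \<ge> m" "d (Xn n \<omega>) (X \<omega>) < 1 / real (Suc r)"
      by (intro that[of "max k m"]) auto
    then have "X \<omega> \<in> mball (Xn n \<omega>) (1 / real (Suc r))" using Xn X \<omega> by auto
    then show "\<omega> \<in> X -` U \<inter> space Q" using V[OF n(1)] \<omega> by (auto simp: V_def)
  qed
  also have "\<dots> \<in> sets Q"
    using pre by (intro sets.countable_UN sets.countable_INT'') (auto intro!: sets.countable_INT)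
  finally show "X -` U \<inter> space Q \<in> sets Q" .
qed

text \<open>The ceiling is the left-continuous choice of step index, which is the orientation of
  \<open>skorokhod_paths\<close>.\<close>

lemma eventually_ceiling_at_left:
  fixes c b t :: real
  assumes "c > 0"
  shows "\<forall>\<^sub>F s in at_left t. \<lceil>c * s + b\<rceil> = \<lceil>c * t + b\<rceil>"
proof -
  let ?k = "\<lceil>c * t + b\<rceil>"
  have "(real_of_int ?k - 1 - b) / c < t" using assms ceiling_correct[of "c * t + b"] by (simp add: field_simps)
  then have "\<forall>\<^sub>F s in at_left t. s \<in> {(real_of_int ?k - 1 - b) / c<..<t}"
    by (rule eventually_at_left_real)
  then show ?thesis
  proof eventually_elim
    case (elim s)
    then have "real_of_int ?k - 1 < c * s + b" using assms by (simp add: field_simps)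
    moreover have "c * s + b \<le> ?k"
      using elim assms ceiling_correct[of "c * t + b"] by (smt (verit) greaterThanLessThan_iff mult_left_mono)
    ultimately show ?case by (intro ceiling_unique) auto
  qed
qed

lemma eventually_ceiling_at_right:
  fixes c b t :: real
  assumes "c > 0"
  shows "\<forall>\<^sub>F s in at_right t. \<lceil>c * s + b\<rceil> = \<lfloor>c * t + b\<rfloor> + 1"
proof -
  let ?k = "\<lfloor>c * t + b\<rfloor>"
  have "t < (real_of_int ?k + 1 - b) / c" using assms floor_correct[of "c * t + b"] by (simp add: field_simps)
  then have "\<forall>\<^sub>F s in at_right t. s \<in> {t<..<(real_of_int ?k + 1 - b) / c}"
    by (rule eventually_at_right_real)
  then show ?thesis
  proof eventually_elim
    case (elim s)
    then have "c * s + b \<le> real_of_int ?k + 1" using assms by (simp add: field_simps)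
    moreover have "?k < c * s + b"
      using elim assms floor_correct[of "c * t + b"] by (smt (verit) greaterThanLessThan_iff mult_strict_left_mono)
    ultimately show ?case by (intro ceiling_unique) auto
  qed
qed

text \<open>One statement for three kinds of paths: rounded grid steps (constant \<open>g\<close>),
  steps divided by a continuous density, and continuous paths (constant \<open>F\<close>).\<close>

lemma ceiling_step_skorokhod:
  fixes F :: "int \<Rightarrow> real"
  assumes c: "c > 0" and g: "continuous_on {p..q} g"
  shows "(\<lambda>t\<in>{p..q}. F \<lceil>c * t + b\<rceil> * g t) \<in> skorokhod_paths p q"
proof -
  have left: "((\<lambda>t\<in>{p..q}. F \<lceil>c * t + b\<rceil> * g t) \<longlongrightarrow> F \<lceil>c * t + b\<rceil> * g t) (at_left t)"
    if "t \<in> {p<..q}" for t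
  proof -
    have "(g \<longlongrightarrow> g t) (at t within {p..q})" using g that by (auto simp: continuous_on_def)
    then have "(g \<longlongrightarrow> g t) (at t within {p..t})"
      by (rule tendsto_within_subset) (use that in auto)
    then have "(g \<longlongrightarrow> g t) (at_left t)" using that by (simp add: at_within_Icc_at_left)
    then have "((\<lambda>s. F \<lceil>c * t + b\<rceil> * g s) \<longlongrightarrow> F \<lceil>c * t + b\<rceil> * g t) (at_left t)"
      by (intro tendsto_intros)
    moreover have "\<forall>\<^sub>F s in at_left t. F \<lceil>c * t + b\<rceil> * g s = (\<lambda>t\<in>{p..q}. F \<lceil>c * t + b\<rceil> * g t) s"
    proof -
      have "\<forall>\<^sub>F s in at_left t. s \<in> {p<..<t}" using that by (intro eventually_at_left_real) auto
      with eventually_ceiling_at_left[OF c, of b t] show ?thesis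
        by eventually_elim (use that in auto)
    qed
    ultimately show ?thesis by (rule Lim_transform_eventually)
  qed
  have right: "((\<lambda>t\<in>{p..q}. F \<lceil>c * t + b\<rceil> * g t) \<longlongrightarrow> F (\<lfloor>c * t + b\<rfloor> + 1) * g t) (at_right t)"
    if "t \<in> {p..<q}" for t
  proof -
    have "(g \<longlongrightarrow> g t) (at t within {p..q})" using g that by (auto simp: continuous_on_def)
    then have "(g \<longlongrightarrow> g t) (at t within {t..q})"
      by (rule tendsto_within_subset) (use that in auto)
    then have "(g \<longlongrightarrow> g t) (at_right t)" using that by (simp add: at_within_Icc_at_right)
    then have "((\<lambda>s. F (\<lfloor>c * t + b\<rfloor> + 1) * g s) \<longlongrightarrow> F (\<lfloor>c * t + b\<rfloor> + 1) * g t) (at_right t)"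
      by (intro tendsto_intros)
    moreover have "\<forall>\<^sub>F s in at_right t. F (\<lfloor>c * t + b\<rfloor> + 1) * g s = (\<lambda>t\<in>{p..q}. F \<lceil>c * t + b\<rceil> * g t) s"
    proof -
      have "\<forall>\<^sub>F s in at_right t. s \<in> {t<..<q}" using that by (intro eventually_at_right_real) auto
      with eventually_ceiling_at_right[OF c, of b t] show ?thesis
        by eventually_elim (use that in auto)
    qed
    ultimately show ?thesis by (rule Lim_transform_eventually)
  qed
  show ?thesis
    unfolding skorokhod_paths_def using left right by auto blast
qed

section \<open>Approximation of paths by step functions on a grid\<close>

lemma affine_time_change:
  fixes u v c c' e :: real
  assumes uv: "u < c'" "v < c" and e: "\<bar>v - u\<bar> \<le> e" "\<bar>c - c'\<bar> \<le> e"
  defines "\<tau> \<equiv> \<lambda>t. v + (t - u) * ((c - v) / (c' - u))"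
  shows "strict_mono_on {u..c'} \<tau>" "\<tau> ` {u..c'} = {v..c}" "\<tau> u = v" "\<tau> c' = c"
    "\<And>t. t \<in> {u..c'} \<Longrightarrow> \<bar>\<tau> t - t\<bar> \<le> e"
proof -
  define k where "k = (c - v) / (c' - u)"
  have k: "k > 0" "(c' - u) * k = c - v" using uv by (auto simp: k_def)
  have \<tau>: "\<tau> t = v + (t - u) * k" for t by (simp add: \<tau>_def k_def)
  show "strict_mono_on {u..c'} \<tau>" using k by (auto simp: strict_mono_on_def \<tau>)
  show 1: "\<tau> u = v" "\<tau> c' = c" using k by (auto simp: \<tau>)
  show "\<tau> ` {u..c'} = {v..c}"
  proof (intro equalityI subsetI)
    fix y assume "y \<in> \<tau> ` {u..c'}"
    then obtain t where t: "t \<in> {u..c'}" "y = \<tau> t" by auto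
    then have "(t - u) * k \<le> (c' - u) * k" using k by (intro mult_right_mono) auto
    then show "y \<in> {v..c}" using t k by (auto simp: \<tau>)
  next
    fix y assume y: "y \<in> {v..c}"
    have "(y - v) / k \<le> c' - u" using y k by (simp add: divide_le_eq)
    then show "y \<in> \<tau> ` {u..c'}" using k y
      by (intro image_eqI[of _ _ "u + (y - v) / k"]) (auto simp: \<tau>)
  qed
  fix t assume t: "t \<in> {u..c'}"
  define l where "l = (t - u) / (c' - u)"
  have l: "0 \<le> l" "l \<le> 1" using t uv by (auto simp: l_def)
  have "t - u = l * (c' - u)" using uv by (simp add: l_def)
  then have "(t - u) * k = l * (c - v)" and t': "t = u + l * (c' - u)" using k by (auto simp: mult.assoc)
  then have "\<tau> t - t = v + l * (c - v) - (u + l * (c' - u))" unfolding \<tau> by linarith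
  \<comment> \<open>The displacement interpolates between its values at the two endpoints, so it
    never exceeds the larger of them.\<close>
  also have "\<dots> = (1 - l) * (v - u) + l * (c - c')" by (simp add: algebra_simps)
  also have "\<bar>\<dots>\<bar> \<le> (1 - l) * \<bar>v - u\<bar> + l * \<bar>c - c'\<bar>"
    using l abs_triangle_ineq[of "(1 - l) * (v - u)" "l * (c - c')"] by (simp add: abs_mult)
  also have "\<dots> \<le> (1 - l) * e + l * e" using l e by (intro add_mono mult_left_mono) auto
  finally show "\<bar>\<tau> t - t\<bar> \<le> e" by (simp add: algebra_simps)
qed

text \<open>Induction on the largest point \<open>b\<close> of \<open>S\<close>, gluing an affine
  piece on the right. The right endpoints \<open>c\<close> and \<open>c'\<close> may differ because
  the induction hypothesis is applied with \<open>b\<close> and \<open>\<rho> b\<close> in their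
  place.\<close>

lemma piecewise_affine_time_change:
  fixes \<rho> :: "real \<Rightarrow> real"
  assumes "finite S"
  shows "p < c \<Longrightarrow> p < c' \<Longrightarrow> (\<forall>s\<in>S. p < s \<and> s < c \<and> p < \<rho> s \<and> \<rho> s < c' \<and> \<bar>s - \<rho> s\<bar> \<le> e) \<Longrightarrow>
    strict_mono_on S \<rho> \<Longrightarrow> \<bar>c - c'\<bar> \<le> e \<Longrightarrow>
    \<exists>\<tau>. strict_mono_on {p..c'} \<tau> \<and> \<tau> ` {p..c'} = {p..c} \<and> \<tau> c' = c \<and> (\<forall>s\<in>S. \<tau> (\<rho> s) = s) \<and>
      (\<forall>t\<in>{p..c'}. \<bar>\<tau> t - t\<bar> \<le> e)"
  using assms
proof (induction S arbitrary: c c' rule: finite_linorder_max_induct)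
  case empty
  have "0 \<le> e" using empty by linarith
  with affine_time_change[of p c' p c e] empty show ?case
    by (intro exI[of _ "\<lambda>t. p + (t - p) * ((c - p) / (c' - p))"]) auto
next
  case (insert b A)
  have b: "p < b" "b < c" "p < \<rho> b" "\<rho> b < c'" "\<bar>b - \<rho> b\<bar> \<le> e" using insert by auto
  have "\<rho> s < \<rho> b" if "s \<in> A" for s
    by (rule strict_mono_onD[OF insert.prems(4)]) (use insert that in auto)
  then have "\<exists>\<tau>. strict_mono_on {p..\<rho> b} \<tau> \<and> \<tau> ` {p..\<rho> b} = {p..b} \<and> \<tau> (\<rho> b) = b \<and> (\<forall>s\<in>A. \<tau> (\<rho> s) = s) \<and>
      (\<forall>t\<in>{p..\<rho> b}. \<bar>\<tau> t - t\<bar> \<le> e)"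
    using insert b by (intro insert.IH) (auto simp: strict_mono_on_def)
  then obtain \<tau>1 where \<tau>1: "strict_mono_on {p..\<rho> b} \<tau>1" "\<tau>1 ` {p..\<rho> b} = {p..b}" "\<tau>1 (\<rho> b) = b"
    "\<And>s. s \<in> A \<Longrightarrow> \<tau>1 (\<rho> s) = s" "\<And>t. t \<in> {p..\<rho> b} \<Longrightarrow> \<bar>\<tau>1 t - t\<bar> \<le> e" by blast
  define \<tau>2 where "\<tau>2 t = b + (t - \<rho> b) * ((c - b) / (c' - \<rho> b))" for t
  note \<tau>2 = affine_time_change[OF b(4,2,5) insert.prems(5), folded \<tau>2_def]
  define \<tau> where "\<tau> t = (if t \<le> \<rho> b then \<tau>1 t else \<tau>2 t)" for t
  have \<tau>_1: "\<tau> t = \<tau>1 t" if "t \<le> \<rho> b" for t using that by (simp add: \<tau>_def)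
  have \<tau>_2: "\<tau> t = \<tau>2 t" if "\<rho> b \<le> t" for t using that \<tau>1(3) \<tau>2(3) by (cases "t = \<rho> b") (auto simp: \<tau>_def)
  have sp: "{p..c'} = {p..\<rho> b} \<union> {\<rho> b..c'}" using b by auto
  have im: "\<tau> ` {p..c'} = {p..c}"
  proof -
    have "\<tau> ` {p..c'} = \<tau>1 ` {p..\<rho> b} \<union> \<tau>2 ` {\<rho> b..c'}"
      unfolding sp image_Un using \<tau>_1 \<tau>_2 by (intro arg_cong2[where f = "(\<union>)"] image_cong) auto
    then show ?thesis using \<tau>1(2) \<tau>2(2) b by auto
  qed
  have mono: "strict_mono_on {p..c'} \<tau>"
  proof (rule strict_mono_onI)
    fix r s assume rs: "r \<in> {p..c'}" "s \<in> {p..c'}" "r < s"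
    consider "s \<le> \<rho> b" | "\<rho> b \<le> r" | "r < \<rho> b" "\<rho> b < s" by linarith
    then show "\<tau> r < \<tau> s"
    proof cases
      case 1 then show ?thesis using rs \<tau>1(1) by (auto simp: \<tau>_1 strict_mono_on_def)
    next
      case 2 then show ?thesis using rs \<tau>2(1) by (auto simp: \<tau>_2 strict_mono_on_def)
    next
      case 3
      have "\<tau>1 r < \<tau>1 (\<rho> b)" using 3 rs b \<tau>1(1) by (auto simp: strict_mono_on_def)
      moreover have "\<tau>2 (\<rho> b) < \<tau>2 s" using 3 rs b \<tau>2(1) by (auto simp: strict_mono_on_def)
      ultimately show ?thesis using 3 \<tau>1(3) \<tau>2(3) by (simp add: \<tau>_1 \<tau>_2)
    qed
  qed
  have "\<tau> (\<rho> s) = s" if "s \<in> insert b A" for s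
  proof (cases "s = b")
    case False
    then have "s \<in> A" using that by simp
    then show ?thesis using \<tau>1(4) \<open>\<And>s. s \<in> A \<Longrightarrow> \<rho> s < \<rho> b\<close>[of s] by (simp add: \<tau>_1)
  qed (simp add: \<tau>_1 \<tau>1(3))
  moreover have "\<bar>\<tau> t - t\<bar> \<le> e" if "t \<in> {p..c'}" for t
    using that \<tau>1(5)[of t] \<tau>2(5)[of t] by (auto simp: \<tau>_def)
  ultimately show ?case using mono im \<tau>_2[of c'] \<tau>2(4) b
    by (intro exI[of _ \<tau>]) auto
qed

text \<open>One-sided limits give the bound near each point, and Bolzano's principle assembles
  finitely many neighbourhoods. A break point may coincide with \<open>t\<close>, since paths are
  left-continuous there; \<open>s = p\<close> is excluded, since a path may jump immediately after
  \<open>p\<close>.\<close>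

lemma skorokhod_path_oscillation:
  assumes f: "f \<in> skorokhod_paths p q" and pq: "p \<le> q" and \<eta>: "\<eta> > 0"
  obtains S where "finite S" "S \<subseteq> {p<..<q}"
    "\<And>s t. p < s \<Longrightarrow> s \<le> t \<Longrightarrow> t \<le> q \<Longrightarrow> S \<inter> {s..<t} = {} \<Longrightarrow> \<bar>f s - f t\<bar> \<le> \<eta>"
proof -
  define P where "P a b \<longleftrightarrow> (\<exists>S. finite S \<and> (\<forall>s t. a < s \<and> p < s \<and> s \<le> t \<and> t \<le> b \<and> t \<le> q \<and>
      S \<inter> {s..<t} = {} \<longrightarrow> \<bar>f s - f t\<bar> \<le> \<eta>))" for a b
  have "P p q"
  proof (rule Bolzano[OF pq])
    fix a b c assume "P a b" "P b c" "a \<le> b" "b \<le> c"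
    then obtain S1 S2 where S: "finite S1" "finite S2"
      "\<And>s t. a < s \<and> p < s \<and> s \<le> t \<and> t \<le> b \<and> t \<le> q \<and> S1 \<inter> {s..<t} = {} \<Longrightarrow> \<bar>f s - f t\<bar> \<le> \<eta>"
      "\<And>s t. b < s \<and> p < s \<and> s \<le> t \<and> t \<le> c \<and> t \<le> q \<and> S2 \<inter> {s..<t} = {} \<Longrightarrow> \<bar>f s - f t\<bar> \<le> \<eta>"
      unfolding P_def by auto
    show "P a c"
      unfolding P_def
    proof (intro exI[of _ "insert b (S1 \<union> S2)"] conjI allI impI)
      fix s t assume st: "a < s \<and> p < s \<and> s \<le> t \<and> t \<le> c \<and> t \<le> q \<and> insert b (S1 \<union> S2) \<inter> {s..<t} = {}"
      then have "t \<le> b \<or> b < s" by auto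
      with st S(3)[of s t] S(4)[of s t] show "\<bar>f s - f t\<bar> \<le> \<eta>" by auto
    qed (use S in auto)
  next
    fix x assume x: "p \<le> x" "x \<le> q"
    have L: "\<exists>b<x. \<forall>s. b < s \<and> p < s \<and> s \<le> x \<longrightarrow> \<bar>f s - f x\<bar> \<le> \<eta> / 2"
    proof (cases "x = p")
      case False
      then have "(f \<longlongrightarrow> f x) (at_left x)" using f x by (auto simp: skorokhod_paths_def)
      then have "eventually (\<lambda>s. dist (f s) (f x) < \<eta> / 2) (at_left x)"
        using \<eta> by (intro tendstoD) auto
      then obtain b where "b < x" and b: "\<And>s. b < s \<Longrightarrow> s < x \<Longrightarrow> dist (f s) (f x) < \<eta> / 2"
        using eventually_at_left[of "x - 1" x] by auto
      then show ?thesis using \<eta> by (intro exI[of _ b]) (force simp: dist_real_def less_eq_real_def)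
    qed (auto intro: exI[of _ "x - 1"])
    have R: "\<exists>c>x. \<exists>l. \<forall>s. x < s \<and> s < c \<and> s \<le> q \<longrightarrow> \<bar>f s - l\<bar> \<le> \<eta> / 2"
    proof (cases "x = q")
      case False
      then obtain l where "(f \<longlongrightarrow> l) (at_right x)" using f x by (force simp: skorokhod_paths_def)
      then have "eventually (\<lambda>s. dist (f s) l < \<eta> / 2) (at_right x)"
        using \<eta> by (intro tendstoD) auto
      then obtain c where "c > x" and c: "\<And>s. x < s \<Longrightarrow> s < c \<Longrightarrow> dist (f s) l < \<eta> / 2"
        using eventually_at_right[of x "x + 1"] by auto
      then show ?thesis using \<eta> by (intro exI[of _ c] conjI exI[of _ l]) (force simp: dist_real_def less_eq_real_def)+
    qed (auto intro: exI[of _ "x + 1"])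
    from L R obtain b c l where b: "b < x" "\<And>s. b < s \<Longrightarrow> p < s \<Longrightarrow> s \<le> x \<Longrightarrow> \<bar>f s - f x\<bar> \<le> \<eta> / 2"
      and c: "c > x" "\<And>s. x < s \<Longrightarrow> s < c \<Longrightarrow> s \<le> q \<Longrightarrow> \<bar>f s - l\<bar> \<le> \<eta> / 2" by blast
    show "\<exists>d>0. \<forall>a b. a \<le> x \<and> x \<le> b \<and> b - a < d \<longrightarrow> P a b"
    proof (intro exI[of _ "min (x - b) (c - x)"] conjI allI impI)
      fix a' b' assume ab: "a' \<le> x \<and> x \<le> b' \<and> b' - a' < min (x - b) (c - x)"
      show "P a' b'"
        unfolding P_def
      proof (intro exI[of _ "{x}"] conjI allI impI)
        fix s t assume st: "a' < s \<and> p < s \<and> s \<le> t \<and> t \<le> b' \<and> t \<le> q \<and> {x} \<inter> {s..<t} = {}"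
        then have "t \<le> x \<or> x < s" by auto
        then show "\<bar>f s - f t\<bar> \<le> \<eta>"
        proof
          assume "t \<le> x"
          then have "\<bar>f s - f x\<bar> \<le> \<eta> / 2" "\<bar>f t - f x\<bar> \<le> \<eta> / 2" using b(2) st ab by auto
          then show ?thesis by linarith
        next
          assume "x < s"
          then have "\<bar>f s - l\<bar> \<le> \<eta> / 2" "\<bar>f t - l\<bar> \<le> \<eta> / 2" using c(2) st ab by auto
          then show ?thesis by linarith
        qed
      qed auto
    qed (use b c in auto)
  qed
  then obtain S where S: "finite S"
    "\<And>s t. p < s \<Longrightarrow> s \<le> t \<Longrightarrow> t \<le> q \<Longrightarrow> S \<inter> {s..<t} = {} \<Longrightarrow> \<bar>f s - f t\<bar> \<le> \<eta>"
    unfolding P_def by blast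
  show ?thesis
  proof (rule that[of "S \<inter> {p<..<q}"])
    fix s t assume "p < s" "s \<le> t" "t \<le> q" "S \<inter> {p<..<q} \<inter> {s..<t} = {}"
    then show "\<bar>f s - f t\<bar> \<le> \<eta>" by (intro S(2)) auto
  qed (use S in auto)
qed

text \<open>
  Values are rounded to multiples of \<open>1/n\<close>, so that for each \<open>n\<close> there are only countably many
  step functions of this form.
\<close>

definition grid_step :: "real \<Rightarrow> real \<Rightarrow> nat \<Rightarrow> (real \<Rightarrow> real) \<Rightarrow> real \<Rightarrow> real" where
  "grid_step p q n f = (\<lambda>t\<in>{p..q}.
     real_of_int \<lfloor>real n * f (p + (q - p) * real_of_int \<lceil>real n / (q - p) * t + - (real n / (q - p) * p)\<rceil> / real n)\<rfloor> / real n)"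

lemma grid_step_skorokhod:
  assumes "p < q" "n > 0"
  shows "grid_step p q n f \<in> skorokhod_paths p q"
proof -
  have "real n / (q - p) > 0" using assms by simp
  from ceiling_step_skorokhod[OF this continuous_on_const[of "{p..q}" 1],
      of "\<lambda>k. real_of_int \<lfloor>real n * f (p + (q - p) * real_of_int k / real n)\<rfloor> / real n" "- (real n / (q - p) * p)"]
  show ?thesis by (simp add: grid_step_def)
qed

lemma skorokhod_dist_le:
  assumes "e \<in> skorokhod_close p q f g"
  shows "skorokhod_dist p q f g \<le> e"
proof -
  have "e > 0" using assms by (auto simp: skorokhod_close_def)
  with assms show ?thesis by (auto simp: skorokhod_dist_def intro!: cInf_lower skorokhod_close_bdd_below)
qed

lemma skorokhod_dist_le_uniform:
  assumes "e > 0" "\<And>t. t \<in> {p..q} \<Longrightarrow> \<bar>f t - g t\<bar> \<le> e"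
  shows "skorokhod_dist p q f g \<le> e"
  using assms by (intro skorokhod_dist_le skorokhod_closeI[OF _ time_change_id]) auto

text \<open>A jump of \<open>f\<close> at \<open>r\<close> shows up in the step function at
  \<open>\<rho> r\<close>, the last grid point not after \<open>r\<close>. The time change sends
  each \<open>\<rho> r\<close> back to \<open>r\<close>, so the sampling point \<open>g t\<close>
  and \<open>\<tau> t\<close> lie on the same side of every jump and \<open>f\<close> differs little
  between them. The gap hypothesis keeps the points \<open>\<rho> r\<close> distinct and away from
  \<open>p\<close>.\<close>

lemma grid_step_close:
  assumes f: "f \<in> skorokhod_paths p q" and pq: "p < q" and n: "n > 0" and \<eta>: "\<eta> > 0"
    and S: "finite S" "S \<subseteq> {p<..<q}"
    and osc: "\<And>s t. p < s \<Longrightarrow> s \<le> t \<Longrightarrow> t \<le> q \<Longrightarrow> S \<inter> {s..<t} = {} \<Longrightarrow> \<bar>f s - f t\<bar> \<le> \<eta>"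
    and gap: "\<And>s t. s \<in> insert p S \<Longrightarrow> t \<in> S \<Longrightarrow> s < t \<Longrightarrow> (q - p) / real n < t - s"
  shows "skorokhod_dist p q (grid_step p q n f) f \<le> (q - p) / real n + \<eta> + 1 / real n"
proof -
  define N where "N t = real n / (q - p) * (t - p)" for t
  define pt where "pt k = p + (q - p) * real_of_int k / real n" for k
  define \<rho> where "\<rho> s = pt \<lfloor>N s\<rfloor>" for s
  define g where "g t = pt \<lceil>N t\<rceil>" for t
  define \<mu> where "\<mu> = (q - p) / real n"
  have \<mu>: "\<mu> > 0" using pq n by (simp add: \<mu>_def)
  have pt: "pt k = p + \<mu> * real_of_int k" for k by (simp add: pt_def \<mu>_def)
  have N: "t = p + \<mu> * N t" for t using pq n by (simp add: N_def \<mu>_def)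
  have N_le: "N s \<le> N t \<longleftrightarrow> s \<le> t" for s t
    using \<mu> by (subst (3 4) N) simp
  have Np: "N p = 0" and Nq: "N q = real n" using pq by (auto simp: N_def)
  have \<rho>_close: "\<rho> s \<le> s" "s - \<rho> s \<le> \<mu>" for s
  proof -
    have "s - \<rho> s = \<mu> * (N s - \<lfloor>N s\<rfloor>)" by (subst (1) N) (simp add: \<rho>_def pt algebra_simps)
    moreover have "0 \<le> N s - \<lfloor>N s\<rfloor>" "N s - \<lfloor>N s\<rfloor> \<le> 1" by linarith+
    moreover from this have "0 \<le> \<mu> * (N s - \<lfloor>N s\<rfloor>)" "\<mu> * (N s - \<lfloor>N s\<rfloor>) \<le> \<mu> * 1"
      using \<mu> by (intro mult_nonneg_nonneg mult_left_mono; simp)+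
    ultimately show "\<rho> s \<le> s" "s - \<rho> s \<le> \<mu>" by linarith+
  qed
  have g_ge: "t \<le> g t" for t
  proof -
    have "\<mu> * N t \<le> \<mu> * real_of_int \<lceil>N t\<rceil>" using \<mu> by (intro mult_left_mono) auto
    then show ?thesis by (subst (1) N) (simp add: g_def pt)
  qed
  have g_le: "g t \<le> q" if "t \<le> q" for t
  proof -
    have "N t \<le> real_of_int (int n)" using that N_le[of t q] Nq by simp
    then have "\<lceil>N t\<rceil> \<le> int n" by (simp add: ceiling_le_iff)
    then have "\<mu> * real_of_int \<lceil>N t\<rceil> \<le> \<mu> * real n" using \<mu> by (intro mult_left_mono) auto
    then show ?thesis using N[of q] by (simp add: g_def pt Nq)
  qed
  \<comment> \<open>Rounding up and rounding down to the grid are adjoint.\<close>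
  have \<rho>_iff: "g t \<le> r \<longleftrightarrow> t \<le> \<rho> r" for t r
  proof
    assume "g t \<le> r"
    then have "\<mu> * real_of_int \<lceil>N t\<rceil> \<le> \<mu> * N r" using N[of r] by (simp add: g_def pt)
    then have "\<lceil>N t\<rceil> \<le> \<lfloor>N r\<rfloor>" using \<mu> by (simp add: le_floor_iff)
    then have "\<mu> * real_of_int \<lceil>N t\<rceil> \<le> \<mu> * real_of_int \<lfloor>N r\<rfloor>" using \<mu> by (intro mult_left_mono) auto
    then have "g t \<le> \<rho> r" by (simp add: g_def \<rho>_def pt)
    then show "t \<le> \<rho> r" using g_ge[of t] by linarith
  next
    assume "t \<le> \<rho> r"
    then have "\<mu> * N t \<le> \<mu> * real_of_int \<lfloor>N r\<rfloor>" using N[of t] by (simp add: \<rho>_def pt)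
    then have "\<lceil>N t\<rceil> \<le> \<lfloor>N r\<rfloor>" using \<mu> by (simp add: ceiling_le_iff)
    then have "\<mu> * real_of_int \<lceil>N t\<rceil> \<le> \<mu> * real_of_int \<lfloor>N r\<rfloor>" using \<mu> by (intro mult_left_mono) auto
    then show "g t \<le> r" using \<rho>_close(1)[of r] by (simp add: g_def \<rho>_def pt)
  qed
  have \<rho>_less: "\<rho> s < \<rho> t" if "\<mu> < t - s" for s t
  proof -
    have "\<mu> * 1 < \<mu> * (N t - N s)" using that N[of s] N[of t] by (simp add: algebra_simps)
    then have "1 < N t - N s" using \<mu> by (simp only: mult_less_cancel_left_pos)
    then have "\<lfloor>N s\<rfloor> < \<lfloor>N t\<rfloor>" by linarith
    then show ?thesis using \<mu> by (simp add: \<rho>_def pt)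
  qed
  have \<rho>p: "\<rho> p = p" by (simp add: \<rho>_def pt Np)
  have "\<exists>\<tau>. strict_mono_on {p..q} \<tau> \<and> \<tau> ` {p..q} = {p..q} \<and> \<tau> q = q \<and> (\<forall>s\<in>S. \<tau> (\<rho> s) = s) \<and>
      (\<forall>t\<in>{p..q}. \<bar>\<tau> t - t\<bar> \<le> \<mu>)"
  proof (rule piecewise_affine_time_change)
    show "\<forall>s\<in>S. p < s \<and> s < q \<and> p < \<rho> s \<and> \<rho> s < q \<and> \<bar>s - \<rho> s\<bar> \<le> \<mu>"
    proof
      fix s assume s: "s \<in> S"
      then have "p < s" "s < q" using S by auto
      moreover have "\<rho> p < \<rho> s" using gap[of p s] s \<open>p < s\<close> by (intro \<rho>_less) (auto simp: \<mu>_def)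
      ultimately show "p < s \<and> s < q \<and> p < \<rho> s \<and> \<rho> s < q \<and> \<bar>s - \<rho> s\<bar> \<le> \<mu>"
        using \<rho>_close[of s] \<rho>p by auto
    qed
    show "strict_mono_on S \<rho>"
      using gap by (intro strict_mono_onI \<rho>_less) (auto simp: \<mu>_def)
  qed (use pq \<mu> S in auto)
  then obtain \<tau> where \<tau>: "strict_mono_on {p..q} \<tau>" "\<tau> ` {p..q} = {p..q}" "\<And>s. s \<in> S \<Longrightarrow> \<tau> (\<rho> s) = s"
    "\<And>t. t \<in> {p..q} \<Longrightarrow> \<bar>\<tau> t - t\<bar> \<le> \<mu>" by blast
  have tc: "\<tau> \<in> time_changes p q" using \<tau> by (simp add: time_changes_def)
  have \<tau>_le: "\<tau> s \<le> \<tau> t \<longleftrightarrow> s \<le> t" if "s \<in> {p..q}" "t \<in> {p..q}" for s t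
  proof -
    have "\<tau> s < \<tau> t \<longleftrightarrow> s < t" "\<tau> t < \<tau> s \<longleftrightarrow> t < s"
      using \<tau>(1) that by (simp_all add: strict_mono_on_less)
    then show ?thesis by linarith
  qed
  have \<rho>pq: "\<rho> r \<in> {p..q}" if "r \<in> S" for r
  proof -
    have r: "p < r" "r < q" using that S by auto
    then have "\<mu> < r - p" using gap[of p r] that by (simp add: \<mu>_def)
    from \<rho>_less[OF this] \<rho>p \<rho>_close(1)[of r] r show ?thesis by simp
  qed
  have close: "\<bar>f (g t) - f (\<tau> t)\<bar> \<le> \<eta>" if t: "t \<in> {p..q}" for t
  \<comment> \<open>At \<open>t = p\<close> both arguments equal \<open>p\<close>, a point outside
    the scope of the oscillation bound.\<close>
  proof (cases "t = p")
    case True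
    then show ?thesis using time_change_left[OF tc] pq \<eta> by (simp add: g_def pt Np)
  next
    case False
    then have tp: "p < t" using t by auto
    have "\<tau> p < \<tau> t" using \<tau>(1) tp t pq by (auto simp: strict_mono_on_def)
    then have \<tau>t: "p < \<tau> t" "\<tau> t \<le> q" using time_change_left[OF tc] pq time_change_in[OF tc t] by auto
    have gt: "p < g t" "g t \<le> q" using tp g_ge[of t] g_le[of t] t by auto
    have *: "g t \<le> r \<longleftrightarrow> \<tau> t \<le> r" if "r \<in> S" for r
      using \<rho>_iff[of t r] \<tau>_le[OF t \<rho>pq[OF that]] \<tau>(3)[OF that] by simp
    show ?thesis
    proof (cases "g t \<le> \<tau> t")
      case True
      have "S \<inter> {g t..<\<tau> t} = {}" using * by force
      then show ?thesis using osc[of "g t" "\<tau> t"] True gt \<tau>t by auto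
    next
      case False
      have "S \<inter> {\<tau> t..<g t} = {}" using * by force
      then show ?thesis using osc[of "\<tau> t" "g t"] False gt \<tau>t by (auto simp: abs_minus_commute)
    qed
  qed
  have step: "grid_step p q n f t = real_of_int \<lfloor>real n * f (g t)\<rfloor> / real n" if "t \<in> {p..q}" for t
    using that by (simp add: grid_step_def g_def pt_def N_def right_diff_distrib)
  have step_close: "\<bar>grid_step p q n f t - f (\<tau> t)\<bar> \<le> \<eta> + 1 / real n" if t: "t \<in> {p..q}" for t
  proof -
    have "grid_step p q n f t - f (g t) = (real_of_int \<lfloor>real n * f (g t)\<rfloor> - real n * f (g t)) / real n"
      using n by (simp add: step[OF t] diff_divide_distrib)
    also have "\<bar>\<dots>\<bar> \<le> 1 / real n"
    proof -
      have "\<bar>real_of_int \<lfloor>real n * f (g t)\<rfloor> - real n * f (g t)\<bar> \<le> 1" by linarith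
      then show ?thesis by (simp add: divide_right_mono)
    qed
    finally show ?thesis using close[OF t] by linarith
  qed
  have "\<mu> + \<eta> + 1 / real n \<in> skorokhod_close p q (grid_step p q n f) f"
  proof (intro skorokhod_closeI[OF _ tc])
    have i: "0 \<le> 1 / real n" by simp
    show "0 < \<mu> + \<eta> + 1 / real n" using i \<mu> \<eta> by linarith
    fix t assume t: "t \<in> {p..q}"
    show "\<bar>\<tau> t - t\<bar> \<le> \<mu> + \<eta> + 1 / real n" using \<tau>(4)[OF t] i \<eta> by linarith
    show "\<bar>grid_step p q n f t - f (\<tau> t)\<bar> \<le> \<mu> + \<eta> + 1 / real n" using step_close[OF t] i \<mu> by linarith
  qed
  then show ?thesis using skorokhod_dist_le by (simp add: \<mu>_def)
qed

lemma grid_step_tendsto: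
  assumes f: "f \<in> skorokhod_paths p q" and pq: "p < q"
  shows "(\<lambda>n. skorokhod_dist p q (grid_step p q (Suc n) f) f) \<longlonglongrightarrow> 0"
proof (rule LIMSEQ_I)
  fix e :: real assume e: "e > 0"
  obtain S where S: "finite S" "S \<subseteq> {p<..<q}"
    "\<And>s t. p < s \<Longrightarrow> s \<le> t \<Longrightarrow> t \<le> q \<Longrightarrow> S \<inter> {s..<t} = {} \<Longrightarrow> \<bar>f s - f t\<bar> \<le> e / 4"
    using skorokhod_path_oscillation[OF f less_imp_le[OF pq], of "e / 4"] e by auto
  define G where "G = {x \<in> (\<lambda>(s, t). t - s) ` (insert p S \<times> S). 0 < x}"
  have "finite G" using S by (simp add: G_def)
  \<comment> \<open>The extra 1 keeps the minimum meaningful when there are no gaps.\<close>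
  define \<gamma> where "\<gamma> = Min (insert 1 G)"
  have \<gamma>: "0 < \<gamma>" unfolding \<gamma>_def using \<open>finite G\<close> by (subst Min_gr_iff) (auto simp: G_def)
  have gap: "\<gamma> \<le> t - s" if "s \<in> insert p S" "t \<in> S" "s < t" for s t
  proof -
    have "t - s \<in> G" unfolding G_def using that by force
    then show ?thesis unfolding \<gamma>_def using \<open>finite G\<close> by (intro Min_le) auto
  qed
  have "(\<lambda>n. (q - p) / real (Suc n)) \<longlonglongrightarrow> 0" "(\<lambda>n. 1 / real (Suc n)) \<longlonglongrightarrow> 0"
    by (intro LIMSEQ_Suc[of "\<lambda>n. _ / real n"] lim_const_over_n)+
  from order_tendstoD(2)[OF this(1), of "min \<gamma> (e / 4)"] order_tendstoD(2)[OF this(2), of "e / 4"] \<gamma> e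
  have "\<forall>\<^sub>F n in sequentially. (q - p) / real (Suc n) < min \<gamma> (e / 4) \<and> 1 / real (Suc n) < e / 4"
    by (auto elim: eventually_elim2)
  then obtain n0 where n0: "\<And>n. n \<ge> n0 \<Longrightarrow> (q - p) / real (Suc n) < min \<gamma> (e / 4) \<and> 1 / real (Suc n) < e / 4"
    by (auto simp: eventually_sequentially)
  interpret Metric_space "skorokhod_paths p q" "skorokhod_dist p q" by (rule Metric_space_skorokhod)
  have "norm (skorokhod_dist p q (grid_step p q (Suc n) f) f - 0) < e" if "n \<ge> n0" for n
  proof -
    have gap': "(q - p) / real (Suc n) < t - s" if "s \<in> insert p S" "t \<in> S" "s < t" for s t
      using n0[OF \<open>n \<ge> n0\<close>] gap[OF that] by linarith
    have "skorokhod_dist p q (grid_step p q (Suc n) f) f \<le> (q - p) / real (Suc n) + e / 4 + 1 / real (Suc n)"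
      using e gap' by (intro grid_step_close[OF f pq _ _ S]) auto
    then have "skorokhod_dist p q (grid_step p q (Suc n) f) f < e" using n0[OF that] e by linarith
    then show ?thesis using nonneg by (simp add: abs_of_nonneg)
  qed
  then show "\<exists>no. \<forall>n\<ge>no. norm (skorokhod_dist p q (grid_step p q (Suc n) f) f - 0) < e" by blast
qed

text \<open>The approximants are coded by integer lists. The preimage of any set is therefore a
  countable union of events about finitely many coordinates, and Borel measurability passes to the
  limit in the metric.\<close>

lemma measurable_skorokhodI:
  assumes pq: "p < q" and X: "\<And>\<omega>. \<omega> \<in> space Q \<Longrightarrow> X \<omega> \<in> skorokhod_paths p q"
    and meas: "\<And>t. t \<in> {p..q} \<Longrightarrow> (\<lambda>\<omega>. X \<omega> t) \<in> borel_measurable Q"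
  shows "X \<in> measurable Q (borel_of_topology (skorokhod_topology p q))"
  unfolding skorokhod_topology_def
proof (rule Metric_space.measurable_metric_limit[OF Metric_space_skorokhod, where Xn = "\<lambda>n \<omega>. grid_step p q (Suc n) (X \<omega>)"])
  fix n :: nat and A :: "(real \<Rightarrow> real) set"
  let ?n = "Suc n"
  \<comment> \<open>Index 0 is attained only at \<open>t = p\<close>, hence \<open>?n + 1\<close>
    values for \<open>?n\<close> cells.\<close>
  define vals where "vals f = map (\<lambda>k. \<lfloor>real ?n * f (p + (q - p) * real k / real ?n)\<rfloor>) [0..<Suc ?n]"
    for f :: "real \<Rightarrow> real"
  define \<Phi> where "\<Phi> v = (\<lambda>t\<in>{p..q}. real_of_int (v ! nat \<lceil>real ?n / (q - p) * t + - (real ?n / (q - p) * p)\<rceil>) / real ?n)"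
    for v :: "int list"
  have \<Phi>: "grid_step p q ?n f = \<Phi> (vals f)" for f
    unfolding grid_step_def \<Phi>_def
  proof (rule restrict_ext)
    fix t assume t: "t \<in> {p..q}"
    let ?N = "real ?n / (q - p) * t + - (real ?n / (q - p) * p)"
    have N: "?N = real ?n / (q - p) * (t - p)"
      unfolding right_diff_distrib by (rule add_uminus_conv_diff)
    have "0 \<le> ?N" unfolding N using t pq by simp
    moreover have "?N \<le> real ?n / (q - p) * (q - p)" unfolding N using t pq by (intro mult_left_mono) auto
    ultimately have "0 \<le> \<lceil>?N\<rceil>" "\<lceil>?N\<rceil> \<le> int ?n" using pq by (simp_all add: ceiling_le_iff)
    then have "nat \<lceil>?N\<rceil> < Suc ?n" "real (nat \<lceil>?N\<rceil>) = real_of_int \<lceil>?N\<rceil>" by auto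
    then show "real_of_int \<lfloor>real ?n * f (p + (q - p) * real_of_int \<lceil>?N\<rceil> / real ?n)\<rfloor> / real ?n
      = real_of_int (vals f ! nat \<lceil>?N\<rceil>) / real ?n"
      unfolding vals_def by (subst nth_map) (auto simp del: upt_Suc)
  qed
  have "{\<omega> \<in> space Q. grid_step p q ?n (X \<omega>) \<in> A}
      = (\<Union>v\<in>{v. \<Phi> v \<in> A}. {\<omega> \<in> space Q. vals (X \<omega>) = v})" by (auto simp: \<Phi>)
  also have "\<dots> \<in> sets Q"
  proof -
    have vals: "{\<omega> \<in> space Q. vals (X \<omega>) = v} \<in> sets Q" for v
    proof -
    have eq: "{\<omega> \<in> space Q. vals (X \<omega>) = v} = (if length v = Suc ?n then
        {\<omega> \<in> space Q. \<forall>k\<in>{..?n}. \<lfloor>real ?n * X \<omega> (p + (q - p) * real k / real ?n)\<rfloor> = v ! k} else {})"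
      by (auto simp: vals_def list_eq_iff_nth_eq less_Suc_eq_le simp del: upt_Suc)
    have *: "(\<lambda>\<omega>. X \<omega> (p + (q - p) * real k / real ?n)) \<in> borel_measurable Q" if "k \<in> {..?n}" for k
    proof (rule meas)
      have "(q - p) * (real k / real ?n) \<le> (q - p) * 1" using that pq by (intro mult_left_mono) auto
      then show "p + (q - p) * real k / real ?n \<in> {p..q}" using pq by auto
    qed
    show ?thesis
    proof -
      have "{\<omega> \<in> space Q. \<lfloor>real ?n * X \<omega> (p + (q - p) * real k / real ?n)\<rfloor> = v ! k} \<in> sets Q"
        if "k \<in> {..?n}" for k
      proof -
        note [measurable] = *[OF that]
        show ?thesis by measurable
      qed
      then have fin: "{\<omega> \<in> space Q. \<forall>k\<in>{..?n}. \<lfloor>real ?n * X \<omega> (p + (q - p) * real k / real ?n)\<rfloor> = v ! k} \<in> sets Q"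
        by (rule sets.sets_Collect_finite_All) auto
      show ?thesis
      proof (cases "length v = Suc ?n")
        case True
        show ?thesis unfolding eq if_P[OF True] by (rule fin)
      next
        case False
        show ?thesis unfolding eq if_not_P[OF False] by (rule sets.empty_sets)
      qed
    qed
    qed
    show ?thesis by (rule sets.countable_UN') (auto intro: vals)
  qed
  finally show "{\<omega> \<in> space Q. grid_step p q ?n (X \<omega>) \<in> A} \<in> sets Q" .
qed (use X pq grid_step_skorokhod grid_step_tendsto in auto)

section \<open>Quantile functions\<close>

text \<open>Right continuity of the distribution function makes the infimum attained, and its limits
  at both ends make the set nonempty and bounded below. Monotonicity, left continuity and
  measurability of quantiles all come from this equivalence.\<close>

lemma (in real_distribution) quantile_le_iff:
  assumes t: "0 < t" "t < 1"
  shows "quantile M t \<le> x \<longleftrightarrow> t \<le> cdf M x"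
proof -
  let ?S = "{x. t \<le> cdf M x}"
  have "\<forall>\<^sub>F x in at_top. t < cdf M x" using cdf_lim_at_top_prob t by (intro order_tendstoD) auto
  then obtain x1 where x1: "t < cdf M x1" by (auto simp: eventually_at_top_linorder)
  have "\<forall>\<^sub>F x in at_bot. cdf M x < t" using cdf_lim_at_bot t by (intro order_tendstoD) auto
  then obtain x0 where x0: "\<And>x. x \<le> x0 \<Longrightarrow> cdf M x < t" by (auto simp: eventually_at_bot_linorder)
  have bdd: "bdd_below ?S" by (rule bdd_belowI[of _ x0]) (use x0 in \<open>metis mem_Collect_eq linorder_not_less less_imp_le\<close>)
  have "t \<le> cdf M (quantile M t)"
  proof (rule tendsto_lowerbound)
    show "(cdf M \<longlongrightarrow> cdf M (quantile M t)) (at_right (quantile M t))"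
      using cdf_is_right_cont by (simp add: continuous_within)
    show "\<forall>\<^sub>F y in at_right (quantile M t). t \<le> cdf M y"
      using eventually_at_right_less
    proof eventually_elim
      case (elim y)
      then obtain z where "z \<in> ?S" "z < y"
        using cInf_lessD[of ?S y] x1 unfolding quantile_def by (metis empty_iff less_imp_le mem_Collect_eq)
      then show ?case using cdf_nondecreasing[of z y] by simp
    qed
  qed simp
  then show ?thesis
    using cdf_nondecreasing[of "quantile M t" x] cInf_lower[OF _ bdd, of x] by (auto simp: quantile_def)
qed

context real_distribution
begin

lemma quantile_mono:
  assumes "0 < s" "s \<le> t" "t < 1"
  shows "quantile M s \<le> quantile M t"
  using quantile_le_iff[of s "quantile M t"] quantile_le_iff[of t "quantile M t"] assms by simp

lemma quantile_tendsto_left: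
  assumes t: "0 < t" "t < 1"
  shows "(quantile M \<longlongrightarrow> quantile M t) (at_left t)"
proof (rule order_tendstoI)
  fix c assume "c < quantile M t"
  then have "cdf M c < t" using quantile_le_iff[OF t, of c] by simp
  then have "max 0 (cdf M c) < t" using t by simp
  from eventually_at_left_real[OF this] show "\<forall>\<^sub>F s in at_left t. c < quantile M s"
  proof eventually_elim
    case (elim s)
    then show ?case using quantile_le_iff[of s c] t by auto
  qed
next
  fix c assume c: "quantile M t < c"
  from eventually_at_left_real[OF t(1)] show "\<forall>\<^sub>F s in at_left t. quantile M s < c"
  proof eventually_elim
    case (elim s)
    then show ?case using quantile_mono[of s t] t c by auto
  qed
qed

lemma quantile_tendsto_right:
  assumes t: "0 < t" "t < 1"
  shows "\<exists>l. (quantile M \<longlongrightarrow> l) (at_right t)"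
proof -
  let ?l = "Inf (quantile M ` {t<..<1})"
  have bdd: "bdd_below (quantile M ` {t<..<1})"
    using t by (intro bdd_belowI2[of _ "quantile M t"] quantile_mono) auto
  have ne: "quantile M ` {t<..<1} \<noteq> {}" using t by auto
  have "(quantile M \<longlongrightarrow> ?l) (at_right t)"
  proof (rule order_tendstoI)
    fix c assume c: "c < ?l"
    from eventually_at_right_real[OF t(2)] show "\<forall>\<^sub>F s in at_right t. c < quantile M s"
    proof eventually_elim
      case (elim s)
      then have "?l \<le> quantile M s" by (intro cInf_lower bdd) auto
      with c show ?case by simp
    qed
  next
    fix c assume "?l < c"
    then obtain u where u: "t < u" "u < 1" "quantile M u < c" using cInf_lessD[OF ne, of c] by auto
    from eventually_at_right_real[OF u(1)] show "\<forall>\<^sub>F s in at_right t. quantile M s < c"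
    proof eventually_elim
      case (elim s)
      then show ?case using quantile_mono[of s u] t u by auto
    qed
  qed
  then show ?thesis by blast
qed

text \<open>To the left of the quantile the distribution function stays below \<open>t\<close>, and
  continuity carries the bound to the quantile itself.\<close>

lemma cdf_quantile:
  assumes cont: "continuous_on UNIV (cdf M)" and t: "0 < t" "t < 1"
  shows "cdf M (quantile M t) = t"
proof (rule antisym)
  show "t \<le> cdf M (quantile M t)" using quantile_le_iff[OF t] by blast
  show "cdf M (quantile M t) \<le> t"
  proof (rule tendsto_upperbound)
    show "(cdf M \<longlongrightarrow> cdf M (quantile M t)) (at_left (quantile M t))"
      using cont by (auto simp: continuous_on_def intro: tendsto_within_subset)
    show "\<forall>\<^sub>F y in at_left (quantile M t). cdf M y \<le> t"
      using eventually_at_left_real[of "quantile M t - 1" "quantile M t", simplified]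
    proof eventually_elim
      case (elim y)
      then show ?case using quantile_le_iff[OF t, of y] by simp
    qed
  qed simp
qed

end

section \<open>Uniform first order expansion of the quantile function\<close>

lemma uniform_first_order_expansion:
  fixes f h :: "real \<Rightarrow> real"
  assumes ab: "a \<le> b" and \<epsilon>: "\<epsilon> > 0"
    and deriv: "\<And>x. x \<in> {a - \<epsilon>..b + \<epsilon>} \<Longrightarrow> (f has_real_derivative h x) (at x within {a - \<epsilon>..b + \<epsilon>})"
    and cont: "continuous_on {a..b} h" and \<eta>: "\<eta> > 0"
  obtains \<delta> where "\<delta> > 0" "\<And>x y. y \<in> {a..b} \<Longrightarrow> \<bar>x - y\<bar> \<le> \<delta> \<Longrightarrow> \<bar>f x - f y - h y * (x - y)\<bar> \<le> \<eta> * \<bar>x - y\<bar>"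
proof -
  have pt: "\<exists>\<delta>>0. \<forall>x. \<bar>x - y\<bar> < \<delta> \<longrightarrow> \<bar>f x - f y - h y * (x - y)\<bar> \<le> \<eta> / 3 * \<bar>x - y\<bar>" if y: "y \<in> {a..b}" for y
  proof -
    have "(f has_real_derivative h y) (at y)"
      using deriv[of y] y \<epsilon> at_within_interior[of y "{a - \<epsilon>..b + \<epsilon>}"] by auto
    then have "(f has_derivative (*) (h y)) (at y)" by (simp add: has_field_derivative_def)
    then have "\<exists>d>0. \<forall>x. norm (x - y) < d \<longrightarrow> norm (f x - f y - h y * (x - y)) \<le> \<eta> / 3 * norm (x - y)"
      using \<eta> unfolding has_derivative_at_alt by (metis divide_pos_pos zero_less_numeral)
    then show ?thesis by simp
  qed
  \<comment> \<open>Continuity of \<open>h\<close> is available only on \<open>{a..b}\<close>. For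
    \<open>x\<close> outside, the expansion is routed through the nearer endpoint, where
    differentiability at a single point suffices.\<close>
  obtain \<delta>a \<delta>b where \<delta>ab: "\<delta>a > 0" "\<And>x. \<bar>x - a\<bar> < \<delta>a \<Longrightarrow> \<bar>f x - f a - h a * (x - a)\<bar> \<le> \<eta> / 3 * \<bar>x - a\<bar>"
    "\<delta>b > 0" "\<And>x. \<bar>x - b\<bar> < \<delta>b \<Longrightarrow> \<bar>f x - f b - h b * (x - b)\<bar> \<le> \<eta> / 3 * \<bar>x - b\<bar>"
    using pt[of a] pt[of b] ab by (auto simp del: abs_less_iff) 
  have "uniformly_continuous_on {a..b} h" using cont by (simp add: compact_uniformly_continuous)
  then obtain \<delta>h where \<delta>h: "\<delta>h > 0" "\<And>x y. x \<in> {a..b} \<Longrightarrow> y \<in> {a..b} \<Longrightarrow> \<bar>x - y\<bar> < \<delta>h \<Longrightarrow> \<bar>h x - h y\<bar> < \<eta> / 3"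
    unfolding uniformly_continuous_on_def dist_real_def using \<eta> by (metis divide_pos_pos zero_less_numeral)
  have mvt: "\<exists>\<xi>\<in>{x..y}. f y - f x = h \<xi> * (y - x)" if "x \<in> {a..b}" "y \<in> {a..b}" "x \<le> y" for x y
  proof -
    have "(f has_derivative (*) (h z)) (at z within {x..y})" if "x \<le> z" "z \<le> y" for z
      using deriv[of z] that \<open>x \<in> {a..b}\<close> \<open>y \<in> {a..b}\<close> \<epsilon>
      by (auto simp: has_field_derivative_def intro: has_derivative_subset)
    with mvt_very_simple[OF that(3), of f "\<lambda>z. (*) (h z)"] show ?thesis by auto
  qed
  have inner: "\<bar>f x - f y - h y * (x - y)\<bar> \<le> \<eta> / 3 * \<bar>x - y\<bar>"
    if xy: "x \<in> {a..b}" "y \<in> {a..b}" "\<bar>x - y\<bar> < \<delta>h" for x y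
  proof -
    obtain \<xi> where \<xi>: "\<xi> \<in> {a..b}" "\<bar>\<xi> - y\<bar> < \<delta>h" "f x - f y = h \<xi> * (x - y)"
    proof (cases "x \<le> y")
      case True
      then obtain \<xi> where "\<xi> \<in> {x..y}" "f y - f x = h \<xi> * (y - x)" using mvt xy by blast
      then show ?thesis using xy by (intro that[of \<xi>]) (auto simp: algebra_simps)
    next
      case False
      then obtain \<xi> where "\<xi> \<in> {y..x}" "f x - f y = h \<xi> * (x - y)" using mvt[of y x] xy by auto
      then show ?thesis using xy by (intro that[of \<xi>]) auto
    qed
    have "f x - f y - h y * (x - y) = (h \<xi> - h y) * (x - y)" using \<xi>(3) by (simp add: algebra_simps)
    then have "\<bar>f x - f y - h y * (x - y)\<bar> = \<bar>h \<xi> - h y\<bar> * \<bar>x - y\<bar>" by (simp add: abs_mult)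
    also have "\<dots> \<le> \<eta> / 3 * \<bar>x - y\<bar>" using \<delta>h(2)[OF \<xi>(1) xy(2) \<xi>(2)] by (intro mult_right_mono) auto
    finally show ?thesis .
  qed
  define \<delta> where "\<delta> = min \<delta>h (min \<delta>a \<delta>b) / 2"
  have \<delta>: "\<delta> > 0" "\<delta> < \<delta>h" "\<delta> < \<delta>a" "\<delta> < \<delta>b" using \<delta>h(1) \<delta>ab(1,3) by (auto simp: \<delta>_def)
  show ?thesis
  proof (rule that[OF \<delta>(1)])
    fix x y assume y: "y \<in> {a..b}" and xy: "\<bar>x - y\<bar> \<le> \<delta>"
    \<comment> \<open>With \<open>c\<close> between \<open>x\<close> and \<open>y\<close>, three
      errors add up: the expansion at \<open>c\<close>, the change of slope from \<open>h y\<close>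
      to \<open>h c\<close>, and the expansion inside the interval.\<close>
    have outer: "\<bar>f x - f y - h y * (x - y)\<bar> \<le> \<eta> * \<bar>x - y\<bar>"
      if c: "c \<in> {a..b}" "\<bar>x - y\<bar> = \<bar>x - c\<bar> + \<bar>c - y\<bar>"
        "\<bar>f x - f c - h c * (x - c)\<bar> \<le> \<eta> / 3 * \<bar>x - c\<bar>" for c
    proof -
      have "\<bar>c - y\<bar> < \<delta>h" using c(2) xy \<delta> by linarith
      have "f x - f y - h y * (x - y) = (f x - f c - h c * (x - c)) + (h c - h y) * (x - c)
          + (f c - f y - h y * (c - y))" by (simp add: algebra_simps)
      moreover have "\<bar>(h c - h y) * (x - c)\<bar> \<le> \<eta> / 3 * \<bar>x - c\<bar>"
        unfolding abs_mult using \<delta>h(2)[OF c(1) y \<open>\<bar>c - y\<bar> < \<delta>h\<close>] by (intro mult_right_mono) auto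
      moreover note c(3) inner[OF c(1) y \<open>\<bar>c - y\<bar> < \<delta>h\<close>]
      ultimately have "\<bar>f x - f y - h y * (x - y)\<bar> \<le> \<eta> / 3 * \<bar>x - c\<bar> + \<eta> / 3 * \<bar>x - c\<bar> + \<eta> / 3 * \<bar>c - y\<bar>"
        by linarith
      also have "\<dots> \<le> \<eta> * (\<bar>x - c\<bar> + \<bar>c - y\<bar>)"
      proof -
        have "0 \<le> \<eta> * \<bar>x - c\<bar>" "0 \<le> \<eta> * \<bar>c - y\<bar>" using \<eta> by auto
        then show ?thesis unfolding distrib_left by linarith
      qed
      finally show ?thesis using c(2) by simp
    qed
    consider "x \<in> {a..b}" | "x < a" | "x > b" by fastforce
    then show "\<bar>f x - f y - h y * (x - y)\<bar> \<le> \<eta> * \<bar>x - y\<bar>"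
    proof cases
      case 1
      then have "\<bar>f x - f y - h y * (x - y)\<bar> \<le> \<eta> / 3 * \<bar>x - y\<bar>" using inner y xy \<delta> by auto
      also have "\<dots> \<le> \<eta> * \<bar>x - y\<bar>" using \<eta> by (intro mult_right_mono) auto
      finally show ?thesis .
    next
      case 2
      then show ?thesis using y xy \<delta> ab by (intro outer[of a] \<delta>ab(2)) auto
    next
      case 3
      then show ?thesis using y xy \<delta> ab by (intro outer[of b] \<delta>ab(4)) auto
    qed
  qed
qed

text \<open>Inverts the expansion of the distribution function, uniformly in \<open>t\<close>. The
  difficulty is to know beforehand that the two quantiles are close; this follows from the lower
  bound on \<open>h\<close> at distance \<open>\<delta>1\<close> and monotonicity beyond.\<close>

lemma quantile_expansion:
  fixes H :: "real measure"
  assumes pq: "0 < p" "p < q" "q < 1" and H: "real_distribution H" and cont: "continuous_on UNIV (cdf H)"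
    and \<epsilon>: "\<epsilon> > 0"
    and deriv: "\<And>x. x \<in> {quantile H p - \<epsilon>..quantile H q + \<epsilon>} \<Longrightarrow>
           (cdf H has_real_derivative h x) (at x within {quantile H p - \<epsilon>..quantile H q + \<epsilon>})"
    and pos: "\<And>x. x \<in> {quantile H p - \<epsilon>..quantile H q + \<epsilon>} \<Longrightarrow> h x > 0"
    and hcont: "continuous_on {quantile H p..quantile H q} h" and \<eta>: "\<eta> > 0"
  obtains \<delta> where "\<delta> > 0"
    "\<And>t u. t \<in> {p..q} \<Longrightarrow> 0 < u \<Longrightarrow> u < 1 \<Longrightarrow> \<bar>u - t\<bar> \<le> \<delta> \<Longrightarrow>
       \<bar>quantile H u - quantile H t - (u - t) / h (quantile H t)\<bar> \<le> \<eta> * \<bar>u - t\<bar>"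
proof -
  interpret real_distribution H by (rule H)
  let ?a = "quantile H p" and ?b = "quantile H q"
  have ab: "?a \<le> ?b" using quantile_mono[of p q] pq by simp
  obtain z where z: "z \<in> {?a..?b}" "\<And>x. x \<in> {?a..?b} \<Longrightarrow> h z \<le> h x"
    using continuous_attains_inf[OF _ _ hcont] ab by auto
  define c where "c = h z"
  have c: "c > 0" using pos[of z] z \<epsilon> by (auto simp: c_def)
  have hc: "c \<le> h x" if "x \<in> {?a..?b}" for x using z(2)[OF that] by (simp add: c_def)
  \<comment> \<open>The first bound keeps difference quotients above \<open>c / 2\<close>; the
    second pays for dividing by \<open>h \<ge> c\<close> and by that slope.\<close>
  define \<eta>1 where "\<eta>1 = min (c / 2) (\<eta> * c * c / 2)"
  have \<eta>1: "\<eta>1 > 0" "\<eta>1 \<le> c / 2" "\<eta>1 \<le> \<eta> * c * c / 2" using c \<eta> by (auto simp: \<eta>1_def)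
  obtain \<delta>1 where \<delta>1: "\<delta>1 > 0" "\<And>x y. y \<in> {?a..?b} \<Longrightarrow> \<bar>x - y\<bar> \<le> \<delta>1 \<Longrightarrow>
      \<bar>cdf H x - cdf H y - h y * (x - y)\<bar> \<le> \<eta>1 * \<bar>x - y\<bar>"
    using uniform_first_order_expansion[OF ab \<epsilon> deriv hcont \<eta>1(1)] by blast
  show ?thesis
  proof (rule that[of "c * \<delta>1 / 4"])
    show "0 < c * \<delta>1 / 4" using c \<delta>1 by simp
    fix t u assume t: "t \<in> {p..q}" and u: "0 < u" "u < 1" "\<bar>u - t\<bar> \<le> c * \<delta>1 / 4"
    define x y where "x = quantile H u" and "y = quantile H t"
    have t': "0 < t" "t < 1" using t pq by auto
    have Hx: "cdf H x = u" and Hy: "cdf H y = t"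
      unfolding x_def y_def using cdf_quantile[OF cont] u t' by auto
    have y: "y \<in> {?a..?b}" unfolding y_def using t pq by (auto intro!: quantile_mono)
    have hy: "c \<le> h y" by (rule hc[OF y])
    have low: "c / 2 * \<bar>w - y\<bar> \<le> \<bar>cdf H w - t\<bar>" if w: "\<bar>w - y\<bar> \<le> \<delta>1" for w
    proof -
      have "\<bar>h y * (w - y)\<bar> - \<bar>cdf H w - t\<bar> \<le> \<eta>1 * \<bar>w - y\<bar>"
        using \<delta>1(2)[OF y w] Hy by linarith
      moreover have "c * \<bar>w - y\<bar> \<le> \<bar>h y * (w - y)\<bar>"
        using hy c by (simp add: abs_mult mult_right_mono)
      moreover have "\<eta>1 * \<bar>w - y\<bar> \<le> c / 2 * \<bar>w - y\<bar>" using \<eta>1 by (intro mult_right_mono) auto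
      moreover have "c * \<bar>w - y\<bar> = c / 2 * \<bar>w - y\<bar> + c / 2 * \<bar>w - y\<bar>" by simp
      ultimately show ?thesis by linarith
    qed
    \<comment> \<open>A quantile farther away than \<open>\<delta>1\<close> would force
      \<open>\<bar>u - t\<bar> \<ge> c * \<delta>1 / 2\<close>, twice the radius allowed.\<close>
    have xy: "\<bar>x - y\<bar> \<le> \<delta>1"
    proof (rule ccontr)
      assume "\<not> \<bar>x - y\<bar> \<le> \<delta>1"
      then have "c / 2 * \<delta>1 \<le> \<bar>u - t\<bar>"
      proof (cases "x > y")
        case True
        with \<open>\<not> \<bar>x - y\<bar> \<le> \<delta>1\<close> have "y + \<delta>1 \<le> x" by auto
        then have "cdf H (y + \<delta>1) \<le> u" using cdf_nondecreasing Hx by metis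
        moreover have "t \<le> cdf H (y + \<delta>1)" using cdf_nondecreasing[of y "y + \<delta>1"] Hy \<delta>1(1) by simp
        ultimately show ?thesis using low[of "y + \<delta>1"] \<delta>1(1) by simp
      next
        case False
        with \<open>\<not> \<bar>x - y\<bar> \<le> \<delta>1\<close> have "x \<le> y - \<delta>1" by auto
        then have "u \<le> cdf H (y - \<delta>1)" using cdf_nondecreasing Hx by metis
        moreover have "cdf H (y - \<delta>1) \<le> t" using cdf_nondecreasing[of "y - \<delta>1" y] Hy \<delta>1(1) by simp
        ultimately show ?thesis using low[of "y - \<delta>1"] \<delta>1(1) by simp
      qed
      moreover have "c * \<delta>1 > 0" using c \<delta>1(1) by simp
      ultimately show False using u(3) by linarith
    qed
    have "\<bar>x - y - (u - t) / h y\<bar> = \<bar>u - t - h y * (x - y)\<bar> / h y"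
    proof -
      have "x - y - (u - t) / h y = - ((u - t - h y * (x - y)) / h y)" using hy c by (simp add: field_simps)
      then show ?thesis using hy c by simp
    qed
    also have "\<dots> \<le> \<eta>1 * \<bar>x - y\<bar> / c"
      using \<delta>1(2)[OF y xy] Hx Hy hy c by (intro frac_le) auto
    also have "\<dots> \<le> \<eta>1 * (2 / c * \<bar>u - t\<bar>) / c"
    proof -
      have "\<bar>x - y\<bar> \<le> 2 / c * \<bar>u - t\<bar>" using low[OF xy] Hx c by (simp add: field_simps)
      then show ?thesis using \<eta>1 c by (intro divide_right_mono mult_left_mono) auto
    qed
    also have "\<dots> = \<eta>1 * (2 / (c * c)) * \<bar>u - t\<bar>" by simp
    also have "\<dots> \<le> \<eta> * \<bar>u - t\<bar>"
    proof (rule mult_right_mono)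
      have "\<eta>1 * (2 / (c * c)) \<le> \<eta> * c * c / 2 * (2 / (c * c))" using \<eta>1 c by (intro mult_right_mono) auto
      also have "\<dots> = \<eta>" using c by simp
      finally show "\<eta>1 * (2 / (c * c)) \<le> \<eta>" .
    qed simp
    finally show "\<bar>quantile H u - quantile H t - (u - t) / h (quantile H t)\<bar> \<le> \<eta> * \<bar>u - t\<bar>"
      by (simp add: x_def y_def)
  qed
qed

lemma continuous_on_quantile:
  fixes H :: "real measure"
  assumes pq: "0 < p" "p < q" "q < 1" and H: "real_distribution H" and cont: "continuous_on UNIV (cdf H)"
    and \<epsilon>: "\<epsilon> > 0"
    and deriv: "\<And>x. x \<in> {quantile H p - \<epsilon>..quantile H q + \<epsilon>} \<Longrightarrow>
           (cdf H has_real_derivative h x) (at x within {quantile H p - \<epsilon>..quantile H q + \<epsilon>})"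
    and pos: "\<And>x. x \<in> {quantile H p - \<epsilon>..quantile H q + \<epsilon>} \<Longrightarrow> h x > 0"
    and hcont: "continuous_on {quantile H p..quantile H q} h"
  shows "continuous_on {p..q} (quantile H)"
proof -
  obtain \<delta> where \<delta>: "\<delta> > 0"
    "\<And>t u. t \<in> {p..q} \<Longrightarrow> 0 < u \<Longrightarrow> u < 1 \<Longrightarrow> \<bar>u - t\<bar> \<le> \<delta> \<Longrightarrow>
       \<bar>quantile H u - quantile H t - (u - t) / h (quantile H t)\<bar> \<le> 1 * \<bar>u - t\<bar>"
    using quantile_expansion[OF pq H cont \<epsilon> deriv pos hcont zero_less_one] by blast
  have "(quantile H \<longlongrightarrow> quantile H t) (at t within {p..q})" if t: "t \<in> {p..q}" for t
  proof -
    have "((\<lambda>u. \<bar>u - t\<bar> + \<bar>u - t\<bar> / \<bar>h (quantile H t)\<bar>) \<longlongrightarrow> \<bar>t - t\<bar> + \<bar>t - t\<bar> / \<bar>h (quantile H t)\<bar>) (at t within {p..q})"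
      unfolding divide_inverse by (intro tendsto_intros)
    then have lim: "((\<lambda>u. \<bar>u - t\<bar> + \<bar>u - t\<bar> / \<bar>h (quantile H t)\<bar>) \<longlongrightarrow> 0) (at t within {p..q})" by simp
    have "\<forall>\<^sub>F u in at t within {p..q}. u \<in> {p..q} \<and> dist u t < \<delta>"
      using \<delta>(1) by (auto simp: eventually_at intro!: exI[of _ \<delta>])
    then have "\<forall>\<^sub>F u in at t within {p..q}. norm (quantile H u - quantile H t) \<le> \<bar>u - t\<bar> + \<bar>u - t\<bar> / \<bar>h (quantile H t)\<bar>"
    proof eventually_elim
      case (elim u)
      then have "\<bar>quantile H u - quantile H t - (u - t) / h (quantile H t)\<bar> \<le> \<bar>u - t\<bar>"
        using \<delta>(2)[OF t, of u] pq by (auto simp: dist_real_def)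
      moreover have "\<bar>(u - t) / h (quantile H t)\<bar> = \<bar>u - t\<bar> / \<bar>h (quantile H t)\<bar>" by simp
      ultimately show ?case unfolding real_norm_def by linarith
    qed
    from Lim_null_comparison[OF this lim] show ?thesis by (simp add: LIM_zero_iff)
  qed
  then show ?thesis by (simp add: continuous_on_def)
qed

section \<open>Oscillation of the centred Dirichlet process\<close>

lemma dyadic_increments:
  fixes V :: "real \<Rightarrow> real"
  assumes c: "\<And>k. k < 2 ^ m \<Longrightarrow> \<bar>V (real (Suc k) / 2 ^ m) - V (real k / 2 ^ m)\<bar> \<le> c"
    and ij: "i \<le> j" "j \<le> 2 ^ m"
  shows "\<bar>V (real j / 2 ^ m) - V (real i / 2 ^ m)\<bar> \<le> real (j - i) * c"
  using ij
proof (induction j rule: dec_induct)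
  case (step n)
  have "\<bar>V (real (Suc n) / 2 ^ m) - V (real n / 2 ^ m)\<bar> \<le> c" using step by (intro c) auto
  then have "\<bar>V (real (Suc n) / 2 ^ m) - V (real i / 2 ^ m)\<bar> \<le> c + real (n - i) * c" using step by linarith
  also have "\<dots> = real (Suc n - i) * c" using step by (simp add: Suc_diff_le algebra_simps)
  finally show ?case .
qed simp

text \<open>Halving \<open>k\<close> moves to the next coarser level: for even \<open>k\<close> the
  point stays the same, for odd \<open>k\<close> it moves to the left neighbour on the finer grid.
  So each level above \<open>m\<close> costs one increment.\<close>

lemma dyadic_chaining:
  fixes V :: "real \<Rightarrow> real"
  assumes c: "\<And>l k. m \<le> l \<Longrightarrow> l \<le> L \<Longrightarrow> k < 2 ^ l \<Longrightarrow> \<bar>V (real (Suc k) / 2 ^ l) - V (real k / 2 ^ l)\<bar> \<le> c l"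
    and c0: "\<And>l. 0 \<le> c l" and l: "m \<le> l" "l \<le> L" and k: "k \<le> 2 ^ l"
  shows "\<bar>V (real k / 2 ^ l) - V (real (k div 2 ^ (l - m)) / 2 ^ m)\<bar> \<le> (\<Sum>i=Suc m..l. c i)"
  using l k
proof (induction l arbitrary: k rule: dec_induct)
  case (step l)
  have k2: "k div 2 \<le> 2 ^ l" using step.prems by simp
  have dd: "k div 2 div 2 ^ (l - m) = k div 2 ^ (Suc l - m)"
    using step.hyps by (simp add: div_mult2_eq[symmetric] Suc_diff_le)
  have IH: "\<bar>V (real (k div 2) / 2 ^ l) - V (real (k div 2 ^ (Suc l - m)) / 2 ^ m)\<bar> \<le> (\<Sum>i=Suc m..l. c i)"
    using step.IH[OF _ k2] step.prems step.hyps dd by simp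
  have "\<bar>V (real k / 2 ^ Suc l) - V (real (k div 2) / 2 ^ l)\<bar> \<le> c (Suc l)"
  proof (cases "even k")
    case True
    then have "real k / 2 ^ Suc l = real (k div 2) / 2 ^ l" by (auto elim!: evenE)
    then show ?thesis using c0 by simp
  next
    case False
    then obtain b where b: "k = Suc (2 * b)" by (auto elim!: oddE)
    then have "\<bar>V (real (Suc (2 * b)) / 2 ^ Suc l) - V (real (2 * b) / 2 ^ Suc l)\<bar> \<le> c (Suc l)"
      using step.prems step.hyps by (intro c) auto
    moreover have "real (2 * b) / 2 ^ Suc l = real (k div 2) / 2 ^ l" using b by simp
    ultimately show ?thesis using b by simp
  qed
  moreover have "(\<Sum>i=Suc m..Suc l. c i) = (\<Sum>i=Suc m..l. c i) + c (Suc l)"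
    using step.hyps by simp
  ultimately show ?case using IH by linarith
qed simp

lemma geometric_sum_le:
  fixes r :: real
  assumes "0 \<le> r" "r < 1"
  shows "(\<Sum>l=m..L. r ^ (l - m)) \<le> 1 / (1 - r)"
proof (cases "m \<le> L")
  case True
  have "(\<Sum>l=m..L. r ^ (l - m)) = (\<Sum>j\<in>{..L - m}. r ^ j)"
    using True by (intro sum.reindex_bij_witness[of _ "\<lambda>j. j + m" "\<lambda>l. l - m"]) auto
  also have "\<dots> \<le> (\<Sum>j. r ^ j)" using assms by (intro sum_le_suminf) (auto intro: summable_geometric)
  also have "\<dots> = 1 / (1 - r)" using assms by (intro suminf_geometric) auto
  finally show ?thesis .
qed (use assms in auto)

section \<open>Dirichlet masses on intervals between quantiles\<close>

locale dirichlet_family =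
  fixes H :: "real measure" and M :: "real \<Rightarrow> 'w measure" and P :: "real \<Rightarrow> 'w \<Rightarrow> real measure"
  assumes H: "real_distribution H" and H_cont: "continuous_on UNIV (cdf H)"
    and DP: "\<And>a. a > 0 \<Longrightarrow> dirichlet_process (M a) a H (P a)"
begin

sublocale H: real_distribution H by (rule H)

text \<open>The half-line of \<open>H\<close>-mass \<open>u\<close>. The ends are set by hand,
  because \<open>quantile\<close> at 0 is an infimum over the whole line and at 1 possibly over the
  empty set.\<close>

definition lower_set :: "real \<Rightarrow> real set" where
  "lower_set u = (if u \<le> 0 then {} else if 1 \<le> u then UNIV else {..quantile H u})"

definition mass :: "real \<Rightarrow> 'w \<Rightarrow> real \<Rightarrow> real" where
  "mass a \<omega> u = measure (P a \<omega>) (lower_set u)"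

text \<open>The process \<open>G\<close>. Measuring time in \<open>H\<close>-mass reduces everything
  to a uniform base measure.\<close>

definition fluct :: "real \<Rightarrow> 'w \<Rightarrow> real \<Rightarrow> real" where
  "fluct a \<omega> u = sqrt a * (mass a \<omega> u - u)"

lemma lower_set_borel [simp]: "lower_set u \<in> sets borel"
  by (auto simp: lower_set_def)

lemma lower_set_mono: "u \<le> v \<Longrightarrow> lower_set u \<subseteq> lower_set v"
  using H.quantile_mono[of u v] by (auto simp: lower_set_def)

lemma measure_lower_set: "0 \<le> u \<Longrightarrow> u \<le> 1 \<Longrightarrow> measure H (lower_set u) = u"
  using H.cdf_quantile[OF H_cont, of u] H.prob_space by (auto simp: lower_set_def cdf_def)

context
  fixes a :: real assumes a: "a > 0"
begin

lemma prob_M: "prob_space (M a)"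
  using DP[OF a] by (simp add: dirichlet_process_def)

lemma P_measurable: "P a \<in> measurable (M a) (prob_algebra H)"
  using DP[OF a] by (simp add: dirichlet_process_def)

lemma real_distribution_P:
  assumes "\<omega> \<in> space (M a)" shows "real_distribution (P a \<omega>)"
proof -
  have "P a \<omega> \<in> space (prob_algebra H)" using measurable_space[OF P_measurable assms] .
  then have "prob_space (P a \<omega>)" "sets (P a \<omega>) = sets borel" by (auto simp: space_prob_algebra)
  then show ?thesis using sets_eq_imp_space_eq[of "P a \<omega>" borel]
    by (auto simp: real_distribution_def real_distribution_axioms_def)
qed

lemma measurable_measure_P [measurable]:
  assumes "A \<in> sets borel" shows "(\<lambda>\<omega>. measure (P a \<omega>) A) \<in> borel_measurable (M a)"
proof -
  have "P a \<in> measurable (M a) (subprob_algebra H)" by (rule measurable_prob_algebraD[OF P_measurable])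
  moreover have "(\<lambda>Q. measure Q A) \<in> borel_measurable (subprob_algebra H)"
    using assms by (intro measurable_measure_subprob_algebra) simp
  ultimately show ?thesis by (rule measurable_compose)
qed

lemma measurable_mass [measurable]: "(\<lambda>\<omega>. mass a \<omega> u) \<in> borel_measurable (M a)"
  unfolding mass_def by (rule measurable_measure_P) simp

lemma measurable_fluct [measurable]: "(\<lambda>\<omega>. fluct a \<omega> u) \<in> borel_measurable (M a)"
  unfolding fluct_def by measurable

lemma mass_bounds: "\<omega> \<in> space (M a) \<Longrightarrow> 0 \<le> mass a \<omega> u \<and> mass a \<omega> u \<le> 1"
  using prob_space.prob_le_1[OF real_distribution.axioms(1)[OF real_distribution_P]] by (auto simp: mass_def)

lemma mass_0: "mass a \<omega> 0 = 0" by (simp add: mass_def lower_set_def)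

lemma mass_1: "\<omega> \<in> space (M a) \<Longrightarrow> mass a \<omega> 1 = 1"
proof -
  assume "\<omega> \<in> space (M a)"
  then interpret real_distribution "P a \<omega>" by (rule real_distribution_P)
  show ?thesis using prob_space by (simp add: mass_def lower_set_def)
qed

lemma mass_diff:
  assumes "\<omega> \<in> space (M a)" "u \<le> v"
  shows "measure (P a \<omega>) (lower_set v - lower_set u) = mass a \<omega> v - mass a \<omega> u"
proof -
  interpret real_distribution "P a \<omega>" by (rule real_distribution_P[OF assms(1)])
  show ?thesis unfolding mass_def using lower_set_mono[OF assms(2)] by (intro finite_measure_Diff) auto
qed

lemma fluct_0: "fluct a \<omega> 0 = 0" by (simp add: fluct_def mass_0)

lemma fluct_1: "\<omega> \<in> space (M a) \<Longrightarrow> fluct a \<omega> 1 = 0" by (simp add: fluct_def mass_1)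

lemma fluct_bound: "\<omega> \<in> space (M a) \<Longrightarrow> 0 \<le> u \<Longrightarrow> u \<le> 1 \<Longrightarrow> \<bar>fluct a \<omega> u\<bar> \<le> sqrt a"
proof -
  assume "\<omega> \<in> space (M a)" "0 \<le> u" "u \<le> 1"
  then have "\<bar>mass a \<omega> u - u\<bar> \<le> 1" using mass_bounds[of \<omega> u] by auto
  then have "sqrt a * \<bar>mass a \<omega> u - u\<bar> \<le> sqrt a * 1" using a by (intro mult_left_mono) auto
  then show ?thesis using a by (simp add: fluct_def abs_mult)
qed

lemma cells_dirichlet:
  assumes A: "\<And>i. i < n \<Longrightarrow> A i \<in> sets borel" "\<And>i. i < n \<Longrightarrow> measure H (A i) > 0"
    and disj: "disjoint_family_on A {..<n}" and un: "(\<Union>i<n. A i) = UNIV"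
  shows "distr (M a) (\<Pi>\<^sub>M i\<in>{..<n}. borel) (\<lambda>\<omega>. \<lambda>i\<in>{..<n}. measure (P a \<omega>) (A i))
    = dirichlet_distribution {..<n} (\<lambda>i. a * measure H (A i))"
proof -
  have J: "{i. i < n \<and> measure H (A i) \<noteq> 0} = {..<n}" using A(2) by force
  have "(\<forall>i<n. A i \<in> sets H) \<and> disjoint_family_on A {..<n} \<and> (\<Union>i<n. A i) = space H"
    using A disj un by simp
  moreover have "\<forall>(k::nat) A. (\<forall>i<k. A i \<in> sets H) \<and> disjoint_family_on A {..<k} \<and>
                   (\<Union>i<k. A i) = space H \<longrightarrow>
        (let J = {i. i < k \<and> measure H (A i) \<noteq> 0} in
           (\<forall>i\<in>{..<k} - J. AE \<omega> in M a. measure (P a \<omega>) (A i) = 0) \<and>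
           distr (M a) (\<Pi>\<^sub>M i\<in>J. borel) (\<lambda>\<omega>. \<lambda>i\<in>J. measure (P a \<omega>) (A i)) =
             dirichlet_distribution J (\<lambda>i. a * measure H (A i)))"
    using DP[OF a] unfolding dirichlet_process_def by blast
  ultimately have "let J = {i. i < n \<and> measure H (A i) \<noteq> 0} in
           (\<forall>i\<in>{..<n} - J. AE \<omega> in M a. measure (P a \<omega>) (A i) = 0) \<and>
           distr (M a) (\<Pi>\<^sub>M i\<in>J. borel) (\<lambda>\<omega>. \<lambda>i\<in>J. measure (P a \<omega>) (A i)) =
             dirichlet_distribution J (\<lambda>i. a * measure H (A i))" by blast
  then show ?thesis unfolding J Let_def by blast
qed

text \<open>Successive differences of nested half-lines form a partition, and their masses are the
  increments of \<open>mass\<close>.\<close>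

lemma mass_increments_dirichlet:
  assumes u: "u 0 = 0" "u n = 1" "\<And>i. i < n \<Longrightarrow> u i < u (Suc i)"
  shows "distr (M a) (\<Pi>\<^sub>M i\<in>{..<n}. borel) (\<lambda>\<omega>. \<lambda>i\<in>{..<n}. mass a \<omega> (u (Suc i)) - mass a \<omega> (u i))
    = dirichlet_distribution {..<n} (\<lambda>i. a * (u (Suc i) - u i))"
proof -
  define A where "A i = lower_set (u (Suc i)) - lower_set (u i)" for i
  have mono: "u i \<le> u j" if "i \<le> j" "j \<le> n" for i j
    using that
  proof (induction j rule: dec_induct)
    case (step k)
    then show ?case using u(3)[of k] by auto
  qed simp
  have range: "0 \<le> u i" "u i \<le> 1" if "i \<le> n" for i
    using mono[of 0 i] mono[of i n] u that by auto
  have mA: "measure H (A i) = u (Suc i) - u i" if "i < n" for i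
    unfolding A_def using that range[of i] range[of "Suc i"] u(3)[OF that] lower_set_mono[of "u i" "u (Suc i)"]
    by (subst H.finite_measure_Diff) (auto simp: measure_lower_set)
  have disj: "disjoint_family_on A {..<n}"
    unfolding disjoint_family_on_def
  proof (intro ballI impI)
    have *: "A i \<inter> A j = {}" if "i < j" "j < n" for i j
      using lower_set_mono[OF mono[of "Suc i" j]] that by (auto simp: A_def)
    fix i j assume "i \<in> {..<n}" "j \<in> {..<n}" "i \<noteq> j"
    then show "A i \<inter> A j = {}" using *[of i j] *[of j i] by (cases i j rule: linorder_cases) auto
  qed
  have "(\<Union>i<k. A i) = lower_set (u k)" if "k \<le> n" for k
    using that
  proof (induction k)
    case 0
    then show ?case by (simp add: u lower_set_def)
  next
    case (Suc k)
    then have "(\<Union>i<Suc k. A i) = A k \<union> lower_set (u k)" by (simp add: lessThan_Suc)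
    also have "\<dots> = lower_set (u (Suc k))"
      unfolding A_def using lower_set_mono[of "u k" "u (Suc k)"] u(3)[of k] Suc by auto
    finally show ?case .
  qed
  from this[of n] have un: "(\<Union>i<n. A i) = UNIV" by (simp add: u lower_set_def)
  have "distr (M a) (\<Pi>\<^sub>M i\<in>{..<n}. borel) (\<lambda>\<omega>. \<lambda>i\<in>{..<n}. measure (P a \<omega>) (A i))
    = dirichlet_distribution {..<n} (\<lambda>i. a * measure H (A i))"
  proof (rule cells_dirichlet[OF _ _ disj un])
    show "i < n \<Longrightarrow> A i \<in> sets borel" for i
      unfolding A_def by (intro sets.Diff lower_set_borel)
    show "i < n \<Longrightarrow> 0 < measure H (A i)" for i using mA u(3) by simp
  qed
  moreover have "distr (M a) (\<Pi>\<^sub>M i\<in>{..<n}. borel) (\<lambda>\<omega>. \<lambda>i\<in>{..<n}. measure (P a \<omega>) (A i))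
    = distr (M a) (\<Pi>\<^sub>M i\<in>{..<n}. borel) (\<lambda>\<omega>. \<lambda>i\<in>{..<n}. mass a \<omega> (u (Suc i)) - mass a \<omega> (u i))"
    by (intro distr_cong refl restrict_ext) (use mass_diff u(3) in \<open>auto simp: A_def less_imp_le\<close>)
  moreover have "dirichlet_distribution {..<n} (\<lambda>i. a * measure H (A i))
    = dirichlet_distribution {..<n} (\<lambda>i. a * (u (Suc i) - u i))"
    unfolding dirichlet_distribution_def by (simp add: mA cong: if_cong)
  ultimately show ?thesis by simp
qed

end

text \<open>
  Since \<open>H\<close> has no atoms, every parameter vector arises from some \<open>a\<close> and some partition. So the
  assumed processes already show that the Dirichlet densities are normalised.
\<close>

lemma prob_space_dirichlet:
  assumes n: "n > 0" and \<beta>: "\<And>i. i < n \<Longrightarrow> \<beta> i > 0"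
  shows "prob_space (dirichlet_distribution {..<n} \<beta>)"
proof -
  define a where "a = (\<Sum>i<n. \<beta> i)"
  have a: "a > 0" unfolding a_def using n \<beta> by (intro sum_pos) auto
  \<comment> \<open>Normalised partial sums: at concentration \<open>a\<close> the cell parameters
    are \<open>\<beta>\<close> again.\<close>
  define u where "u k = (\<Sum>i<k. \<beta> i) / a" for k
  have d: "u (Suc i) - u i = \<beta> i / a" for i by (simp add: u_def add_divide_distrib)
  have lt: "u i < u (Suc i)" if "i < n" for i
  proof -
    have "0 < \<beta> i / a" using \<beta>[OF that] a by simp
    then show ?thesis using d[of i] by linarith
  qed
  have "prob_space (distr (M a) (\<Pi>\<^sub>M i\<in>{..<n}. borel)
      (\<lambda>\<omega>. \<lambda>i\<in>{..<n}. mass a \<omega> (u (Suc i)) - mass a \<omega> (u i)))"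
    using measurable_mass[OF a] by (intro prob_space.prob_space_distr[OF prob_M[OF a]] measurable_restrict) auto
  also have "distr (M a) (\<Pi>\<^sub>M i\<in>{..<n}. borel)
      (\<lambda>\<omega>. \<lambda>i\<in>{..<n}. mass a \<omega> (u (Suc i)) - mass a \<omega> (u i))
    = dirichlet_distribution {..<n} (\<lambda>i. a * (u (Suc i) - u i))"
    using a lt by (intro mass_increments_dirichlet) (auto simp: u_def a_def)
  also have "(\<lambda>i. a * (u (Suc i) - u i)) = \<beta>" using a by (simp add: d)
  finally show ?thesis .
qed

lemma fluct_fourth_moment:
  assumes a: "a > 0" and st: "0 \<le> s" "s \<le> t" "t \<le> 1"
  shows "integrable (M a) (\<lambda>\<omega>. (fluct a \<omega> t - fluct a \<omega> s) ^ 4)"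
    "(\<integral>\<omega>. (fluct a \<omega> t - fluct a \<omega> s) ^ 4 \<partial>M a) \<le> 3 * (t - s)\<^sup>2 + 6 * (t - s) / a"
proof -
  interpret prob_space "M a" by (rule prob_M[OF a])
  note [measurable] = measurable_fluct[OF a] measurable_measure_P[OF a]
  show "integrable (M a) (\<lambda>\<omega>. (fluct a \<omega> t - fluct a \<omega> s) ^ 4)"
  proof (rule integrable_const_bound[of _ "(2 * sqrt a) ^ 4"])
    show "AE \<omega> in M a. norm ((fluct a \<omega> t - fluct a \<omega> s) ^ 4) \<le> (2 * sqrt a) ^ 4"
    proof (rule AE_I2)
      fix \<omega> assume "\<omega> \<in> space (M a)"
      then have "\<bar>fluct a \<omega> t - fluct a \<omega> s\<bar> \<le> 2 * sqrt a"
        using fluct_bound[OF a, of \<omega> t] fluct_bound[OF a, of \<omega> s] st by linarith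
      then show "norm ((fluct a \<omega> t - fluct a \<omega> s) ^ 4) \<le> (2 * sqrt a) ^ 4"
        unfolding real_norm_def power_abs by (rule power_mono) simp
    qed
  qed measurable
  define x where "x = t - s"
  \<comment> \<open>For \<open>x = 0\<close> or \<open>x = 1\<close> one of the two cells would have
    parameter 0, so these cases are computed directly.\<close>
  consider "x = 0" | "x = 1" | "0 < x" "x < 1" using st by (auto simp: x_def) linarith
  then show "(\<integral>\<omega>. (fluct a \<omega> t - fluct a \<omega> s) ^ 4 \<partial>M a) \<le> 3 * (t - s)\<^sup>2 + 6 * (t - s) / a"
  proof cases
    case 1
    then show ?thesis by (simp add: x_def)
  next
    case 2
    then have "s = 0" "t = 1" using st by (auto simp: x_def)
    then have "(\<integral>\<omega>. (fluct a \<omega> t - fluct a \<omega> s) ^ 4 \<partial>M a) = (\<integral>\<omega>. 0 \<partial>M a)"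
      by (intro Bochner_Integration.integral_cong refl) (simp add: fluct_0[OF a] fluct_1[OF a])
    then show ?thesis using st a by simp
  next
    case 3
    define B where "B = lower_set t - lower_set s"
    define A where "A i = (if i = 0 then B else - B)" for i :: nat
    have B: "B \<in> sets borel" unfolding B_def by (intro sets.Diff lower_set_borel)
    have HB: "measure H B = x"
      unfolding B_def x_def using st lower_set_mono[of s t]
      by (subst H.finite_measure_Diff) (auto simp: measure_lower_set)
    have HA: "measure H (A i) = (if i = 0 then x else 1 - x)" for i
      using H.prob_compl[of B] B HB by (auto simp: A_def Compl_eq_Diff_UNIV)
    have two: "{..<2} = {0, 1 :: nat}" by auto
    have D: "distr (M a) (\<Pi>\<^sub>M i\<in>{0, 1}. borel) (\<lambda>\<omega>. \<lambda>i\<in>{0, 1}. measure (P a \<omega>) (A i))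
      = dirichlet_distribution {0, 1} (\<lambda>i. a * (if i = 0 then x else 1 - x))"
      using cells_dirichlet[OF a, of 2 A] 3 B unfolding HA two
      by (auto simp: A_def disjoint_family_on_def)
    have mD: "(\<lambda>\<omega>. \<lambda>i\<in>{0, 1}. measure (P a \<omega>) (A i)) \<in> measurable (M a) (\<Pi>\<^sub>M i\<in>{0, 1}. borel)"
      using B by (intro measurable_restrict measurable_measure_P[OF a]) (auto simp: A_def)
    have eq: "(fluct a \<omega> t - fluct a \<omega> s) ^ 4
        = a\<^sup>2 * ((1 - x) * measure (P a \<omega>) (A 0) - x * measure (P a \<omega>) (A 1)) ^ 4"
      if \<omega>: "\<omega> \<in> space (M a)" for \<omega>
    proof -
      interpret R: real_distribution "P a \<omega>" by (rule real_distribution_P[OF a \<omega>])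
      have "measure (P a \<omega>) (A 1) = 1 - measure (P a \<omega>) (A 0)"
        using R.prob_compl[of B] B by (simp add: A_def Compl_eq_Diff_UNIV)
      then have "(1 - x) * measure (P a \<omega>) (A 0) - x * measure (P a \<omega>) (A 1) = measure (P a \<omega>) (A 0) - x"
        by (simp only:) (simp add: algebra_simps)
      moreover have "A 0 = B" by (simp add: A_def)
      moreover have "fluct a \<omega> t - fluct a \<omega> s = sqrt a * (measure (P a \<omega>) B - x)"
        unfolding B_def mass_diff[OF a \<omega> st(2)] x_def fluct_def by (simp add: algebra_simps)
      moreover have "sqrt a ^ 4 = a\<^sup>2"
      proof -
        have "sqrt a ^ 4 = (sqrt a ^ 2) ^ 2" by (simp flip: power_mult)
        then show ?thesis using a by simp
      qed
      ultimately show ?thesis by (simp add: power_mult_distrib)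
    qed
    have "(\<integral>\<omega>. (fluct a \<omega> t - fluct a \<omega> s) ^ 4 \<partial>M a)
        = a\<^sup>2 * (\<integral>\<omega>. ((1 - x) * measure (P a \<omega>) (A 0) - x * measure (P a \<omega>) (A 1)) ^ 4 \<partial>M a)"
      unfolding integral_mult_right_zero[symmetric] by (intro Bochner_Integration.integral_cong refl eq)
    also have "(\<integral>\<omega>. ((1 - x) * measure (P a \<omega>) (A 0) - x * measure (P a \<omega>) (A 1)) ^ 4 \<partial>M a)
        = (\<integral>y. ((1 - x) * y 0 - x * y 1) ^ 4 \<partial>dirichlet_distribution {0, 1} (\<lambda>i. a * (if i = 0 then x else 1 - x)))"
      unfolding D[symmetric] by (subst integral_distr[OF mD]) auto
    also have "a\<^sup>2 * \<dots> \<le> a\<^sup>2 * (3 * x\<^sup>2 / a\<^sup>2 + 6 * x / a ^ 3)"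
    proof (intro mult_left_mono dirichlet_centred_fourth_moment)
      fix \<beta> :: "nat \<Rightarrow> real" assume "\<And>i. i \<in> {0, 1} \<Longrightarrow> 0 < \<beta> i"
      then show "prob_space (dirichlet_distribution {0, 1} \<beta>)"
        unfolding two[symmetric] by (intro prob_space_dirichlet) auto
    qed (use 3 a in auto)
    also have "\<dots> = 3 * x\<^sup>2 + 6 * x / a" using a by (simp add: field_simps eval_nat_numeral)
    finally show ?thesis by (simp add: x_def)
  qed
qed

text \<open>From \<open>y^2 \<le> 1 + y^4\<close> and the fourth moment. For
  \<open>a \<ge> 1\<close> the bound \<open>1 + 3 + 6\<close> does not depend on \<open>a\<close>,
  as the limit theorem for vectors requires.\<close>

lemma fluct_second_moment:
  assumes a: "a \<ge> 1" and u: "0 \<le> u" "u \<le> 1"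
  shows "integrable (M a) (\<lambda>\<omega>. (fluct a \<omega> u)\<^sup>2)" "(\<integral>\<omega>. (fluct a \<omega> u)\<^sup>2 \<partial>M a) \<le> 10"
proof -
  have a0: "a > 0" using a by simp
  interpret prob_space "M a" by (rule prob_M[OF a0])
  note [measurable] = measurable_fluct[OF a0]
  have 4: "integrable (M a) (\<lambda>\<omega>. fluct a \<omega> u ^ 4)" "(\<integral>\<omega>. fluct a \<omega> u ^ 4 \<partial>M a) \<le> 3 * u\<^sup>2 + 6 * u / a"
    using fluct_fourth_moment[OF a0 order_refl u] by (simp_all add: fluct_0[OF a0])
  have le: "y\<^sup>2 \<le> 1 + y ^ 4" for y :: real
  proof -
    have "0 \<le> (y\<^sup>2 - 1)\<^sup>2 + y\<^sup>2" by simp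
    then show ?thesis by (simp add: power2_diff flip: power_mult)
  qed
  show i2: "integrable (M a) (\<lambda>\<omega>. (fluct a \<omega> u)\<^sup>2)"
  proof (rule Bochner_Integration.integrable_bound)
    show "integrable (M a) (\<lambda>\<omega>. 1 + fluct a \<omega> u ^ 4)" using 4 by auto
    show "AE \<omega> in M a. norm ((fluct a \<omega> u)\<^sup>2) \<le> norm (1 + fluct a \<omega> u ^ 4)"
      using le by (intro AE_I2) (auto intro: order_trans[OF _ abs_ge_self])
  qed measurable
  have "(\<integral>\<omega>. (fluct a \<omega> u)\<^sup>2 \<partial>M a) \<le> (\<integral>\<omega>. 1 + fluct a \<omega> u ^ 4 \<partial>M a)"
    using 4 i2 le by (intro integral_mono) auto
  also have "\<dots> = 1 + (\<integral>\<omega>. fluct a \<omega> u ^ 4 \<partial>M a)" using 4 by (simp add: prob_space)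
  also have "\<dots> \<le> 1 + (3 * 1 + 6)"
  proof -
    have "u\<^sup>2 \<le> 1" using u by (simp add: power_le_one)
    moreover have "6 * u / a \<le> 6 * 1 / 1" using u a by (intro frac_le) auto
    ultimately show ?thesis using 4(2) by linarith
  qed
  finally show "(\<integral>\<omega>. (fluct a \<omega> u)\<^sup>2 \<partial>M a) \<le> 10" by simp
qed

text \<open>The thresholds of all levels add up to at most \<open>\<eta>\<close>, because
  \<open>1 / 10 = 1 - 9 / 10\<close>.\<close>

definition bad_event :: "real \<Rightarrow> nat \<Rightarrow> nat \<Rightarrow> real \<Rightarrow> 'w set" where
  "bad_event a m L \<eta> = {\<omega> \<in> space (M a). \<exists>l\<in>{m..L}. \<exists>k\<in>{..<2 ^ l}.
     \<eta> / 10 * (9 / 10) ^ (l - m) < \<bar>fluct a \<omega> (real (Suc k) / 2 ^ l) - fluct a \<omega> (real k / 2 ^ l)\<bar>}"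

text \<open>
  At level \<open>l\<close> there are \<open>2 ^ l\<close> increments with fourth moment of order \<open>4 ^ -l\<close>. Since
  \<open>2 * (9 / 10) ^ 4 > 1\<close>, the thresholds decay slowly enough for the union bound to be summable.
\<close>

lemma bad_event_prob:
  assumes a: "a > 0" and L: "2 ^ L \<le> 2 * a" and \<eta>: "\<eta> > 0"
  shows "bad_event a m L \<eta> \<in> sets (M a)" "measure (M a) (bad_event a m L \<eta>) \<le> 750000 / (2 ^ m * \<eta> ^ 4)"
proof -
  interpret prob_space "M a" by (rule prob_M[OF a])
  note [measurable] = measurable_fluct[OF a]
  define E where "E l k = {\<omega> \<in> space (M a).
     \<eta> / 10 * (9 / 10) ^ (l - m) < \<bar>fluct a \<omega> (real (Suc k) / 2 ^ l) - fluct a \<omega> (real k / 2 ^ l)\<bar>}" for l k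
  have E [measurable]: "E l k \<in> sets (M a)" for l k unfolding E_def by measurable
  have bad: "bad_event a m L \<eta> = (\<Union>l\<in>{m..L}. \<Union>k\<in>{..<2 ^ l}. E l k)"
    by (auto simp: bad_event_def E_def)
  show "bad_event a m L \<eta> \<in> sets (M a)" unfolding bad by (intro sets.finite_UN) auto
  have PE: "measure (M a) (E l k) \<le> 150000 / \<eta> ^ 4 * (10000 / 6561) ^ (l - m) / 4 ^ l"
    if l: "l \<in> {m..L}" and k: "k < 2 ^ l" for l k
  proof -
    define c where "c = \<eta> / 10 * (9 / 10) ^ (l - m)"
    have c: "c > 0" using \<eta> by (simp add: c_def)
    define X where "X \<omega> = fluct a \<omega> (real (Suc k) / 2 ^ l) - fluct a \<omega> (real k / 2 ^ l)" for \<omega>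
    have range: "0 \<le> real k / 2 ^ l" "real k / 2 ^ l \<le> real (Suc k) / 2 ^ l" "real (Suc k) / 2 ^ l \<le> 1"
    proof -
      have "real (Suc k) \<le> real (2 ^ l)" using k by (intro of_nat_mono) simp
      then show "real (Suc k) / 2 ^ l \<le> 1" by (simp add: divide_le_eq)
      show "real k / 2 ^ l \<le> real (Suc k) / 2 ^ l" by (intro divide_right_mono) auto
    qed simp
    have d: "real (Suc k) / 2 ^ l - real k / 2 ^ l = 1 / 2 ^ l" by (simp add: diff_divide_distrib[symmetric])
    have iX: "integrable (M a) (\<lambda>\<omega>. X \<omega> ^ 4)" and eX: "(\<integral>\<omega>. X \<omega> ^ 4 \<partial>M a) \<le> 3 * (1 / 2 ^ l)\<^sup>2 + 6 * (1 / 2 ^ l) / a"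
      using fluct_fourth_moment[OF a range] unfolding d X_def by auto
    \<comment> \<open>Here the level is limited by \<open>a\<close>: the linear term
      \<open>6 x / a\<close> is at most \<open>12 x^2\<close> for \<open>x = 1 / 2 ^ l\<close>,
      which gives the constant \<open>15 = 3 + 12\<close>.\<close>
    have "(2::real) ^ l \<le> 2 ^ L" using l by (intro power_increasing) auto
    then have "2 ^ l \<le> 2 * a" using L by (rule order_trans)
    then have "1 / a \<le> 2 / 2 ^ l" using a by (simp add: field_simps)
    then have "6 * (1 / 2 ^ l) * (1 / a) \<le> 6 * (1 / 2 ^ l) * (2 / 2 ^ l)" by (intro mult_left_mono) auto
    moreover have "(1 / 2 ^ l)\<^sup>2 = 1 / (4::real) ^ l" "1 / 2 ^ l * (1 / 2 ^ l) = 1 / (4::real) ^ l"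
      by (simp_all add: power2_eq_square power_mult_distrib[symmetric])
    ultimately have eX': "(\<integral>\<omega>. X \<omega> ^ 4 \<partial>M a) \<le> 15 / 4 ^ l" using eX by simp
    have "E l k \<subseteq> {\<omega> \<in> space (M a). c ^ 4 \<le> X \<omega> ^ 4}"
    proof
      fix \<omega> assume "\<omega> \<in> E l k"
      then have \<omega>: "\<omega> \<in> space (M a)" "c < \<bar>X \<omega>\<bar>" by (auto simp: E_def X_def c_def)
      then have "c ^ 4 \<le> \<bar>X \<omega>\<bar> ^ 4" using c by (intro power_mono) auto
      then show "\<omega> \<in> {\<omega> \<in> space (M a). c ^ 4 \<le> X \<omega> ^ 4}" using \<omega> by simp
    qed
    then have "measure (M a) (E l k) \<le> measure (M a) {\<omega> \<in> space (M a). c ^ 4 \<le> X \<omega> ^ 4}"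
      unfolding X_def by (intro finite_measure_mono) measurable
    also have "\<dots> \<le> (\<integral>\<omega>. X \<omega> ^ 4 \<partial>M a) / c ^ 4"
      using c iX by (intro integral_Markov_inequality_measure[where A = "{}"]) auto
    also have "\<dots> \<le> 15 / 4 ^ l / c ^ 4" using eX' c by (intro divide_right_mono) auto
    also have "c ^ 4 = \<eta> ^ 4 / 10000 * (6561 / 10000) ^ (l - m)"
    proof -
      have "((9 / 10 :: real) ^ (l - m)) ^ 4 = ((9 / 10) ^ 4) ^ (l - m)" by (simp flip: power_mult add: mult.commute)
      moreover have "(9 / 10 :: real) ^ 4 = 6561 / 10000" by (simp add: power_divide)
      ultimately have "((9 / 10 :: real) ^ (l - m)) ^ 4 = (6561 / 10000) ^ (l - m)" by (simp only:)
      then show ?thesis unfolding c_def power_mult_distrib by (simp add: power_divide[of \<eta>])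
    qed
    also have "15 / 4 ^ l / (\<eta> ^ 4 / 10000 * (6561 / 10000) ^ (l - m))
        = 150000 / \<eta> ^ 4 * (10000 / 6561) ^ (l - m) / 4 ^ l"
      by (simp add: power_divide)
    finally show ?thesis .
  qed
  have "measure (M a) (bad_event a m L \<eta>) \<le> (\<Sum>l\<in>{m..L}. measure (M a) (\<Union>k\<in>{..<2 ^ l}. E l k))"
    unfolding bad by (intro finite_measure_subadditive_finite) auto
  also have "\<dots> \<le> (\<Sum>l\<in>{m..L}. \<Sum>k\<in>{..<2 ^ l}. measure (M a) (E l k))"
    by (intro sum_mono finite_measure_subadditive_finite) auto
  also have "\<dots> \<le> (\<Sum>l\<in>{m..L}. \<Sum>k\<in>{..<2 ^ l :: nat}. 150000 / \<eta> ^ 4 * (10000 / 6561) ^ (l - m) / 4 ^ l)"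
    by (intro sum_mono PE) auto
  \<comment> \<open>Summing \<open>2 ^ l\<close> terms of size \<open>1 / 4 ^ l\<close> halves the
    ratio \<open>10000 / 6561\<close> to \<open>5000 / 6561 < 1\<close>.\<close>
  also have "\<dots> = (\<Sum>l\<in>{m..L}. 150000 / (2 ^ m * \<eta> ^ 4) * (5000 / 6561) ^ (l - m))"
  proof (intro sum.cong refl)
    fix l assume "l \<in> {m..L}"
    then obtain j where j: "l = m + j" by (metis atLeastAtMost_iff le_Suc_ex)
    have "(4::real) ^ l = 2 ^ l * 2 ^ l" by (simp flip: power_mult_distrib)
    moreover have "(10000 / 6561 :: real) ^ j = (5000 / 6561) ^ j * 2 ^ j" by (simp flip: power_mult_distrib)
    ultimately show "(\<Sum>k\<in>{..<2 ^ l :: nat}. 150000 / \<eta> ^ 4 * (10000 / 6561) ^ (l - m) / 4 ^ l)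
        = 150000 / (2 ^ m * \<eta> ^ 4) * (5000 / 6561) ^ (l - m)"
      by (simp add: j power_add)
  qed
  also have "\<dots> = 150000 / (2 ^ m * \<eta> ^ 4) * (\<Sum>l=m..L. (5000 / 6561) ^ (l - m))"
    by (simp only: sum_distrib_left)
  also have "\<dots> \<le> 150000 / (2 ^ m * \<eta> ^ 4) * (1 / (1 - 5000 / 6561))"
    using \<eta> by (intro mult_left_mono geometric_sum_le) auto
  \<comment> \<open>The geometric series is \<open>6561 / 1561 < 5\<close>.\<close>
  also have "\<dots> \<le> 150000 / (2 ^ m * \<eta> ^ 4) * 5"
    using \<eta> by (intro mult_left_mono) auto
  finally show "measure (M a) (bad_event a m L \<eta>) \<le> 750000 / (2 ^ m * \<eta> ^ 4)" by simp
qed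

lemma fluct_oscillation:
  assumes a: "a > 0" and \<omega>: "\<omega> \<in> space (M a) - bad_event a m L \<eta>" and \<eta>: "\<eta> > 0"
    and mL: "m \<le> L" and k: "k \<le> 2 ^ L"
  shows "\<bar>fluct a \<omega> (real k / 2 ^ L) - fluct a \<omega> (real (k div 2 ^ (L - m)) / 2 ^ m)\<bar> \<le> \<eta>"
    and "\<And>i j. i \<le> j \<Longrightarrow> j \<le> 2 ^ m \<Longrightarrow> \<bar>fluct a \<omega> (real j / 2 ^ m) - fluct a \<omega> (real i / 2 ^ m)\<bar> \<le> real (j - i) * (\<eta> / 10)"
proof -
  let ?c = "\<lambda>l. \<eta> / 10 * (9 / 10) ^ (l - m)"
  have inc: "\<bar>fluct a \<omega> (real (Suc k) / 2 ^ l) - fluct a \<omega> (real k / 2 ^ l)\<bar> \<le> ?c l"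
    if "m \<le> l" "l \<le> L" "k < 2 ^ l" for l k
    using \<omega> that unfolding bad_event_def by (force simp: not_less)
  have "\<bar>fluct a \<omega> (real k / 2 ^ L) - fluct a \<omega> (real (k div 2 ^ (L - m)) / 2 ^ m)\<bar> \<le> (\<Sum>i=Suc m..L. ?c i)"
    using \<eta> mL k by (intro dyadic_chaining[OF inc]) auto
  also have "\<dots> \<le> (\<Sum>i=m..L. ?c i)" using \<eta> by (intro sum_mono2) auto
  also have "\<dots> = \<eta> / 10 * (\<Sum>i=m..L. (9 / 10) ^ (i - m))" by (simp only: sum_distrib_left)
  also have "\<dots> \<le> \<eta> / 10 * (1 / (1 - 9 / 10))" using \<eta> by (intro mult_left_mono geometric_sum_le) auto
  finally show "\<bar>fluct a \<omega> (real k / 2 ^ L) - fluct a \<omega> (real (k div 2 ^ (L - m)) / 2 ^ m)\<bar> \<le> \<eta>" by simp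
  fix i j :: nat assume "i \<le> j" "j \<le> 2 ^ m"
  then show "\<bar>fluct a \<omega> (real j / 2 ^ m) - fluct a \<omega> (real i / 2 ^ m)\<bar> \<le> real (j - i) * (\<eta> / 10)"
    using inc[of m] mL by (intro dyadic_increments) auto
qed

text \<open>The grid of level 0 is \<open>{0, 1}\<close>, where the process vanishes, so chaining
  from level 0 bounds the process itself.\<close>

lemma fluct_sup:
  assumes a: "a > 0" and \<omega>: "\<omega> \<in> space (M a) - bad_event a 0 L K" and K: "K > 0" and k: "k \<le> 2 ^ L"
  shows "\<bar>fluct a \<omega> (real k / 2 ^ L)\<bar> \<le> K"
proof -
  have "k div 2 ^ L \<le> 1" using k by (metis div_le_mono div_self power_not_zero zero_neq_numeral)
  then consider "k div 2 ^ L = 0" | "k div 2 ^ L = 1" by linarith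
  then have "fluct a \<omega> (real (k div 2 ^ L)) = 0"
    using \<omega> fluct_0[OF a] fluct_1[OF a] by cases auto
  then show ?thesis using fluct_oscillation(1)[OF a \<omega> K _ k] by simp
qed

end

section \<open>Finite-dimensional distributions\<close>

lemma restrict_skorokhodI:
  assumes "\<And>t. t \<in> {p<..q} \<Longrightarrow> (f \<longlongrightarrow> f t) (at_left t)"
    and "\<And>t. t \<in> {p..<q} \<Longrightarrow> \<exists>l. (f \<longlongrightarrow> l) (at_right t)"
  shows "(\<lambda>t\<in>{p..q}. f t) \<in> skorokhod_paths p q"
proof -
  have "((\<lambda>t\<in>{p..q}. f t) \<longlongrightarrow> f t) (at_left t)" if t: "t \<in> {p<..q}" for t
  proof -
    have "\<forall>\<^sub>F s in at_left t. s \<in> {p<..<t}" using t by (intro eventually_at_left_real) auto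
    then have "\<forall>\<^sub>F s in at_left t. f s = (\<lambda>t\<in>{p..q}. f t) s"
      by eventually_elim (use t in auto)
    then show ?thesis by (rule Lim_transform_eventually[OF assms(1)[OF t]])
  qed
  moreover have "\<exists>l. ((\<lambda>t\<in>{p..q}. f t) \<longlongrightarrow> l) (at_right t)" if t: "t \<in> {p..<q}" for t
  proof -
    obtain l where l: "(f \<longlongrightarrow> l) (at_right t)" using assms(2)[OF t] by blast
    have "\<forall>\<^sub>F s in at_right t. s \<in> {t<..<q}" using t by (intro eventually_at_right_real) auto
    then have "\<forall>\<^sub>F s in at_right t. f s = (\<lambda>t\<in>{p..q}. f t) s"
      by eventually_elim (use t in auto)
    then show ?thesis using Lim_transform_eventually[OF l] by blast
  qed
  ultimately show ?thesis by (auto simp: skorokhod_paths_def)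
qed

lemma continuous_skorokhod: "continuous_on {p..q} g \<Longrightarrow> (\<lambda>t\<in>{p..q}. g t) \<in> skorokhod_paths p q"
  using ceiling_step_skorokhod[of 1 p q g "\<lambda>_. 1" 0] by simp

lemma gaussian_processD:
  assumes "gaussian_process N T X" "finite I" "I \<subseteq> T"
  shows "\<exists>\<mu> \<sigma>. \<sigma> \<ge> 0 \<and> distr N borel (\<lambda>\<omega>. \<Sum>t\<in>I. c t * X t \<omega>) = normal_distribution \<mu> \<sigma>"
  using assms by (simp add: gaussian_process_def)

lemma gaussian_process_marginal:
  assumes "gaussian_process N T X" "t \<in> T"
  shows "X t \<in> borel_measurable N" "integrable N (X t)" "integrable N (\<lambda>\<omega>. (X t \<omega>)\<^sup>2)"
proof -
  show m: "X t \<in> borel_measurable N" using assms by (auto simp: gaussian_process_def)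
  have "\<exists>\<mu> \<sigma>. \<sigma> \<ge> 0 \<and> distr N borel (\<lambda>\<omega>. \<Sum>s\<in>{t}. 1 * X s \<omega>) = normal_distribution \<mu> \<sigma>"
    using gaussian_processD[OF assms(1), of "{t}" "\<lambda>_. 1"] assms(2) by simp
  then obtain \<mu> \<sigma> where \<sigma>: "\<sigma> \<ge> 0"
    and "distr N borel (\<lambda>\<omega>. \<Sum>s\<in>{t}. 1 * X s \<omega>) = normal_distribution \<mu> \<sigma>" by blast
  then have "distr N borel (X t) = normal_distribution \<mu> \<sigma>" by simp
  from gaussian_random_variable[OF _ m \<sigma> this] assms(1)
  show "integrable N (X t)" "integrable N (\<lambda>\<omega>. (X t \<omega>)\<^sup>2)" by (auto simp: gaussian_process_def)
qed

lemma integrable_product_of_squares: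
  fixes X Y :: "'v \<Rightarrow> real"
  assumes [measurable]: "X \<in> borel_measurable N" "Y \<in> borel_measurable N"
    and "integrable N (\<lambda>\<omega>. (X \<omega>)\<^sup>2)" "integrable N (\<lambda>\<omega>. (Y \<omega>)\<^sup>2)"
  shows "integrable N (\<lambda>\<omega>. X \<omega> * Y \<omega>)"
proof (rule Bochner_Integration.integrable_bound)
  show "integrable N (\<lambda>\<omega>. (X \<omega>)\<^sup>2 + (Y \<omega>)\<^sup>2)" using assms by auto
  have "\<bar>x * y\<bar> \<le> x\<^sup>2 + y\<^sup>2" for x y :: real
  proof -
    have "2 * \<bar>x\<bar> * \<bar>y\<bar> \<le> \<bar>x\<bar>\<^sup>2 + \<bar>y\<bar>\<^sup>2" by (rule sum_squares_bound)
    moreover have "0 \<le> \<bar>x\<bar> * \<bar>y\<bar>" by simp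
    ultimately show ?thesis unfolding abs_mult power2_abs by linarith
  qed
  then show "AE \<omega> in N. norm (X \<omega> * Y \<omega>) \<le> norm ((X \<omega>)\<^sup>2 + (Y \<omega>)\<^sup>2)"
    by (intro AE_I2) (auto intro: order_trans[OF _ abs_ge_self])
qed measurable

lemma brownian_bridge_moments:
  assumes B: "brownian_bridge N B" and st: "s \<in> {0..1}" "t \<in> {0..1}"
  shows "integrable N (\<lambda>\<omega>. B s \<omega> * B t \<omega>)" "(\<integral>\<omega>. B s \<omega> * B t \<omega> \<partial>N) = min s t - s * t"
proof -
  have g: "gaussian_process N {0..1} B" using B by (simp add: brownian_bridge_def)
  show "integrable N (\<lambda>\<omega>. B s \<omega> * B t \<omega>)"
    using gaussian_process_marginal[OF g] st by (intro integrable_product_of_squares) auto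
  have "covariance N (B s) (B t) = (\<integral>\<omega>. B s \<omega> * B t \<omega> \<partial>N)"
    using B st by (simp add: covariance_def brownian_bridge_def)
  then show "(\<integral>\<omega>. B s \<omega> * B t \<omega> \<partial>N) = min s t - s * t"
    using B st by (simp add: brownian_bridge_def)
qed

text \<open>A normal law is fixed by mean and variance, so the characteristic function of a
  combination of bridge values follows from the covariances.\<close>

lemma brownian_bridge_dyadic_char:
  assumes B: "brownian_bridge N B"
  shows "char (distr N borel (\<lambda>\<omega>. \<Sum>k<Suc (2 ^ m). c k * B (real k / 2 ^ m) \<omega>)) 1 = complex_of_real
    (exp (- (\<Sum>k<Suc (2 ^ m). \<Sum>l<Suc (2 ^ m). c k * c l *
       (min (real k / 2 ^ m) (real l / 2 ^ m) - real k / 2 ^ m * (real l / 2 ^ m))) / 2))"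
proof -
  let ?n = "Suc (2 ^ m)" and ?u = "\<lambda>k::nat. real k / 2 ^ m"
  have g: "gaussian_process N {0..1} B" using B by (simp add: brownian_bridge_def)
  interpret prob_space N using g by (simp add: gaussian_process_def)
  have u: "?u k \<in> {0..1}" if "k < ?n" for k
  proof -
    have "real k \<le> real (2 ^ m)" using that by (intro of_nat_mono) simp
    then show ?thesis by (simp add: divide_le_eq)
  qed
  note marg = gaussian_process_marginal[OF g u]
  define X where "X \<omega> = (\<Sum>k<?n. c k * B (?u k) \<omega>)" for \<omega>
  have Xm: "X \<in> borel_measurable N"
    unfolding X_def using marg by (intro borel_measurable_sum borel_measurable_times) auto
  \<comment> \<open>\<open>gaussian_process\<close> indexes coefficients by times; \<open>c'\<close>
    recovers the grid index from the time.\<close>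
  define c' where "c' t = c (nat \<lfloor>t * 2 ^ m\<rfloor>)" for t :: real
  have c': "c' (?u k) = c k" for k by (simp add: c'_def)
  have inj: "inj_on ?u {..<?n}" by (auto simp: inj_on_def)
  have Xeq: "(\<lambda>\<omega>. \<Sum>t\<in>?u ` {..<?n}. c' t * B t \<omega>) = X"
    unfolding X_def by (subst sum.reindex[OF inj]) (simp add: c')
  have "\<exists>\<mu> \<sigma>. \<sigma> \<ge> 0 \<and>
      distr N borel (\<lambda>\<omega>. \<Sum>t\<in>?u ` {..<?n}. c' t * B t \<omega>) = normal_distribution \<mu> \<sigma>"
    by (rule gaussian_processD[OF g]) (use u in auto)
  then obtain \<mu> \<sigma> where \<sigma>: "\<sigma> \<ge> 0" and d: "distr N borel X = normal_distribution \<mu> \<sigma>"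
    unfolding Xeq by blast
  note gr = gaussian_random_variable[OF prob_space_axioms Xm \<sigma> d]
  have "(\<integral>\<omega>. X \<omega> \<partial>N) = (\<Sum>k<?n. c k * (\<integral>\<omega>. B (?u k) \<omega> \<partial>N))"
    unfolding X_def using marg by (subst Bochner_Integration.integral_sum) auto
  also have "\<dots> = 0" using B u by (intro sum.neutral) (auto simp: brownian_bridge_def)
  finally have \<mu>: "\<mu> = 0" using gr(3) by simp
  have "\<sigma>\<^sup>2 = (\<integral>\<omega>. (X \<omega>)\<^sup>2 \<partial>N)" using gr(4) \<mu> by simp
  also have "\<dots> = (\<integral>\<omega>. (\<Sum>k<?n. \<Sum>l<?n. c k * c l * (B (?u k) \<omega> * B (?u l) \<omega>)) \<partial>N)"
    unfolding X_def power2_eq_square sum_product by (simp only: mult_ac)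
  also have "\<dots> = (\<Sum>k<?n. \<Sum>l<?n. c k * c l * (\<integral>\<omega>. B (?u k) \<omega> * B (?u l) \<omega> \<partial>N))"
    using brownian_bridge_moments(1)[OF B u u]
    by (subst Bochner_Integration.integral_sum, force intro!: Bochner_Integration.integrable_sum)
      (intro sum.cong refl, subst Bochner_Integration.integral_sum, auto)
  also have "\<dots> = (\<Sum>k<?n. \<Sum>l<?n. c k * c l * (min (?u k) (?u l) - ?u k * ?u l))"
    using brownian_bridge_moments(2)[OF B u u] by (intro sum.cong refl) auto
  finally show ?thesis using gr(5) \<mu> unfolding X_def[abs_def] by simp
qed

context dirichlet_family
begin

text \<open>A combination of values of \<open>fluct\<close> on the grid is a centred linear form in
  the cell masses, hence in a Dirichlet vector. Its moments converge to Gaussian ones, with the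
  variance of the bridge.\<close>

lemma fluct_dyadic_char_tendsto:
  "((\<lambda>a. char (distr (M a) borel (\<lambda>\<omega>. \<Sum>k<Suc (2 ^ m). c k * fluct a \<omega> (real k / 2 ^ m))) 1) \<longlongrightarrow>
    complex_of_real (exp (- (\<Sum>k<Suc (2 ^ m). \<Sum>l<Suc (2 ^ m). c k * c l *
       (min (real k / 2 ^ m) (real l / 2 ^ m) - real k / 2 ^ m * (real l / 2 ^ m))) / 2))) at_top"
proof -
  let ?N = "Suc (2 ^ m)"
  define n :: nat where "n = 2 ^ m"
  have n: "n > 0" and rn: "(2::real) ^ m = real n" by (simp_all add: n_def)
  let ?u = "\<lambda>k::nat. real k / real n"
  \<comment> \<open>The weight of cell \<open>i\<close> in the value at \<open>k / n\<close>: the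
    indicator of the first \<open>k\<close> cells, centred. Subtracting \<open>?u k\<close> in every
    cell is legitimate because the masses sum to 1.\<close>
  define s where "s k i = (if i < k then 1 else 0) - ?u k" for k i :: nat
  define \<theta> where "\<theta> i = (\<Sum>k<Suc n. c k * s k i)" for i
  define w where "w i = 1 / real n" for i :: nat
  have cnt: "(\<Sum>i<n. if i < k then 1 else 0) = real k" if "k \<le> n" for k
  proof -
    have "{i. i < n \<and> i < k} = {..<k}" using that by auto
    then show ?thesis by (simp add: sum.If_cases Int_def)
  qed
  \<comment> \<open>Covariances of centred indicators under the uniform law on \<open>n\<close>
    cells are those of the bridge.\<close>
  have ss: "(\<Sum>i<n. w i * (s k i * s l i)) = min (?u k) (?u l) - ?u k * ?u l" if "k \<le> n" "l \<le> n" for k l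
  proof -
    have "s k i * s l i = (if i < min k l then 1 else 0) - ?u l * (if i < k then 1 else 0)
        - ?u k * (if i < l then 1 else 0) + ?u k * ?u l" for i
      by (simp add: s_def algebra_simps)
    then have "(\<Sum>i<n. s k i * s l i) = (\<Sum>i<n. if i < min k l then 1 else 0) - ?u l * (\<Sum>i<n. if i < k then 1 else 0)
        - ?u k * (\<Sum>i<n. if i < l then 1 else 0) + real n * (?u k * ?u l)"
      by (simp only: sum.distrib sum_subtractf sum_distrib_left[symmetric] sum_constant card_lessThan mult.left_commute[of "real n"])
    also have "\<dots> = real (min k l) - ?u l * real k - ?u k * real l + real n * (?u k * ?u l)"
      using that by (subst (1 2 3) cnt) auto
    also have "\<dots> = real n * (min (?u k) (?u l) - ?u k * ?u l)"
      using n by (simp add: min_def field_simps)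
    finally show ?thesis using n by (simp add: w_def sum_distrib_left[symmetric] flip: sum_divide_distrib)
  qed
  have s0: "(\<Sum>i<n. w i * s k i) = 0" if "k \<le> n" for k
  proof -
    have "(\<Sum>i<n. s k i) = (\<Sum>i<n. if i < k then 1 else 0) - real n * ?u k"
      unfolding s_def by (simp only: sum_subtractf sum_constant card_lessThan)
    then have "(\<Sum>i<n. s k i) = 0" using cnt[OF that] n by simp
    then show ?thesis by (simp add: w_def flip: sum_divide_distrib)
  qed
  have \<theta>0: "(\<Sum>i<n. w i * \<theta> i) = 0"
  proof -
    have "(\<Sum>i<n. w i * \<theta> i) = (\<Sum>k<Suc n. c k * (\<Sum>i<n. w i * s k i))"
      unfolding \<theta>_def sum_distrib_left by (subst sum.swap) (simp only: mult_ac)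
    also have "\<dots> = 0" using s0 by (intro sum.neutral) auto
    finally show ?thesis .
  qed
  have v: "(\<Sum>i<n. w i * (\<theta> i)\<^sup>2) = (\<Sum>k<Suc n. \<Sum>l<Suc n. c k * c l * (min (?u k) (?u l) - ?u k * ?u l))"
  proof -
    have "(\<Sum>i<n. w i * (\<theta> i)\<^sup>2) = (\<Sum>i<n. \<Sum>k<Suc n. \<Sum>l<Suc n. c k * c l * (w i * (s k i * s l i)))"
    proof (rule sum.cong[OF refl])
      fix i
      have "(\<theta> i)\<^sup>2 = (\<Sum>k<Suc n. \<Sum>l<Suc n. (c k * s k i) * (c l * s l i))"
        unfolding \<theta>_def power2_eq_square by (rule sum_product)
      then show "w i * (\<theta> i)\<^sup>2 = (\<Sum>k<Suc n. \<Sum>l<Suc n. c k * c l * (w i * (s k i * s l i)))"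
        by (simp only: sum_distrib_left mult_ac)
    qed
    also have "\<dots> = (\<Sum>k<Suc n. \<Sum>i<n. \<Sum>l<Suc n. c k * c l * (w i * (s k i * s l i)))" by (rule sum.swap)
    also have "\<dots> = (\<Sum>k<Suc n. \<Sum>l<Suc n. \<Sum>i<n. c k * c l * (w i * (s k i * s l i)))"
      by (intro sum.cong refl sum.swap)
    also have "\<dots> = (\<Sum>k<Suc n. \<Sum>l<Suc n. c k * c l * (min (?u k) (?u l) - ?u k * ?u l))"
      by (intro sum.cong refl) (simp only: sum_distrib_left[symmetric], subst ss, auto)
    finally show ?thesis .
  qed
  define X where "X a \<omega> = (\<Sum>k<Suc n. c k * fluct a \<omega> (?u k))" for a \<omega>
  have X_eq: "X a \<omega> = sqrt a * (\<Sum>i<n. \<theta> i * (mass a \<omega> (?u (Suc i)) - mass a \<omega> (?u i)))"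
    if a: "a > 0" and \<omega>: "\<omega> \<in> space (M a)" for a \<omega>
  proof -
    let ?d = "\<lambda>i. mass a \<omega> (?u (Suc i)) - mass a \<omega> (?u i)"
    have tel: "(\<Sum>i<k. ?d i) = mass a \<omega> (?u k)" for k
      using sum_lessThan_telescope[of "\<lambda>i. mass a \<omega> (?u i)" k] mass_0[OF a] by simp
    have "(\<Sum>i<n. s k i * ?d i) = mass a \<omega> (?u k) - ?u k" if "k \<le> n" for k
    proof -
      have "(\<Sum>i<n. (if i < k then 1 else 0) * ?d i) = (\<Sum>i<k. ?d i)"
        using that by (intro sum.mono_neutral_cong_right) auto
      moreover have "(\<Sum>i<n. s k i * ?d i) = (\<Sum>i<n. (if i < k then 1 else 0) * ?d i) - ?u k * (\<Sum>i<n. ?d i)"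
      proof -
        have "s k i * ?d i = (if i < k then 1 else 0) * ?d i - ?u k * ?d i" for i
          unfolding s_def by (rule left_diff_distrib)
        then show ?thesis by (simp only: sum_subtractf[of "\<lambda>i. (if i < k then 1 else 0) * ?d i"] sum_distrib_left)
      qed
      ultimately show ?thesis using tel[of k] tel[of n] mass_1[OF a \<omega>] n by simp
    qed
    then have "X a \<omega> = (\<Sum>k<Suc n. sqrt a * (c k * (\<Sum>i<n. s k i * ?d i)))"
      unfolding X_def fluct_def by (intro sum.cong refl) auto
    also have "\<dots> = sqrt a * (\<Sum>k<Suc n. \<Sum>i<n. c k * s k i * ?d i)"
      by (simp only: sum_distrib_left mult.assoc)
    also have "(\<Sum>k<Suc n. \<Sum>i<n. c k * s k i * ?d i) = (\<Sum>i<n. \<theta> i * ?d i)"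
      unfolding \<theta>_def sum_distrib_right by (rule sum.swap)
    finally show ?thesis .
  qed
  have "((\<lambda>a. char (distr (M a) borel (X a)) 1) \<longlongrightarrow>
      complex_of_real (exp (- (\<Sum>i<n. w i * (\<theta> i)\<^sup>2) / 2))) at_top"
  proof (rule char_tendsto_gauss)
    show "\<forall>\<^sub>F a in at_top. prob_space (M a) \<and> X a \<in> borel_measurable (M a) \<and> (\<forall>k. integrable (M a) (\<lambda>\<omega>. X a \<omega> ^ k))"
      using eventually_gt_at_top[of 0]
    proof eventually_elim
      case (elim a)
      interpret prob_space "M a" by (rule prob_M[OF elim])
      have m [measurable]: "X a \<in> borel_measurable (M a)"
        unfolding X_def using measurable_fluct[OF elim] by measurable
      have "integrable (M a) (\<lambda>\<omega>. X a \<omega> ^ k)" for k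
      proof (rule integrable_const_bound[of _ "(\<Sum>k<Suc n. \<bar>c k\<bar> * sqrt a) ^ k"])
        show "AE \<omega> in M a. norm (X a \<omega> ^ k) \<le> (\<Sum>k<Suc n. \<bar>c k\<bar> * sqrt a) ^ k"
        proof (rule AE_I2)
          fix \<omega> assume \<omega>: "\<omega> \<in> space (M a)"
          have "\<bar>X a \<omega>\<bar> \<le> (\<Sum>k<Suc n. \<bar>c k * fluct a \<omega> (?u k)\<bar>)" unfolding X_def by (rule sum_abs)
          also have "\<dots> \<le> (\<Sum>k<Suc n. \<bar>c k\<bar> * sqrt a)"
            unfolding abs_mult using n by (intro sum_mono mult_left_mono fluct_bound[OF elim \<omega>]) auto
          finally show "norm (X a \<omega> ^ k) \<le> (\<Sum>k<Suc n. \<bar>c k\<bar> * sqrt a) ^ k"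
            unfolding real_norm_def power_abs by (rule power_mono) simp
        qed
      qed measurable
      with m prob_space_axioms show ?case by blast
    qed
    fix k
    have "((\<lambda>a. \<integral>y. (sqrt a * (\<Sum>j<n. \<theta> j * y j)) ^ k \<partial>dirichlet_distribution {..<n} (\<lambda>j. a * w j))
      \<longlongrightarrow> fact k * gauss_coeff (\<Sum>j<n. w j * (\<theta> j)\<^sup>2) k) at_top"
      using n by (intro dirichlet_linear_form_moment_tendsto \<theta>0 prob_space_dirichlet) (auto simp: w_def)
    moreover have "\<forall>\<^sub>F a in at_top. (\<integral>y. (sqrt a * (\<Sum>j<n. \<theta> j * y j)) ^ k \<partial>dirichlet_distribution {..<n} (\<lambda>j. a * w j))
      = (\<integral>\<omega>. X a \<omega> ^ k \<partial>M a)"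
      using eventually_gt_at_top[of 0]
    proof eventually_elim
      case (elim a)
      have D: "distr (M a) (\<Pi>\<^sub>M i\<in>{..<n}. borel) (\<lambda>\<omega>. \<lambda>i\<in>{..<n}. mass a \<omega> (?u (Suc i)) - mass a \<omega> (?u i))
        = dirichlet_distribution {..<n} (\<lambda>j. a * w j)"
      proof -
        have "?u (Suc i) - ?u i = w i" for i by (simp add: w_def diff_divide_distrib[symmetric])
        moreover have "distr (M a) (\<Pi>\<^sub>M i\<in>{..<n}. borel) (\<lambda>\<omega>. \<lambda>i\<in>{..<n}. mass a \<omega> (?u (Suc i)) - mass a \<omega> (?u i))
          = dirichlet_distribution {..<n} (\<lambda>i. a * (?u (Suc i) - ?u i))"
          using n by (intro mass_increments_dirichlet elim) (auto intro!: divide_strict_right_mono)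
        ultimately show ?thesis by simp
      qed
      have mD: "(\<lambda>\<omega>. \<lambda>i\<in>{..<n}. mass a \<omega> (?u (Suc i)) - mass a \<omega> (?u i)) \<in> measurable (M a) (\<Pi>\<^sub>M i\<in>{..<n}. borel)"
        using measurable_mass[OF elim] by (intro measurable_restrict) auto
      show ?case
        unfolding D[symmetric] using X_eq[OF elim]
        by (subst integral_distr[OF mD]) (auto intro!: Bochner_Integration.integral_cong)
    qed
    ultimately show "((\<lambda>a. \<integral>\<omega>. X a \<omega> ^ k \<partial>M a) \<longlongrightarrow> fact k * gauss_coeff (\<Sum>i<n. w i * (\<theta> i)\<^sup>2) k) at_top"
      by (rule Lim_transform_eventually)
  qed
  then show ?thesis unfolding v X_def[abs_def] rn n_def[symmetric] .
qed

lemma fluct_dyadic_weak: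
  fixes \<psi> :: "(nat \<Rightarrow> real) \<Rightarrow> real"
  assumes B: "brownian_bridge N B"
    and \<psi>a: "\<forall>\<^sub>F a in at_top. (\<lambda>\<omega>. \<psi> (\<lambda>k. fluct a \<omega> (real k / 2 ^ m))) \<in> borel_measurable (M a)"
    and \<psi>B: "(\<lambda>\<omega>. \<psi> (\<lambda>k. B (real k / 2 ^ m) \<omega>)) \<in> borel_measurable N"
    and lip: "\<And>x y. \<bar>\<psi> x - \<psi> y\<bar> \<le> C * (\<Sum>k<Suc (2 ^ m). \<bar>x k - y k\<bar>)" and bd: "\<And>x. \<bar>\<psi> x\<bar> \<le> D"
  shows "((\<lambda>a. \<integral>\<omega>. \<psi> (\<lambda>k. fluct a \<omega> (real k / 2 ^ m)) \<partial>M a)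
    \<longlongrightarrow> (\<integral>\<omega>. \<psi> (\<lambda>k. B (real k / 2 ^ m) \<omega>) \<partial>N)) at_top"
proof -
  have g: "gaussian_process N {0..1} B" using B by (simp add: brownian_bridge_def)
  interpret prob_space N using g by (simp add: gaussian_process_def)
  have u: "real k / 2 ^ m \<in> {0..1}" if "k < Suc (2 ^ m)" for k
  proof -
    have "real k \<le> real (2 ^ m)" using that by (intro of_nat_mono) simp
    then show ?thesis by (simp add: divide_le_eq)
  qed
  note marg = gaussian_process_marginal[OF g u]
  have BX: "(\<lambda>\<omega>. \<Sum>k<Suc (2 ^ m). c k * B (real k / 2 ^ m) \<omega>) \<in> borel_measurable N" for c :: "nat \<Rightarrow> real"
    using marg by (intro borel_measurable_sum borel_measurable_times) auto
  have char: "((\<lambda>a. \<integral>\<omega>. cos (\<Sum>k<Suc (2 ^ m). c k * fluct a \<omega> (real k / 2 ^ m)) \<partial>M a)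
      \<longlongrightarrow> (\<integral>\<omega>. cos (\<Sum>k<Suc (2 ^ m). c k * B (real k / 2 ^ m) \<omega>) \<partial>N)) at_top"
    "((\<lambda>a. \<integral>\<omega>. sin (\<Sum>k<Suc (2 ^ m). c k * fluct a \<omega> (real k / 2 ^ m)) \<partial>M a)
      \<longlongrightarrow> (\<integral>\<omega>. sin (\<Sum>k<Suc (2 ^ m). c k * B (real k / 2 ^ m) \<omega>) \<partial>N)) at_top" for c :: "nat \<Rightarrow> real"
  proof -
    let ?X = "\<lambda>a \<omega>. \<Sum>k<Suc (2 ^ m). c k * fluct a \<omega> (real k / 2 ^ m)"
    let ?Y = "\<lambda>\<omega>. \<Sum>k<Suc (2 ^ m). c k * B (real k / 2 ^ m) \<omega>"
    have lim: "((\<lambda>a. char (distr (M a) borel (?X a)) 1) \<longlongrightarrow> char (distr N borel ?Y) 1) at_top"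
      unfolding brownian_bridge_dyadic_char[OF B] by (rule fluct_dyadic_char_tendsto)
    have "\<forall>\<^sub>F a in at_top. Re (char (distr (M a) borel (?X a)) 1) = (\<integral>\<omega>. cos (?X a \<omega>) \<partial>M a) \<and>
        Im (char (distr (M a) borel (?X a)) 1) = (\<integral>\<omega>. sin (?X a \<omega>) \<partial>M a)"
      using eventually_gt_at_top[of 0]
    proof eventually_elim
      case (elim a)
      have "?X a \<in> borel_measurable (M a)" using measurable_fluct[OF elim] by measurable
      from char_cos_sin[OF prob_M[OF elim] this] show ?case by simp
    qed
    then have ev: "\<forall>\<^sub>F a in at_top. Re (char (distr (M a) borel (?X a)) 1) = (\<integral>\<omega>. cos (?X a \<omega>) \<partial>M a)"
      "\<forall>\<^sub>F a in at_top. Im (char (distr (M a) borel (?X a)) 1) = (\<integral>\<omega>. sin (?X a \<omega>) \<partial>M a)"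
      by (auto elim: eventually_mono)
    show "((\<lambda>a. \<integral>\<omega>. cos (?X a \<omega>) \<partial>M a) \<longlongrightarrow> (\<integral>\<omega>. cos (?Y \<omega>) \<partial>N)) at_top"
      unfolding char_cos_sin[OF prob_space_axioms BX]
      by (rule Lim_transform_eventually[OF tendsto_Re[OF lim] ev(1)])
    show "((\<lambda>a. \<integral>\<omega>. sin (?X a \<omega>) \<partial>M a) \<longlongrightarrow> (\<integral>\<omega>. sin (?Y \<omega>) \<partial>N)) at_top"
      unfolding char_cos_sin[OF prob_space_axioms BX]
      by (rule Lim_transform_eventually[OF tendsto_Im[OF lim] ev(2)])
  qed
  \<comment> \<open>The same constant as in \<open>fluct_second_moment\<close>, since
    \<open>cramer_wold_lipschitz\<close> takes one bound for both sides.\<close>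
  have B2: "(\<integral>\<omega>. (B (real k / 2 ^ m) \<omega>)\<^sup>2 \<partial>N) \<le> 10" if "k < Suc (2 ^ m)" for k
  proof -
    have "(\<integral>\<omega>. (B (real k / 2 ^ m) \<omega>)\<^sup>2 \<partial>N) = real k / 2 ^ m - real k / 2 ^ m * (real k / 2 ^ m)"
      using brownian_bridge_moments(2)[OF B u[OF that] u[OF that]] by (simp add: power2_eq_square)
    moreover have "0 \<le> real k / 2 ^ m * (real k / 2 ^ m)" by simp
    moreover have "real k / 2 ^ m \<le> 1" using u[OF that] by simp
    ultimately show ?thesis by linarith
  qed
  show ?thesis
  proof (rule cramer_wold_lipschitz[where n = "Suc (2 ^ m)" and C = 10, OF _ prob_space_axioms _ _ _ \<psi>B char lip bd])
    show "\<forall>\<^sub>F a in at_top. prob_space (M a) \<and> (\<forall>k<Suc (2 ^ m). (\<lambda>\<omega>. fluct a \<omega> (real k / 2 ^ m)) \<in> borel_measurable (M a) \<and>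
        integrable (M a) (\<lambda>\<omega>. (fluct a \<omega> (real k / 2 ^ m))\<^sup>2) \<and> (\<integral>\<omega>. (fluct a \<omega> (real k / 2 ^ m))\<^sup>2 \<partial>M a) \<le> 10) \<and>
        (\<lambda>\<omega>. \<psi> (\<lambda>k. fluct a \<omega> (real k / 2 ^ m))) \<in> borel_measurable (M a)"
      using \<psi>a eventually_ge_at_top[of 1]
    proof eventually_elim
      case (elim a)
      then have "a > 0" by simp
      then show ?case using elim prob_M measurable_fluct fluct_second_moment[OF elim(2)] u by auto
    qed
  qed (use marg B2 in auto)
qed

end

section \<open>The quantile process\<close>

locale dirichlet_quantile = dirichlet_family H M P
  for H :: "real measure" and M :: "real \<Rightarrow> 'w measure" and P :: "real \<Rightarrow> 'w \<Rightarrow> real measure" +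
  fixes h :: "real \<Rightarrow> real" and p q \<epsilon> :: real
  assumes pq: "0 < p" "p < q" "q < 1" and \<epsilon>: "\<epsilon> > 0"
    and deriv: "\<And>x. x \<in> {quantile H p - \<epsilon>..quantile H q + \<epsilon>} \<Longrightarrow>
           (cdf H has_real_derivative h x) (at x within {quantile H p - \<epsilon>..quantile H q + \<epsilon>})"
    and h_pos: "\<And>x. x \<in> {quantile H p - \<epsilon>..quantile H q + \<epsilon>} \<Longrightarrow> h x > 0"
    and h_cont: "continuous_on {quantile H p..quantile H q} h"
begin

abbreviation hq :: "real \<Rightarrow> real" where
  "hq t \<equiv> h (quantile H t)"

lemma quantile_range: "t \<in> {p..q} \<Longrightarrow> quantile H t \<in> {quantile H p..quantile H q}"
  using pq by (auto intro!: H.quantile_mono)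

lemma hq_cont: "continuous_on {p..q} hq"
  using continuous_on_compose2[OF h_cont continuous_on_quantile[OF pq H H_cont \<epsilon> deriv h_pos h_cont]]
    quantile_range by blast

lemma hq_pos: "t \<in> {p..q} \<Longrightarrow> hq t > 0"
  using quantile_range[of t] \<epsilon> by (intro h_pos) auto

lemma hq_nonzero: "t \<in> {p..q} \<Longrightarrow> hq t \<noteq> 0"
  using hq_pos[of t] by simp

lemma hq_lower_bound: obtains c where "c > 0" "\<And>t. t \<in> {p..q} \<Longrightarrow> c \<le> hq t"
proof -
  obtain z where "z \<in> {p..q}" "\<And>t. t \<in> {p..q} \<Longrightarrow> hq z \<le> hq t"
    using continuous_attains_inf[OF _ _ hq_cont] pq by auto
  then show ?thesis using that[of "hq z"] hq_pos by blast
qed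

text \<open>
  A Bahadur representation. If \<open>j\<close> is the first dyadic point of level \<open>L\<close> where \<open>P a \<omega>\<close> has mass at
  least \<open>t\<close>, then the random quantile lies between the \<open>H\<close>-quantiles at levels \<open>(j - 1) / 2 ^ L\<close> and
  \<open>j / 2 ^ L\<close>, and both levels differ from \<open>t\<close> by about \<open>- fluct / sqrt a\<close>.
\<close>

lemma bahadur:
  assumes a: "a \<ge> 1" and aL: "a \<le> 2 ^ L" and mL: "m \<le> L"
    and \<omega>: "\<omega> \<in> space (M a)" "\<omega> \<notin> bad_event a m L \<eta>" "\<omega> \<notin> bad_event a 0 L K"
    and \<eta>: "\<eta> > 0" and K: "K > 0" and \<gamma>: "\<gamma> > 0"
    and small: "(K + 1) / sqrt a \<le> \<delta>" "(K + 1) / sqrt a < p" "(K + 1) / sqrt a < 1 - q"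
      "(K + 1) / sqrt a \<le> 1 / 2 ^ m"
    and ex: "\<And>t u. t \<in> {p..q} \<Longrightarrow> 0 < u \<Longrightarrow> u < 1 \<Longrightarrow> \<bar>u - t\<bar> \<le> \<delta> \<Longrightarrow>
       \<bar>quantile H u - quantile H t - (u - t) / hq t\<bar> \<le> \<gamma> * \<bar>u - t\<bar>"
    and c: "c > 0" "\<And>t. t \<in> {p..q} \<Longrightarrow> c \<le> hq t" and t: "t \<in> {p..q}"
  shows "\<bar>sqrt a * (quantile (P a \<omega>) t - quantile H t) + fluct a \<omega> (real (nat \<lceil>2 ^ m * t\<rceil>) / 2 ^ m) / hq t\<bar>
    \<le> (2 * \<eta> + 1 / sqrt a) / c + \<gamma> * (K + 1)"
proof -
  have a0: "a > 0" using a by simp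
  define s where "s = sqrt a"
  have s: "s \<ge> 1" "s > 0" "s * s = a" using a by (auto simp: s_def)
  have t01: "0 < t" "t < 1" using t pq by auto
  interpret F: real_distribution "P a \<omega>" by (rule real_distribution_P[OF a0 \<omega>(1)])
  define V where "V k = fluct a \<omega> (real k / 2 ^ L)" for k :: nat
  define W where "W k = mass a \<omega> (real k / 2 ^ L)" for k :: nat
  have WV: "s * (W k - real k / 2 ^ L) = V k" for k by (simp add: W_def V_def fluct_def s_def)
  have VK: "\<bar>V k\<bar> \<le> K" if "k \<le> 2 ^ L" for k
    unfolding V_def using \<omega> K that by (intro fluct_sup[OF a0]) auto
  have WL: "t \<le> W (2 ^ L)" using mass_1[OF a0 \<omega>(1)] t01 by (simp add: W_def)
  define j where "j = (LEAST k. t \<le> W k)"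
  have j: "t \<le> W j" unfolding j_def by (rule LeastI[of "\<lambda>k. t \<le> W k", OF WL])
  have jL: "j \<le> 2 ^ L" unfolding j_def by (rule Least_le[of "\<lambda>k. t \<le> W k", OF WL])
  have "W 0 = 0" using mass_0[OF a0] by (simp add: W_def)
  then have "j \<noteq> 0" using j t01 by (intro notI) simp
  then obtain i where i: "j = Suc i" by (cases j) auto
  have Wi: "W i < t" using not_less_Least[of i "\<lambda>k. t \<le> W k"] i by (simp add: j_def)
  define u where "u = real j / 2 ^ L"
  define u' where "u' = real i / 2 ^ L"
  define d where "d = (1::real) / 2 ^ L"
  have ud: "u = u' + d" by (simp add: u_def u'_def d_def i add_divide_distrib)
  \<comment> \<open>One cell of the finest grid costs at most \<open>1 / sqrt a\<close> after
    scaling, because \<open>2 ^ L \<ge> a\<close>.\<close>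
  have sd: "s * d \<le> 1 / s"
  proof -
    have "d \<le> 1 / a" unfolding d_def using aL a0 by (intro divide_left_mono) auto
    then have "s * d \<le> s * (1 / a)" using s by (intro mult_left_mono) auto
    also have "\<dots> = 1 / s" using s by (simp flip: s(3))
    finally show ?thesis .
  qed
  have s1: "1 / s \<le> 1" "0 < 1 / s" using s by auto
  have d0: "0 < s * d" using s by (simp add: d_def)
  have lo: "- V j \<le> s * (u - t)"
  proof -
    have "s * (t - u) \<le> s * (W j - u)" using j s by (intro mult_left_mono) auto
    then show ?thesis using WV[of j] by (simp add: u_def algebra_simps)
  qed
  have hi: "s * (u' - t) < - V i"
  proof -
    have "s * (W i - u') < s * (t - u')" using Wi s by (intro mult_strict_left_mono) auto
    then show ?thesis using WV[of i] by (simp add: u'_def algebra_simps)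
  qed
  \<comment> \<open>Minimality of \<open>j\<close> bounds \<open>u\<close> only from below and
    \<open>u'\<close> only from above. Moving by one cell makes both bounds two-sided.\<close>
  have suu: "s * (u - t) = s * (u' - t) + s * d" by (simp add: ud algebra_simps)
  have K1: "\<bar>s * (u - t)\<bar> \<le> K + 1" "\<bar>s * (u' - t)\<bar> \<le> K + 1"
    using lo hi suu sd s1 d0 VK[OF jL] VK[of i] jL i by linarith+
  have ut: "\<bar>u - t\<bar> \<le> (K + 1) / sqrt a" "\<bar>u' - t\<bar> \<le> (K + 1) / sqrt a"
    using K1 s unfolding abs_mult by (simp_all add: s_def[symmetric] pos_le_divide_eq mult.commute)
  have u01: "0 < u'" "u' < u" "u < 1" using ut small(2,3) t d0 s ud by (auto simp: zero_less_mult_iff)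
  have cdf_lower: "cdf (P a \<omega>) (quantile H v) = mass a \<omega> v" if "0 < v" "v < 1" for v
    using that by (simp add: cdf_def mass_def lower_set_def)
  have x_hi: "quantile (P a \<omega>) t \<le> quantile H u"
    using F.quantile_le_iff[OF t01] cdf_lower[of u] u01 j by (simp add: W_def u_def)
  have x_lo: "quantile H u' \<le> quantile (P a \<omega>) t"
  proof -
    have "u' < 1" using u01 by linarith
    then have "cdf (P a \<omega>) (quantile H u') = W i"
      using cdf_lower[OF u01(1)] by (simp add: W_def u'_def)
    then show ?thesis using F.quantile_le_iff[OF t01, of "quantile H u'"] Wi by simp
  qed
  define r where "r = nat \<lceil>2 ^ m * t\<rceil>"
  define V0 where "V0 = fluct a \<omega> (real r / 2 ^ m)"
  have near: "\<bar>V k - V0\<bar> \<le> 2 * \<eta>" if k: "k \<le> 2 ^ L" and kt: "\<bar>real k / 2 ^ L - t\<bar> \<le> 1 / 2 ^ m" for k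
  proof -
    define k' where "k' = k div 2 ^ (L - m)"
    have osc: "\<bar>V k - fluct a \<omega> (real k' / 2 ^ m)\<bar> \<le> \<eta>"
      unfolding V_def k'_def using \<omega> by (intro fluct_oscillation(1)[OF a0 _ \<eta> mL k]) auto
    have p2: "(2::real) ^ L = 2 ^ (L - m) * 2 ^ m" using mL by (simp flip: power_add)
    have fl: "int k' = \<lfloor>2 ^ m * (real k / 2 ^ L)\<rfloor>"
    proof -
      have "2 ^ m * (real k / 2 ^ L) = real k / real (2 ^ (L - m))" unfolding p2 by simp
      then show ?thesis unfolding k'_def by (simp only: floor_divide_of_nat_eq)
    qed
    have "\<bar>2 ^ m * (real k / 2 ^ L) - 2 ^ m * t\<bar> \<le> 1"
    proof -
      have "2 ^ m * \<bar>real k / 2 ^ L - t\<bar> \<le> 2 ^ m * (1 / 2 ^ m)" using kt by (intro mult_left_mono) auto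
      moreover have "\<bar>2 ^ m * x - 2 ^ m * t\<bar> = 2 ^ m * \<bar>x - t\<bar>" for x
        by (simp add: abs_mult flip: right_diff_distrib)
      moreover have "(2::real) ^ m * (1 / 2 ^ m) = 1" by simp
      ultimately show ?thesis by (simp only:)
    qed
    moreover have r: "int r = \<lceil>2 ^ m * t\<rceil>" 
    proof -
      have "0 < 2 ^ m * t" using t01 by simp
      then have "0 \<le> \<lceil>2 ^ m * t\<rceil>" by linarith
      then show ?thesis by (simp add: r_def)
    qed
    \<comment> \<open>Floor and ceiling of numbers at distance at most 1 differ by at most 2. So two
      coarse increments, of size \<open>\<eta> / 10\<close> each, are added to the chaining error
      \<open>\<eta>\<close>.\<close>
    ultimately have rk: "\<bar>int k' - int r\<bar> \<le> 2" unfolding fl r by linarith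
    have "k' \<le> 2 ^ L div 2 ^ (L - m)" unfolding k'_def using k by (rule div_le_mono)
    also have "(2::nat) ^ L div 2 ^ (L - m) = 2 ^ m" using mL by (simp flip: power_diff)
    finally have k'm: "k' \<le> 2 ^ m" .
    have rm: "r \<le> 2 ^ m"
    proof -
      have "2 ^ m * t \<le> 2 ^ m" using t01 by simp
      then have "\<lceil>2 ^ m * t\<rceil> \<le> 2 ^ m" by (simp add: ceiling_le_iff)
      then have "int r \<le> int (2 ^ m)" unfolding r by simp
      then show ?thesis by (simp only: of_nat_le_iff)
    qed
    have "\<bar>fluct a \<omega> (real k' / 2 ^ m) - V0\<bar> \<le> 2 * (\<eta> / 10)"
    proof (cases "r \<le> k'")
      case True
      then have "\<bar>fluct a \<omega> (real k' / 2 ^ m) - V0\<bar> \<le> real (k' - r) * (\<eta> / 10)"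
        unfolding V0_def using \<omega> k'm by (intro fluct_oscillation(2)[OF a0 _ \<eta> mL k]) auto
      also have "\<dots> \<le> 2 * (\<eta> / 10)" using rk True \<eta> by (intro mult_right_mono) auto
      finally show ?thesis .
    next
      case False
      then have "\<bar>V0 - fluct a \<omega> (real k' / 2 ^ m)\<bar> \<le> real (r - k') * (\<eta> / 10)"
        unfolding V0_def using \<omega> rm by (intro fluct_oscillation(2)[OF a0 _ \<eta> mL k]) auto
      also have "\<dots> \<le> 2 * (\<eta> / 10)" using rk False \<eta> by (intro mult_right_mono) auto
      finally show ?thesis by (simp add: abs_minus_commute)
    qed
    with osc \<eta> show ?thesis by linarith
  qed
  have nj: "\<bar>V j - V0\<bar> \<le> 2 * \<eta>" and ni: "\<bar>V i - V0\<bar> \<le> 2 * \<eta>"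
    using ut small(4) jL i unfolding u_def u'_def by (auto intro!: near)
  have b: "\<bar>s * (u - t) + V0\<bar> \<le> 2 * \<eta> + 1 / s" "\<bar>s * (u' - t) + V0\<bar> \<le> 2 * \<eta> + 1 / s"
    using lo hi suu sd s1 d0 nj ni by linarith+
  have h: "c \<le> hq t" "hq t > 0" using c t hq_pos by auto
  have approx: "\<bar>s * (quantile H v - quantile H t) + V0 / hq t\<bar> \<le> (2 * \<eta> + 1 / s) / c + \<gamma> * (K + 1)"
    if v: "0 < v" "v < 1" "\<bar>v - t\<bar> \<le> (K + 1) / sqrt a" "\<bar>s * (v - t)\<bar> \<le> K + 1"
      "\<bar>s * (v - t) + V0\<bar> \<le> 2 * \<eta> + 1 / s" for v
  proof -
    let ?e = "quantile H v - quantile H t - (v - t) / hq t"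
    have "\<bar>?e\<bar> \<le> \<gamma> * \<bar>v - t\<bar>" using v small(1) by (intro ex[OF t]) auto
    then have "s * \<bar>?e\<bar> \<le> s * (\<gamma> * \<bar>v - t\<bar>)" using s by (intro mult_left_mono) auto
    also have "\<dots> = \<gamma> * \<bar>s * (v - t)\<bar>" using s by (simp add: abs_mult)
    also have "\<dots> \<le> \<gamma> * (K + 1)" using v(4) \<gamma> by (intro mult_left_mono) auto
    finally have 1: "\<bar>s * ?e\<bar> \<le> \<gamma> * (K + 1)" using s by (simp add: abs_mult)
    have "\<bar>(s * (v - t) + V0) / hq t\<bar> = \<bar>s * (v - t) + V0\<bar> / hq t" using h by simp
    also have "\<dots> \<le> (2 * \<eta> + 1 / s) / c" using v(5) h c(1) \<eta> s by (intro frac_le) auto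
    finally have 2: "\<bar>(s * (v - t) + V0) / hq t\<bar> \<le> (2 * \<eta> + 1 / s) / c" .
    have "s * (quantile H v - quantile H t) + V0 / hq t = s * ?e + (s * (v - t) + V0) / hq t"
      by (simp add: right_diff_distrib add_divide_distrib)
    with 1 2 show ?thesis by linarith
  qed
  have "s * (quantile H u' - quantile H t) \<le> s * (quantile (P a \<omega>) t - quantile H t)"
    "s * (quantile (P a \<omega>) t - quantile H t) \<le> s * (quantile H u - quantile H t)"
    using x_lo x_hi s by (intro mult_left_mono; simp)+
  moreover have "\<bar>s * (quantile H u' - quantile H t) + V0 / hq t\<bar> \<le> (2 * \<eta> + 1 / s) / c + \<gamma> * (K + 1)"
    "\<bar>s * (quantile H u - quantile H t) + V0 / hq t\<bar> \<le> (2 * \<eta> + 1 / s) / c + \<gamma> * (K + 1)"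
    using u01 ut K1 b by (auto intro!: approx)
  ultimately have "\<bar>s * (quantile (P a \<omega>) t - quantile H t) + V0 / hq t\<bar> \<le> (2 * \<eta> + 1 / s) / c + \<gamma> * (K + 1)"
    by linarith
  then show ?thesis by (simp only: s_def V0_def r_def)
qed

text \<open>The level \<open>m\<close> is fixed before \<open>a\<close> and controls the oscillation
  event; the finest level \<open>L\<close> follows \<open>a\<close>. The bound \<open>K\<close> on
  the whole process, chosen first, determines how accurate the quantile expansion must be.\<close>

lemma quantile_process_approx:
  assumes e: "e > 0" and \<zeta>: "\<zeta> > 0"
  obtains m0 where "\<And>m. m \<ge> m0 \<Longrightarrow> \<forall>\<^sub>F a in at_top. \<exists>A\<in>sets (M a). measure (M a) A \<le> \<zeta> \<and>
     (\<forall>\<omega>\<in>space (M a) - A. \<forall>t\<in>{p..q}.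
       \<bar>sqrt a * (quantile (P a \<omega>) t - quantile H t) + fluct a \<omega> (real (nat \<lceil>2 ^ m * t\<rceil>) / 2 ^ m) / hq t\<bar> \<le> e)"
proof -
  obtain c where c: "c > 0" "\<And>t. t \<in> {p..q} \<Longrightarrow> c \<le> hq t" using hq_lower_bound by blast
  \<comment> \<open>The error budget: \<open>3 * \<eta> / c = 3 * e / 8\<close> from oscillation and
    grid, \<open>\<gamma> * (K + 1) = e / 2\<close> from the quantile expansion.\<close>
  define \<eta> where "\<eta> = e * c / 8"
  have \<eta>: "\<eta> > 0" using e c by (simp add: \<eta>_def)
  \<comment> \<open>Twice the constant of \<open>bad_event_prob\<close> over \<open>\<zeta>\<close>;
    \<open>K \<ge> 1\<close> gives \<open>K \<le> K ^ 4\<close>.\<close>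
  define K where "K = max 1 (1500000 / \<zeta>)"
  have K: "K \<ge> 1" "1500000 / \<zeta> \<le> K" by (auto simp: K_def)
  have KB: "750000 / (2 ^ 0 * K ^ 4) \<le> \<zeta> / 2"
  proof -
    have "K ^ 1 \<le> K ^ 4" using K by (intro power_increasing) auto
    then have "1500000 / \<zeta> \<le> K ^ 4" using K by simp
    then have "1500000 \<le> \<zeta> * K ^ 4" using \<zeta> by (simp add: field_simps)
    then show ?thesis using K by (simp add: divide_le_eq)
  qed
  define \<gamma> where "\<gamma> = e / (2 * (K + 1))"
  have \<gamma>: "\<gamma> > 0" using e K by (simp add: \<gamma>_def)
  obtain \<delta> where \<delta>: "\<delta> > 0" "\<And>t u. t \<in> {p..q} \<Longrightarrow> 0 < u \<Longrightarrow> u < 1 \<Longrightarrow> \<bar>u - t\<bar> \<le> \<delta> \<Longrightarrow>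
       \<bar>quantile H u - quantile H t - (u - t) / hq t\<bar> \<le> \<gamma> * \<bar>u - t\<bar>"
    using quantile_expansion[OF pq H H_cont \<epsilon> deriv h_pos h_cont \<gamma>] by blast
  obtain m0 :: nat where m0: "1500000 / (\<zeta> * \<eta> ^ 4) < 2 ^ m0"
    using real_arch_pow[of 2 "1500000 / (\<zeta> * \<eta> ^ 4)"] by auto
  have lim: "((\<lambda>a. x / sqrt a) \<longlongrightarrow> 0) at_top" for x
    by (intro tendsto_divide_0[OF tendsto_const] filterlim_at_top_imp_at_infinity sqrt_at_top)
  show ?thesis
  proof (rule that[of m0])
    fix m assume m: "m \<ge> m0"
    have mB: "750000 / (2 ^ m * \<eta> ^ 4) \<le> \<zeta> / 2"
    proof -
      have "(2::real) ^ m0 \<le> 2 ^ m" using m by (intro power_increasing) auto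
      then have "1500000 / (\<zeta> * \<eta> ^ 4) \<le> 2 ^ m" using m0 by linarith
      then have "1500000 \<le> 2 ^ m * (\<zeta> * \<eta> ^ 4)" using \<zeta> \<eta> by (simp add: divide_le_eq)
      then show ?thesis using \<eta> by (simp add: divide_le_eq mult_ac)
    qed
    \<comment> \<open>Combines the four smallness conditions of \<open>bahadur\<close>, all on
      \<open>(K + 1) / sqrt a\<close>.\<close>
    have "0 < min (min \<delta> (1 / 2 ^ m)) (min p (1 - q))" using \<delta>(1) pq by simp
    from order_tendstoD(2)[OF lim this, of "K + 1"] order_tendstoD(2)[OF lim \<eta>, of 1]
      eventually_ge_at_top[of 1] eventually_gt_at_top[of "2 ^ m"]
    show "\<forall>\<^sub>F a in at_top. \<exists>A\<in>sets (M a). measure (M a) A \<le> \<zeta> \<and>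
     (\<forall>\<omega>\<in>space (M a) - A. \<forall>t\<in>{p..q}.
       \<bar>sqrt a * (quantile (P a \<omega>) t - quantile H t) + fluct a \<omega> (real (nat \<lceil>2 ^ m * t\<rceil>) / 2 ^ m) / hq t\<bar> \<le> e)"
    proof eventually_elim
      case (elim a)
      have a0: "a > 0" using elim by simp
      interpret prob_space "M a" by (rule prob_M[OF a0])
      \<comment> \<open>Minimality gives \<open>2 ^ L \<le> 2 * a\<close>, the condition under which
        bad events are rare.\<close>
      define L where "L = (LEAST n. a \<le> 2 ^ n)"
      obtain n :: nat where n: "a < 2 ^ n" using real_arch_pow[of 2 a] by auto
      have aL: "a \<le> 2 ^ L" unfolding L_def by (rule LeastI[of "\<lambda>n. a \<le> 2 ^ n", OF less_imp_le[OF n]])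
      have "L \<noteq> 0"
      proof
        assume "L = 0"
        then have "a \<le> 1" using aL by simp
        moreover have "(1::real) \<le> 2 ^ m" by simp
        ultimately show False using elim by linarith
      qed
      then obtain l where l: "L = Suc l" by (cases L) auto
      have "\<not> a \<le> 2 ^ l" using not_less_Least[of l "\<lambda>n. a \<le> 2 ^ n"] l by (simp add: L_def)
      then have L2: "2 ^ L \<le> 2 * a" using l by simp
      have mL: "m \<le> L"
      proof (rule ccontr)
        assume "\<not> m \<le> L"
        then have "(2::real) ^ L \<le> 2 ^ m" by (intro power_increasing) auto
        then show False using aL elim by linarith
      qed
      let ?A = "bad_event a m L \<eta> \<union> bad_event a 0 L K"
      have K0: "K > 0" using K by simp
      note B1 = bad_event_prob[OF a0 L2 \<eta>, of m] and B2 = bad_event_prob[OF a0 L2 K0, of 0]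
      have "measure (M a) ?A \<le> measure (M a) (bad_event a m L \<eta>) + measure (M a) (bad_event a 0 L K)"
        by (rule measure_Un_le[OF B1(1) B2(1)])
      also have "\<dots> \<le> \<zeta>" using B1(2) B2(2) mB KB by linarith
      finally have mA: "measure (M a) ?A \<le> \<zeta>" .
      have "\<bar>sqrt a * (quantile (P a \<omega>) t - quantile H t) + fluct a \<omega> (real (nat \<lceil>2 ^ m * t\<rceil>) / 2 ^ m) / hq t\<bar> \<le> e"
        if \<omega>: "\<omega> \<in> space (M a) - ?A" and t: "t \<in> {p..q}" for \<omega> t
      proof -
        have "\<bar>sqrt a * (quantile (P a \<omega>) t - quantile H t) + fluct a \<omega> (real (nat \<lceil>2 ^ m * t\<rceil>) / 2 ^ m) / hq t\<bar>
            \<le> (2 * \<eta> + 1 / sqrt a) / c + \<gamma> * (K + 1)"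
          using \<omega> elim by (intro bahadur[OF _ aL mL _ _ _ \<eta> K0 \<gamma> _ _ _ _ \<delta>(2) c t]) auto
        also have "\<dots> \<le> (2 * \<eta> + \<eta>) / c + \<gamma> * (K + 1)"
          using elim c by (intro add_right_mono divide_right_mono) auto
        also have "(2 * \<eta> + \<eta>) / c = 3 * e / 8" using c by (simp add: \<eta>_def)
        also have "\<gamma> * (K + 1) = e / 2"
        proof -
          have "e / (2 * x) * x = e / 2" if "x \<noteq> 0" for x using that by simp
          then show ?thesis unfolding \<gamma>_def by this (use K in linarith)
        qed
        also have "3 * e / 8 + e / 2 \<le> e" using e by simp
        finally show ?thesis .
      qed
      with mA B1(1) B2(1) show ?case by (intro bexI[of _ ?A]) auto
    qed
  qed
qed

section \<open>Step approximations and the limit in path space\<close>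

definition step_path :: "nat \<Rightarrow> (nat \<Rightarrow> real) \<Rightarrow> real \<Rightarrow> real" where
  "step_path m v = (\<lambda>t\<in>{p..q}. v (nat \<lceil>2 ^ m * t\<rceil>) * (- (1 / hq t)))"

lemma step_path_skorokhod: "step_path m v \<in> skorokhod_paths p q"
proof -
  have "continuous_on {p..q} (\<lambda>t. - (1 / hq t))"
    by (intro continuous_intros hq_cont) (use hq_nonzero in auto)
  from ceiling_step_skorokhod[of "2 ^ m" p q "\<lambda>t. - (1 / hq t)" "\<lambda>k. v (nat k)" 0, OF _ this]
  show ?thesis by (simp add: step_path_def)
qed

lemma step_index: "t \<in> {p..q} \<Longrightarrow> nat \<lceil>2 ^ m * t\<rceil> < Suc (2 ^ m)"
proof -
  assume t: "t \<in> {p..q}"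
  have "2 ^ m * t \<le> 2 ^ m" using t pq by simp
  then have "\<lceil>2 ^ m * t\<rceil> \<le> 2 ^ m" by (simp add: ceiling_le_iff)
  then show ?thesis by (simp add: nat_le_iff less_Suc_eq_le)
qed

text \<open>The identity time change suffices. The added \<open>e\<close> is there because
  \<open>skorokhod_close\<close> contains only positive numbers, while the sum may be 0.\<close>

lemma step_path_lipschitz:
  assumes c: "c > 0" "\<And>t. t \<in> {p..q} \<Longrightarrow> c \<le> hq t"
  shows "skorokhod_dist p q (step_path m v) (step_path m w) \<le> 1 / c * (\<Sum>k<Suc (2 ^ m). \<bar>v k - w k\<bar>)"
proof (rule field_le_epsilon)
  fix e :: real assume e: "e > 0"
  let ?S = "\<Sum>k<Suc (2 ^ m). \<bar>v k - w k\<bar>"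
  show "skorokhod_dist p q (step_path m v) (step_path m w) \<le> 1 / c * ?S + e"
  proof (rule skorokhod_dist_le_uniform)
    have "0 \<le> 1 / c * ?S" using c by (intro mult_nonneg_nonneg sum_nonneg) auto
    then show "0 < 1 / c * ?S + e" using e by linarith
    fix t assume t: "t \<in> {p..q}"
    let ?k = "nat \<lceil>2 ^ m * t\<rceil>"
    have "step_path m v t - step_path m w t = (v ?k - w ?k) * (- (1 / hq t))"
      using t by (simp add: step_path_def diff_divide_distrib)
    then have "\<bar>step_path m v t - step_path m w t\<bar> = 1 / hq t * \<bar>v ?k - w ?k\<bar>"
      using hq_pos[OF t] by (simp add: abs_mult)
    also have "\<dots> \<le> 1 / c * ?S"
      using c c(2)[OF t] step_index[OF t, of m] hq_pos[OF t]
      by (intro mult_mono member_le_sum divide_left_mono) auto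
    finally show "\<bar>step_path m v t - step_path m w t\<bar> \<le> 1 / c * ?S + e" using e by linarith
  qed
qed

lemma measurable_step_path:
  assumes "\<And>k. k < Suc (2 ^ m) \<Longrightarrow> (\<lambda>\<omega>. V \<omega> k) \<in> borel_measurable Q"
  shows "(\<lambda>\<omega>. step_path m (V \<omega>)) \<in> measurable Q (borel_of_topology (skorokhod_topology p q))"
proof (rule measurable_skorokhodI[OF pq(2) step_path_skorokhod])
  fix t assume t: "t \<in> {p..q}"
  show "(\<lambda>\<omega>. step_path m (V \<omega>) t) \<in> borel_measurable Q"
    using t assms[OF step_index[OF t]] by (simp add: step_path_def)
qed

lemma quantile_path_skorokhod:
  assumes a: "a > 0" and \<omega>: "\<omega> \<in> space (M a)"
  shows "quantile_process_path P H p q a \<omega> \<in> skorokhod_paths p q"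
  unfolding quantile_process_path_def
proof (rule restrict_skorokhodI)
  interpret F: real_distribution "P a \<omega>" by (rule real_distribution_P[OF a \<omega>])
  fix t
  show "((\<lambda>t. sqrt a * (quantile (P a \<omega>) t - quantile H t)) \<longlongrightarrow> sqrt a * (quantile (P a \<omega>) t - quantile H t)) (at_left t)"
    if "t \<in> {p<..q}"
    using that pq by (intro tendsto_intros F.quantile_tendsto_left H.quantile_tendsto_left) auto
  assume "t \<in> {p..<q}"
  then obtain l l' where "(quantile (P a \<omega>) \<longlongrightarrow> l) (at_right t)" "(quantile H \<longlongrightarrow> l') (at_right t)"
    using F.quantile_tendsto_right[of t] H.quantile_tendsto_right[of t] pq by auto
  then have "((\<lambda>t. sqrt a * (quantile (P a \<omega>) t - quantile H t)) \<longlongrightarrow> sqrt a * (l - l')) (at_right t)"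
    by (intro tendsto_intros)
  then show "\<exists>l. ((\<lambda>t. sqrt a * (quantile (P a \<omega>) t - quantile H t)) \<longlongrightarrow> l) (at_right t)" by blast
qed

lemma measurable_quantile_path:
  assumes a: "a > 0"
  shows "quantile_process_path P H p q a \<in> measurable (M a) (borel_of_topology (skorokhod_topology p q))"
proof (rule measurable_skorokhodI[OF pq(2) quantile_path_skorokhod[OF a]])
  fix t assume t: "t \<in> {p..q}"
  have "(\<lambda>\<omega>. quantile (P a \<omega>) t) \<in> borel_measurable (M a)"
  proof (subst borel_measurable_iff_le, intro allI)
    fix x
    have "{\<omega> \<in> space (M a). quantile (P a \<omega>) t \<le> x} = {\<omega> \<in> space (M a). t \<le> measure (P a \<omega>) {..x}}"
      using real_distribution.quantile_le_iff[OF real_distribution_P[OF a], of _ t x] t pq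
      by (auto simp: cdf_def)
    also have "\<dots> \<in> sets (M a)"
    proof -
      have [measurable]: "(\<lambda>\<omega>. measure (P a \<omega>) {..x}) \<in> borel_measurable (M a)"
        by (rule measurable_measure_P[OF a]) simp
      show ?thesis by measurable
    qed
    finally show "{\<omega> \<in> space (M a). quantile (P a \<omega>) t \<le> x} \<in> sets (M a)" .
  qed
  then show "(\<lambda>\<omega>. quantile_process_path P H p q a \<omega> t) \<in> borel_measurable (M a)"
    using t by (simp add: quantile_process_path_def)
qed

definition limit_path :: "(real \<Rightarrow> 'v \<Rightarrow> real) \<Rightarrow> 'v \<Rightarrow> real \<Rightarrow> real" where
  "limit_path B \<omega> = (\<lambda>t\<in>{p..q}. limit_process B h H t \<omega>)"

lemma limit_path_skorokhod:
  assumes "brownian_bridge N B" "\<omega> \<in> space N"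
  shows "limit_path B \<omega> \<in> skorokhod_paths p q"
proof -
  have "continuous_on {0..1} (\<lambda>t. B t \<omega>)" using assms by (auto simp: brownian_bridge_def)
  then have "continuous_on {p..q} (\<lambda>t. B t \<omega>)" by (rule continuous_on_subset) (use pq in auto)
  then have "continuous_on {p..q} (\<lambda>t. - (B t \<omega> / hq t))"
    by (intro continuous_intros hq_cont) (use hq_nonzero in auto)
  then show ?thesis unfolding limit_path_def limit_process_def by (rule continuous_skorokhod)
qed

lemma measurable_limit_path:
  assumes B: "brownian_bridge N B"
  shows "limit_path B \<in> measurable N (borel_of_topology (skorokhod_topology p q))"
proof (rule measurable_skorokhodI[OF pq(2) limit_path_skorokhod[OF B]])
  fix t assume t: "t \<in> {p..q}"
  then have "B t \<in> borel_measurable N"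
    using B pq by (auto simp: brownian_bridge_def gaussian_process_def)
  then show "(\<lambda>\<omega>. limit_path B \<omega> t) \<in> borel_measurable N"
    using t by (simp add: limit_path_def limit_process_def)
qed

text \<open>Bridge paths are uniformly continuous, so rounding time up to the dyadic grid changes
  them uniformly little; dividing by \<open>hq \<ge> c\<close> preserves this.\<close>

lemma step_path_limit:
  assumes B: "brownian_bridge N B" and \<omega>: "\<omega> \<in> space N"
  shows "(\<lambda>m. skorokhod_dist p q (step_path m (\<lambda>k. B (real k / 2 ^ m) \<omega>)) (limit_path B \<omega>)) \<longlonglongrightarrow> 0"
proof (rule LIMSEQ_I)
  fix e :: real assume e: "e > 0"
  obtain c where c: "c > 0" "\<And>t. t \<in> {p..q} \<Longrightarrow> c \<le> hq t" using hq_lower_bound by blast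
  have "continuous_on {0..1} (\<lambda>t. B t \<omega>)" using B \<omega> by (auto simp: brownian_bridge_def)
  then have "uniformly_continuous_on {0..1} (\<lambda>t. B t \<omega>)" by (simp add: compact_uniformly_continuous)
  moreover have "0 < c * e / 2" using c e by simp
  ultimately obtain \<delta> where \<delta>: "\<delta> > 0"
    "\<And>s t. s \<in> {0..1} \<Longrightarrow> t \<in> {0..1} \<Longrightarrow> dist t s < \<delta> \<Longrightarrow> dist (B t \<omega>) (B s \<omega>) < c * e / 2"
    unfolding uniformly_continuous_on_def by metis
  obtain m0 :: nat where m0: "1 / \<delta> < 2 ^ m0" using real_arch_pow[of 2 "1 / \<delta>"] by auto
  interpret Metric_space "skorokhod_paths p q" "skorokhod_dist p q" by (rule Metric_space_skorokhod)
  have "norm (skorokhod_dist p q (step_path m (\<lambda>k. B (real k / 2 ^ m) \<omega>)) (limit_path B \<omega>) - 0) < e"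
    if m: "m \<ge> m0" for m
  proof -
    have "(2::real) ^ m0 \<le> 2 ^ m" using m by (intro power_increasing) auto
    then have "1 / \<delta> < 2 ^ m" using m0 by linarith
    then have \<delta>m: "1 / 2 ^ m < \<delta>" using \<delta>(1) by (simp add: field_simps)
    have "skorokhod_dist p q (step_path m (\<lambda>k. B (real k / 2 ^ m) \<omega>)) (limit_path B \<omega>) \<le> e / 2"
    proof (rule skorokhod_dist_le_uniform)
      fix t assume t: "t \<in> {p..q}"
      let ?k = "nat \<lceil>2 ^ m * t\<rceil>"
      have rk: "real ?k = of_int \<lceil>2 ^ m * t\<rceil>" using t pq by simp
      have k1: "2 ^ m * t \<le> real ?k" "real ?k < 2 ^ m * t + 1" unfolding rk by linarith+
      have "t \<le> real ?k / 2 ^ m" "real ?k / 2 ^ m < t + 1 / 2 ^ m"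
        using k1 by (simp_all add: field_simps)
      moreover have "real ?k / 2 ^ m \<le> 1"
      proof -
        have "real ?k \<le> real (2 ^ m)" using step_index[OF t, of m] by (simp only: of_nat_le_iff less_Suc_eq_le)
        then show ?thesis by (simp add: divide_le_eq)
      qed
      ultimately have "dist (B (real ?k / 2 ^ m) \<omega>) (B t \<omega>) < c * e / 2"
        using t pq \<delta>m by (intro \<delta>(2)) (auto simp: dist_real_def)
      then have d: "\<bar>B (real ?k / 2 ^ m) \<omega> - B t \<omega>\<bar> \<le> c * e / 2" by (simp add: dist_real_def)
      have "step_path m (\<lambda>k. B (real k / 2 ^ m) \<omega>) t - limit_path B \<omega> t
          = (B (real ?k / 2 ^ m) \<omega> - B t \<omega>) * (- (1 / hq t))"
        using t by (simp add: step_path_def limit_path_def limit_process_def diff_divide_distrib)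
      then have "\<bar>step_path m (\<lambda>k. B (real k / 2 ^ m) \<omega>) t - limit_path B \<omega> t\<bar>
          = \<bar>B (real ?k / 2 ^ m) \<omega> - B t \<omega>\<bar> / hq t"
        using hq_pos[OF t] by (simp add: abs_mult)
      also have "\<dots> \<le> (c * e / 2) / c" using d c(1) c(2)[OF t] e by (intro frac_le) auto
      finally show "\<bar>step_path m (\<lambda>k. B (real k / 2 ^ m) \<omega>) t - limit_path B \<omega> t\<bar> \<le> e / 2"
        using c by simp
    qed (use e in simp)
    then show ?thesis using e nonneg by (simp add: abs_of_nonneg)
  qed
  then show "\<exists>no. \<forall>m\<ge>no. norm (skorokhod_dist p q (step_path m (\<lambda>k. B (real k / 2 ^ m) \<omega>)) (limit_path B \<omega>) - 0) < e"
    by blast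
qed

text \<open>Three comparisons at one fixed level \<open>m\<close>: the Bahadur representation
  replaces the quantile process by a step path, the finite-dimensional limit replaces
  \<open>fluct\<close> by bridge values, and path continuity removes the steps. Each costs at most
  \<open>e / 4\<close>.\<close>

lemma quantile_process_lipschitz_tendsto:
  assumes B: "brownian_bridge N B"
    and lip: "\<And>f g. f \<in> skorokhod_paths p q \<Longrightarrow> g \<in> skorokhod_paths p q \<Longrightarrow>
       \<bar>\<phi> f - \<phi> g\<bar> \<le> C * skorokhod_dist p q f g"
    and bd: "\<And>f. f \<in> skorokhod_paths p q \<Longrightarrow> \<bar>\<phi> f\<bar> \<le> D"
  shows "((\<lambda>a. \<integral>\<omega>. \<phi> (quantile_process_path P H p q a \<omega>) \<partial>M a) \<longlongrightarrow> (\<integral>\<omega>. \<phi> (limit_path B \<omega>) \<partial>N)) at_top"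
proof (rule tendstoI)
  fix e :: real assume e: "e > 0"
  have g: "gaussian_process N {0..1} B" using B by (simp add: brownian_bridge_def)
  interpret N: prob_space N using g by (simp add: gaussian_process_def)
  interpret S: Metric_space "skorokhod_paths p q" "skorokhod_dist p q" by (rule Metric_space_skorokhod)
  obtain c where c: "c > 0" "\<And>t. t \<in> {p..q} \<Longrightarrow> c \<le> hq t" using hq_lower_bound by blast
  have D: "D \<ge> 0" using bd[OF step_path_skorokhod[of 0 "\<lambda>_. 0"]] by linarith
  have lip': "\<bar>\<phi> f - \<phi> g\<bar> \<le> \<bar>C\<bar> * skorokhod_dist p q f g"
    if "f \<in> skorokhod_paths p q" "g \<in> skorokhod_paths p q" for f g
    using lip[OF that] mult_right_mono[OF abs_ge_self[of C] S.nonneg[of f g]] by linarith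
  have \<phi>m: "\<phi> \<in> borel_measurable (borel_of_topology (skorokhod_topology p q))"
    unfolding skorokhod_topology_def
    by (rule borel_measurable_continuous_map[OF S.continuous_map_lipschitz[of _ C]]) (rule lip)
  have u: "real k / 2 ^ m \<in> {0..1}" if "k < Suc (2 ^ m)" for k m
  proof -
    have "real k \<le> real (2 ^ m)" using that by (intro of_nat_mono) simp
    then show ?thesis by (simp add: divide_le_eq)
  qed
  let ?ZB = "\<lambda>m \<omega>. step_path m (\<lambda>k. B (real k / 2 ^ m) \<omega>)"
  let ?ZU = "\<lambda>m a \<omega>. step_path m (\<lambda>k. fluct a \<omega> (real k / 2 ^ m))"
  let ?X = "quantile_process_path P H p q"
  have ZB: "(\<lambda>\<omega>. \<phi> (?ZB m \<omega>)) \<in> borel_measurable N" for m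
    using gaussian_process_marginal(1)[OF g u] by (intro measurable_compose[OF measurable_step_path \<phi>m]) auto
  have ZU: "(\<lambda>\<omega>. \<phi> (?ZU m a \<omega>)) \<in> borel_measurable (M a)" if "a > 0" for a m
    using measurable_fluct[OF that] by (intro measurable_compose[OF measurable_step_path \<phi>m]) auto
  have Y: "(\<lambda>\<omega>. \<phi> (limit_path B \<omega>)) \<in> borel_measurable N"
    by (rule measurable_compose[OF measurable_limit_path[OF B] \<phi>m])
  have X: "(\<lambda>\<omega>. \<phi> (?X a \<omega>)) \<in> borel_measurable (M a)" if "a > 0" for a
    by (rule measurable_compose[OF measurable_quantile_path[OF that] \<phi>m])
  \<comment> \<open>\<open>e1\<close> bounds the uniform distance off the exceptional event and
    \<open>\<zeta>\<close> its probability; each contributes at most \<open>e / 8\<close>.\<close>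
  define e1 where "e1 = e / (8 * (\<bar>C\<bar> + 1))"
  define \<zeta> where "\<zeta> = e / (16 * (D + 1))"
  have cancel: "x * (e / (r * x)) = e / r" if "x \<noteq> 0" for x r :: real
    using that by simp
  have e1: "e1 > 0" "\<bar>C\<bar> * e1 \<le> e / 8"
  proof -
    show "e1 > 0" using e by (simp add: e1_def add_nonneg_pos)
    then have "\<bar>C\<bar> * e1 \<le> (\<bar>C\<bar> + 1) * e1" by (intro mult_right_mono) auto
    also have "\<dots> = e / 8" unfolding e1_def by (rule cancel) linarith
    finally show "\<bar>C\<bar> * e1 \<le> e / 8" .
  qed
  have \<zeta>: "\<zeta> > 0" "2 * D * \<zeta> \<le> e / 8"
  proof -
    show "\<zeta> > 0" using e D by (simp add: \<zeta>_def)
    then have "2 * D * \<zeta> \<le> 2 * ((D + 1) * \<zeta>)" by (simp add: algebra_simps)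
    also have "(D + 1) * \<zeta> = e / 16" unfolding \<zeta>_def using D by (intro cancel) linarith
    finally show "2 * D * \<zeta> \<le> e / 8" by simp
  qed
  obtain m0 where m0: "\<And>m. m \<ge> m0 \<Longrightarrow> \<forall>\<^sub>F a in at_top. \<exists>A\<in>sets (M a). measure (M a) A \<le> \<zeta> \<and>
     (\<forall>\<omega>\<in>space (M a) - A. \<forall>t\<in>{p..q}.
       \<bar>sqrt a * (quantile (P a \<omega>) t - quantile H t) + fluct a \<omega> (real (nat \<lceil>2 ^ m * t\<rceil>) / 2 ^ m) / hq t\<bar> \<le> e1)"
    using quantile_process_approx[OF e1(1) \<zeta>(1)] by blast
  have "(\<lambda>m. \<integral>\<omega>. \<phi> (?ZB m \<omega>) \<partial>N) \<longlonglongrightarrow> (\<integral>\<omega>. \<phi> (limit_path B \<omega>) \<partial>N)"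
  proof (rule integral_dominated_convergence[where w = "\<lambda>_. D"])
    show "AE \<omega> in N. (\<lambda>m. \<phi> (?ZB m \<omega>)) \<longlonglongrightarrow> \<phi> (limit_path B \<omega>)"
    proof (rule AE_I2)
      fix \<omega> assume \<omega>: "\<omega> \<in> space N"
      have "(\<lambda>m. \<bar>C\<bar> * skorokhod_dist p q (?ZB m \<omega>) (limit_path B \<omega>)) \<longlonglongrightarrow> \<bar>C\<bar> * 0"
        by (intro tendsto_intros step_path_limit[OF B \<omega>])
      then have "(\<lambda>m. \<bar>C\<bar> * skorokhod_dist p q (?ZB m \<omega>) (limit_path B \<omega>)) \<longlonglongrightarrow> 0" by simp
      then have "(\<lambda>m. \<phi> (?ZB m \<omega>) - \<phi> (limit_path B \<omega>)) \<longlonglongrightarrow> 0"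
        by (rule Lim_null_comparison[rotated])
          (use lip'[OF step_path_skorokhod limit_path_skorokhod[OF B \<omega>]] in auto)
      then show "(\<lambda>m. \<phi> (?ZB m \<omega>)) \<longlonglongrightarrow> \<phi> (limit_path B \<omega>)" by (simp add: LIM_zero_iff)
    qed
    show "AE \<omega> in N. norm (\<phi> (?ZB m \<omega>)) \<le> D" for m using bd[OF step_path_skorokhod] by simp
  qed (use Y ZB in auto)
  then have "\<forall>\<^sub>F m in sequentially. dist (\<integral>\<omega>. \<phi> (?ZB m \<omega>) \<partial>N) (\<integral>\<omega>. \<phi> (limit_path B \<omega>) \<partial>N) < e / 4"
    using e by (intro tendstoD) auto
  then obtain m1 where m1: "\<And>m. m \<ge> m1 \<Longrightarrow> dist (\<integral>\<omega>. \<phi> (?ZB m \<omega>) \<partial>N) (\<integral>\<omega>. \<phi> (limit_path B \<omega>) \<partial>N) < e / 4"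
    unfolding eventually_sequentially by blast
  define m where "m = max m0 m1"
  have "m \<ge> m0" by (simp add: m_def)
  note m0m = m0[OF this]
  have "((\<lambda>a. \<integral>\<omega>. \<phi> (?ZU m a \<omega>) \<partial>M a) \<longlongrightarrow> (\<integral>\<omega>. \<phi> (?ZB m \<omega>) \<partial>N)) at_top"
  proof (rule fluct_dyadic_weak[OF B, where \<psi> = "\<lambda>v. \<phi> (step_path m v)"])
    show "\<forall>\<^sub>F a in at_top. (\<lambda>\<omega>. \<phi> (?ZU m a \<omega>)) \<in> borel_measurable (M a)"
      using eventually_gt_at_top[of 0] by eventually_elim (rule ZU)
    fix v w :: "nat \<Rightarrow> real"
    have "\<bar>\<phi> (step_path m v) - \<phi> (step_path m w)\<bar> \<le> \<bar>C\<bar> * skorokhod_dist p q (step_path m v) (step_path m w)"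
      by (intro lip' step_path_skorokhod)
    also have "\<dots> \<le> \<bar>C\<bar> * (1 / c * (\<Sum>k<Suc (2 ^ m). \<bar>v k - w k\<bar>))"
      by (intro mult_left_mono step_path_lipschitz c) auto
    finally show "\<bar>\<phi> (step_path m v) - \<phi> (step_path m w)\<bar> \<le> (\<bar>C\<bar> * (1 / c)) * (\<Sum>k<Suc (2 ^ m). \<bar>v k - w k\<bar>)"
      by (simp only: mult.assoc)
  qed (use ZB bd step_path_skorokhod in auto)
  then have "\<forall>\<^sub>F a in at_top. dist (\<integral>\<omega>. \<phi> (?ZU m a \<omega>) \<partial>M a) (\<integral>\<omega>. \<phi> (?ZB m \<omega>) \<partial>N) < e / 4"
    using e by (intro tendstoD) auto
  from m0m this show "\<forall>\<^sub>F a in at_top. dist (\<integral>\<omega>. \<phi> (?X a \<omega>) \<partial>M a) (\<integral>\<omega>. \<phi> (limit_path B \<omega>) \<partial>N) < e"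
    using eventually_gt_at_top[of 0]
  proof eventually_elim
    case (elim a)
    interpret Q: prob_space "M a" by (rule prob_M[OF elim(3)])
    obtain A where A: "A \<in> sets (M a)" "measure (M a) A \<le> \<zeta>"
      "\<And>\<omega> t. \<omega> \<in> space (M a) - A \<Longrightarrow> t \<in> {p..q} \<Longrightarrow>
       \<bar>sqrt a * (quantile (P a \<omega>) t - quantile H t) + fluct a \<omega> (real (nat \<lceil>2 ^ m * t\<rceil>) / 2 ^ m) / hq t\<bar> \<le> e1"
      using elim(1) by blast
    have iX: "integrable (M a) (\<lambda>\<omega>. \<phi> (?X a \<omega>))"
      using X[OF elim(3)] bd quantile_path_skorokhod[OF elim(3)]
      by (intro Q.integrable_const_bound[of _ D] AE_I2) auto
    have iZ: "integrable (M a) (\<lambda>\<omega>. \<phi> (?ZU m a \<omega>))"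
      using ZU[OF elim(3)] bd step_path_skorokhod
      by (intro Q.integrable_const_bound[of _ D] AE_I2) auto
    have pw: "\<bar>\<phi> (?X a \<omega>) - \<phi> (?ZU m a \<omega>)\<bar> \<le> \<bar>C\<bar> * e1 + 2 * D * indicator A \<omega>"
      if \<omega>: "\<omega> \<in> space (M a)" for \<omega>
    proof (cases "\<omega> \<in> A")
      case True
      have "\<bar>\<phi> (?X a \<omega>) - \<phi> (?ZU m a \<omega>)\<bar> \<le> 2 * D"
        using bd[OF quantile_path_skorokhod[OF elim(3) \<omega>]] bd[OF step_path_skorokhod[of m "\<lambda>k. fluct a \<omega> (real k / 2 ^ m)"]]
        by linarith
      moreover have "0 \<le> \<bar>C\<bar> * e1" using e1 by simp
      ultimately show ?thesis using True by simp
    next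
      case False
      have "skorokhod_dist p q (?X a \<omega>) (?ZU m a \<omega>) \<le> e1"
      proof (rule skorokhod_dist_le_uniform[OF e1(1)])
        fix t assume t: "t \<in> {p..q}"
        have "?X a \<omega> t - ?ZU m a \<omega> t
          = sqrt a * (quantile (P a \<omega>) t - quantile H t) + fluct a \<omega> (real (nat \<lceil>2 ^ m * t\<rceil>) / 2 ^ m) / hq t"
          using t by (simp add: quantile_process_path_def step_path_def)
        then show "\<bar>?X a \<omega> t - ?ZU m a \<omega> t\<bar> \<le> e1" using A(3)[OF _ t, of \<omega>] \<omega> False by simp
      qed
      then have "\<bar>C\<bar> * skorokhod_dist p q (?X a \<omega>) (?ZU m a \<omega>) \<le> \<bar>C\<bar> * e1" by (intro mult_left_mono) auto
      then show ?thesis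
        using lip'[OF quantile_path_skorokhod[OF elim(3) \<omega>] step_path_skorokhod[of m "\<lambda>k. fluct a \<omega> (real k / 2 ^ m)"]] False
        by simp
    qed
    have "\<bar>(\<integral>\<omega>. \<phi> (?X a \<omega>) \<partial>M a) - (\<integral>\<omega>. \<phi> (?ZU m a \<omega>) \<partial>M a)\<bar> = \<bar>\<integral>\<omega>. \<phi> (?X a \<omega>) - \<phi> (?ZU m a \<omega>) \<partial>M a\<bar>"
      using iX iZ by simp
    also have "\<dots> \<le> (\<integral>\<omega>. \<bar>\<phi> (?X a \<omega>) - \<phi> (?ZU m a \<omega>)\<bar> \<partial>M a)" by (rule integral_abs_bound)
    also have "\<dots> \<le> (\<integral>\<omega>. \<bar>C\<bar> * e1 + 2 * D * indicator A \<omega> \<partial>M a)"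
      using iX iZ A(1) by (intro integral_mono pw Bochner_Integration.integrable_add integrable_mult_right) 
        (auto simp: Q.emeasure_eq_measure)
    also have "\<dots> = \<bar>C\<bar> * e1 + 2 * D * measure (M a) A"
      using A(1) by (subst Bochner_Integration.integral_add) (auto simp: Q.prob_space Q.emeasure_eq_measure)
    also have "\<dots> \<le> e / 8 + 2 * D * \<zeta>" using e1(2) A(2) D by (intro add_mono mult_left_mono) auto
    also have "\<dots> \<le> e / 4" using \<zeta>(2) by simp
    finally have "\<bar>(\<integral>\<omega>. \<phi> (?X a \<omega>) \<partial>M a) - (\<integral>\<omega>. \<phi> (?ZU m a \<omega>) \<partial>M a)\<bar> \<le> e / 4" .
    moreover have "dist (\<integral>\<omega>. \<phi> (?ZB m \<omega>) \<partial>N) (\<integral>\<omega>. \<phi> (limit_path B \<omega>) \<partial>N) < e / 4"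
      by (rule m1) (simp add: m_def)
    ultimately show ?case using elim(2) e unfolding dist_real_def by linarith
  qed
qed

lemma quantile_process_convergence:
  assumes B: "brownian_bridge N B"
  shows "converges_in_distribution (skorokhod_topology p q) M (quantile_process_path P H p q) N (limit_path B) at_top"
proof (rule Metric_space.weak_convergence_from_lipschitz[OF Metric_space_skorokhod, folded skorokhod_topology_def])
  show "\<forall>\<^sub>F a in at_top. prob_space (M a) \<and>
      quantile_process_path P H p q a \<in> measurable (M a) (borel_of_topology (skorokhod_topology p q))"
    using eventually_gt_at_top[of 0]
  proof eventually_elim
    case (elim a)
    then show ?case using prob_M measurable_quantile_path by blast
  qed
  show "prob_space N" using B by (simp add: brownian_bridge_def gaussian_process_def)
qed (use B measurable_limit_path quantile_process_lipschitz_tendsto in blast)+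

lemma limit_process_facts:
  assumes B: "brownian_bridge N B"
  shows "gaussian_process N {p..q} (limit_process B h H)"
    and "\<And>t. t \<in> {p..q} \<Longrightarrow> (\<integral>\<omega>. limit_process B h H t \<omega> \<partial>N) = 0"
    and "\<And>s t. s \<in> {p..q} \<Longrightarrow> t \<in> {p..q} \<Longrightarrow>
      covariance N (limit_process B h H s) (limit_process B h H t) = (min s t - s * t) / (hq s * hq t)"
proof -
  have g: "gaussian_process N {0..1} B" using B by (simp add: brownian_bridge_def)
  have sub: "{p..q} \<subseteq> {0..1}" using pq by auto
  have L: "limit_process B h H t \<omega> = - (1 / hq t) * B t \<omega>" for t \<omega> by (simp add: limit_process_def)
  show "gaussian_process N {p..q} (limit_process B h H)"
    unfolding gaussian_process_def
  proof (intro conjI ballI allI impI)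
    show "prob_space N" using g by (simp add: gaussian_process_def)
    fix t assume "t \<in> {p..q}"
    then have "B t \<in> borel_measurable N" using g sub by (auto simp: gaussian_process_def)
    then show "limit_process B h H t \<in> borel_measurable N" unfolding limit_process_def[abs_def] by measurable
  next
    fix I and c :: "real \<Rightarrow> real" assume I: "finite I \<and> I \<subseteq> {p..q}"
    have eq: "(\<Sum>t\<in>I. c t * limit_process B h H t \<omega>) = (\<Sum>t\<in>I. (c t * - (1 / hq t)) * B t \<omega>)" for \<omega>
      unfolding L by (simp only: mult.assoc)
    show "\<exists>\<mu> \<sigma>. \<sigma> \<ge> 0 \<and> distr N borel (\<lambda>\<omega>. \<Sum>t\<in>I. c t * limit_process B h H t \<omega>) = normal_distribution \<mu> \<sigma>"
    proof -
      have "I \<subseteq> {0..1}" using I sub by blast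
      with I show ?thesis
        unfolding eq by (intro gaussian_processD[OF g]) auto
    qed
  qed
  show mean: "(\<integral>\<omega>. limit_process B h H t \<omega> \<partial>N) = 0" if "t \<in> {p..q}" for t
  proof -
    have "(\<integral>\<omega>. B t \<omega> \<partial>N) = 0" using B that sub by (auto simp: brownian_bridge_def)
    then show ?thesis unfolding L by (simp only: integral_mult_right_zero mult_zero_right)
  qed
  fix s t assume st: "s \<in> {p..q}" "t \<in> {p..q}"
  have "covariance N (limit_process B h H s) (limit_process B h H t)
      = (\<integral>\<omega>. (1 / (hq s * hq t)) * (B s \<omega> * B t \<omega>) \<partial>N)"
    unfolding covariance_def mean[OF st(1)] mean[OF st(2)] by (simp add: limit_process_def)
  also have "\<dots> = (1 / (hq s * hq t)) * (min s t - s * t)"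
    using brownian_bridge_moments(2)[OF B] st sub by (subst integral_mult_right_zero) auto
  finally show "covariance N (limit_process B h H s) (limit_process B h H t) = (min s t - s * t) / (hq s * hq t)"
    by simp
qed

end

text \<open>Continuity of \<open>h\<close> serves twice: it makes the quantile expansion uniform in
  \<open>t\<close>, and it puts the paths of the limit process into \<open>skorokhod_paths\<close>.
  The spaces \<open>M a\<close> may differ, as only the laws matter.\<close>

theorem corollary1:
  fixes H :: "real measure" and h :: "real \<Rightarrow> real" and p q \<epsilon> :: real
    and M :: "real \<Rightarrow> 'w measure" and P :: "real \<Rightarrow> 'w \<Rightarrow> real measure"
    and N :: "'v measure" and B :: "real \<Rightarrow> 'v \<Rightarrow> real"
  assumes "0 < p" "p < q" "q < 1"
    and "real_distribution H"
    and "continuous_on UNIV (cdf H)"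
    and "\<epsilon> > 0"
    and "\<And>x. x \<in> {quantile H p - \<epsilon>..quantile H q + \<epsilon>} \<Longrightarrow>
           (cdf H has_real_derivative h x) (at x within {quantile H p - \<epsilon>..quantile H q + \<epsilon>})"
    and "\<And>x. x \<in> {quantile H p - \<epsilon>..quantile H q + \<epsilon>} \<Longrightarrow> h x > 0"
    and "continuous_on {quantile H p..quantile H q} h"
    and "\<And>a. a > 0 \<Longrightarrow> dirichlet_process (M a) a H (P a)"
    and "brownian_bridge N B"
  shows "converges_in_distribution (skorokhod_topology p q)
           M (quantile_process_path P H p q)
           N (\<lambda>\<omega>. \<lambda>t\<in>{p..q}. limit_process B h H t \<omega>) at_top \<and>
         gaussian_process N {p..q} (limit_process B h H) \<and>
         (\<forall>t\<in>{p..q}. (\<integral>\<omega>. limit_process B h H t \<omega> \<partial>N) = 0) \<and>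
         (\<forall>s\<in>{p..q}. \<forall>t\<in>{p..q}.
           covariance N (limit_process B h H s) (limit_process B h H t) =
             (min s t - s * t) / (h (quantile H s) * h (quantile H t)))"
proof -
  interpret dirichlet_quantile H M P h p q \<epsilon>
    by (intro dirichlet_quantile.intro dirichlet_family.intro dirichlet_quantile_axioms.intro) (rule assms; assumption)+
  show ?thesis
    by (intro conjI ballI quantile_process_convergence[OF assms(11), unfolded limit_path_def[abs_def]]
        limit_process_facts[OF assms(11)])
qed

end
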